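(* Let $k$ be a natural number and let $G$ be a finite group. Then the following statements are equivalent. (1) Every subgroup of $G$ is $k$-submodular in $G$. (2) For every subgroup $A$ of $G$, every maximal subgroup of $A$ is $k$-submodular in $A$. (3) $G$ is supersoluble and for every chief factor $H/K$ of $G$, the group $G/C_G(H/K)$ is either trivial or cyclic of order $q^n$ for some prime $q$ and some natural number $n\le k$. (4) $G$ is a $k$-$\mathrm{LM}$-group.
   Context: All groups are finite; natural numbers are positive integers. $\mathrm{Core}_G(H)$ denotes the intersection of all conjugates of $H$ in $G$. For a natural number $n$, a subgroup $H$ of $G$ is $n$-modularly embedded in $G$ if either $H\unlhd G$, or $G/\mathrm{Core}_G(H)$ is a non-nilpotent group of order $pq^n$ with $|G:H|=p$ for some primes $p$ and $q$. For a natural number $k$, a subgroup $H$ of $G$ is $k$-submodular in $G$ if there is a chain of subgroups $H=H_0\le H_1\le\cdots\le H_m=G$ such that for every $i=1,\dots,m$, $H_{i-1}$ is $n_i$-modularly embedded in $H_i$ for some natural number $n_i\le k$. $C_G(H/K)$ is the centralizer in $G$ of the chief factor $H/K$ under the conjugation action. $n$-maximal subgroups: $G$ is the $0$-maximal subgroup of $G$, and for $n\ge1$ a subgroup $M$ is $n$-maximal in $G$ if $M$ is a maximal subgroup of some $(n-1)$-maximal subgroup of $G$. $G$ is a $k$-$\mathrm{LM}$-group if for every pair of subgroups $A,B$ of $G$ with $A$ maximal in $\langle A,B\rangle$, there are a prime $q$ and a natural number $n\le k$ such that $A\cap B$ is an $n$-maximal subgroup of $B$ and $|B:A\cap B|=q^n$.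 *)

theory Defs
  imports "HOL-Algebra.Algebra" "HOL-Computational_Algebra.Primes"
begin

(* HOL-Algebra's Divisibility has its own constant "prime"; here "prime" is a prime number. *)
hide_const (open) Divisibility.prime

text \<open>
  A subgroup \<open>A\<close> of \<open>G\<close>, regarded as a group in its own right, is \<open>G\<lparr>carrier := A\<rparr>\<close>;
  the index of \<open>H\<close> in \<open>G\<close> is \<open>card (rcosets\<^bsub>G\<^esub> H)\<close>.
\<close>

definition core :: "('a, 'b) monoid_scheme \<Rightarrow> 'a set \<Rightarrow> 'a set" where
  "core G H = (\<Inter>g\<in>carrier G. (g <#\<^bsub>G\<^esub> H) #>\<^bsub>G\<^esub> inv\<^bsub>G\<^esub> g)"

primrec lower_central :: "('a, 'b) monoid_scheme \<Rightarrow> nat \<Rightarrow> 'a set" where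
  "lower_central G 0 = carrier G"
| "lower_central G (Suc n) = generate G
     (\<Union>x\<in>lower_central G n. \<Union>y\<in>carrier G. {x \<otimes>\<^bsub>G\<^esub> y \<otimes>\<^bsub>G\<^esub> inv\<^bsub>G\<^esub> x \<otimes>\<^bsub>G\<^esub> inv\<^bsub>G\<^esub> y})"

definition nilpotent_group :: "('a, 'b) monoid_scheme \<Rightarrow> bool" where
  "nilpotent_group G \<longleftrightarrow> (\<exists>n. lower_central G n = {\<one>\<^bsub>G\<^esub>})"

definition supersoluble :: "('a, 'b) monoid_scheme \<Rightarrow> bool" where
  "supersoluble G \<longleftrightarrow> (\<exists>(N :: nat \<Rightarrow> 'a set) m.
     N 0 = {\<one>\<^bsub>G\<^esub>} \<and> N m = carrier G \<and> (\<forall>i\<le>m. N i \<lhd> G) \<and>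
     (\<forall>i<m. N i \<subseteq> N (Suc i) \<and> cyclic_group (G\<lparr>carrier := N (Suc i)\<rparr> Mod N i)))"

definition chief_factor :: "('a, 'b) monoid_scheme \<Rightarrow> 'a set \<Rightarrow> 'a set \<Rightarrow> bool" where
  "chief_factor G H K \<longleftrightarrow> H \<lhd> G \<and> K \<lhd> G \<and> K \<subset> H \<and>
     (\<forall>N. N \<lhd> G \<longrightarrow> K \<subseteq> N \<longrightarrow> N \<subseteq> H \<longrightarrow> N = K \<or> N = H)"

definition factor_centralizer :: "('a, 'b) monoid_scheme \<Rightarrow> 'a set \<Rightarrow> 'a set \<Rightarrow> 'a set" where
  "factor_centralizer G H K = {g \<in> carrier G.
     \<forall>S\<in>carrier (G\<lparr>carrier := H\<rparr> Mod K). (g <#\<^bsub>G\<^esub> S) #>\<^bsub>G\<^esub> inv\<^bsub>G\<^esub> g = S}"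

definition maximal_subgroup :: "('a, 'b) monoid_scheme \<Rightarrow> 'a set \<Rightarrow> bool" where
  "maximal_subgroup G M \<longleftrightarrow> subgroup M G \<and> M \<noteq> carrier G \<and>
     (\<forall>L. subgroup L G \<longrightarrow> M \<subseteq> L \<longrightarrow> L = M \<or> L = carrier G)"

primrec n_maximal :: "('a, 'b) monoid_scheme \<Rightarrow> nat \<Rightarrow> 'a set \<Rightarrow> bool" where
  "n_maximal G 0 M \<longleftrightarrow> M = carrier G"
| "n_maximal G (Suc n) M \<longleftrightarrow> (\<exists>L. n_maximal G n L \<and> maximal_subgroup (G\<lparr>carrier := L\<rparr>) M)"

definition modularly_embedded :: "nat \<Rightarrow> ('a, 'b) monoid_scheme \<Rightarrow> 'a set \<Rightarrow> bool" where
  "modularly_embedded n G H \<longleftrightarrow> subgroup H G \<and>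
     (H \<lhd> G \<or>
      (\<exists>p q :: nat. prime p \<and> prime q \<and> \<not> nilpotent_group (G Mod core G H) \<and>
         order (G Mod core G H) = p * q ^ n \<and> card (rcosets\<^bsub>G\<^esub> H) = p))"

definition submodular :: "nat \<Rightarrow> ('a, 'b) monoid_scheme \<Rightarrow> 'a set \<Rightarrow> bool" where
  "submodular k G H \<longleftrightarrow> (\<exists>(C :: nat \<Rightarrow> 'a set) m.
     C 0 = H \<and> C m = carrier G \<and> (\<forall>i\<le>m. subgroup (C i) G) \<and>
     (\<forall>i<m. C i \<subseteq> C (Suc i) \<and>
        (\<exists>n. 1 \<le> n \<and> n \<le> k \<and> modularly_embedded n (G\<lparr>carrier := C (Suc i)\<rparr>) (C i))))"

definition LM_group :: "nat \<Rightarrow> ('a, 'b) monoid_scheme \<Rightarrow> bool" where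
  "LM_group k G \<longleftrightarrow> (\<forall>A B. subgroup A G \<longrightarrow> subgroup B G \<longrightarrow>
     maximal_subgroup (G\<lparr>carrier := generate G (A \<union> B)\<rparr>) A \<longrightarrow>
     (\<exists>(q :: nat) n. prime q \<and> 1 \<le> n \<and> n \<le> k \<and>
        n_maximal (G\<lparr>carrier := B\<rparr>) n (A \<inter> B) \<and>
        card (rcosets\<^bsub>G\<lparr>carrier := B\<rparr>\<^esub> (A \<inter> B)) = q ^ n))"

end

theory Submission
  imports Defs "HOL-Number_Theory.Residue_Primitive_Roots"
begin

text \<open>
  The proof links all four conditions to a statement about pairs: every maximal subgroup \<open>M\<close> of every subgroup
  \<open>A\<close> is \<open>n\<close>-modularly embedded in \<open>A\<close> for some \<open>n \<le> k\<close>. For maximal subgroups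
  of \<open>A\<close> this is submodularity in \<open>A\<close>, and composing chains makes all subgroups submodular. If, conversely,
  all subgroups are submodular, then this holds because a chain from \<open>M\<close> to \<open>G\<close> meets \<open>A\<close> only in \<open>M\<close> and in \<open>A\<close>, so that a single step \<open>E \<subseteq> D\<close> with \<open>E \<inter> A = M\<close> and \<open>A \<subseteq> D\<close> decides
  (\<open>submodular_maximal_in_subgroup\<close>). In such a step with \<open>E\<close> not normal, any subgroup of \<open>D\<close> either permutes the \<open>p\<close>
  cosets of \<open>E\<close> transitively or is a \<open>q\<close>-group modulo the core (\<open>modularly_embedded_dichotomy\<close>); the same
  alternative, applied to \<open>B\<close> and a maximal subgroup \<open>A\<close> of the join of \<open>A\<close> and \<open>B\<close>, gives the LM-condition.

  Supersolubility comes from a weaker property \<open>P\<close>, shared by groups with the pair property and by LM-groups: in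
  every subgroup, maximal subgroups have prime index. For a chief factor \<open>N/J\<close> with centralizer \<open>C\<close>, take a
  maximal subgroup \<open>M\<close> above \<open>J\<close> with \<open>C\<close> not inside \<open>M\<close>. Then \<open>MC = G\<close>, so \<open>M\<close>-invariant subgroups between \<open>J\<close> and
  \<open>N\<close> are normal in \<open>G\<close>, and \<open>|N : J|\<close> is prime by induction (\<open>chief_factor_prime_order\<close>). Such an \<open>M\<close> exists because
  the Sylow subgroup of \<open>G/J\<close> for the largest prime is normal, centralizes \<open>N/J\<close>, and is not contained in the
  Frattini subgroup (\<open>normal_Sylow_of_largest_prime\<close>, \<open>chief_factor_centralized\<close>, \<open>normal_Sylow_not_Frattini\<close>).

  Once \<open>|N : J| = p\<close> is prime, \<open>G/C\<close> is cyclic, generated by some \<open>g\<close>. If \<open>C \<noteq> G\<close>, then \<open>M = J\<langle>g\<rangle>\<close> is a maximal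
  subgroup of \<open>N\<langle>g\<rangle>\<close> of index \<open>p\<close>, with core \<open>M \<inter> C\<close>, and \<open>|M : M \<inter> C| = |G : C|\<close> (\<open>noncentral_factor_witness\<close>). The
  modular embedding of \<open>M\<close>, or the LM-condition for \<open>M\<close> and one of its conjugates, makes this index a
  prime power \<open>q\<^sup>n\<close> with \<open>1 \<le> n \<le> k\<close>.

  Conversely, the condition on chief factors yields a normal series with factors of prime order and centralizers
  of prime power index; such a series can be intersected with a subgroup \<open>A\<close>, and the factor of the resulting series at which
  a maximal subgroup \<open>M\<close> of \<open>A\<close> stops containing the terms exhibits the modular embedding of \<open>M\<close>
  (\<open>maximal_modularly_embedded_if_good_series\<close>).

  Inductions run over subgroups of one group. Quotients \<open>G/J\<close> are replaced by statements about subgroups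
  containing \<open>J\<close> and about orders, since a quotient has another element type than the group itself.
\<close>

section \<open>Subgroups of finite groups\<close>

locale finite_group = group +
  assumes finite_carrier [simp]: "finite (carrier G)"

context finite_group
begin

lemma finite_subgroup [simp]: "subgroup H G \<Longrightarrow> finite H"
  using finite_subset[OF subgroup.subset finite_carrier] .

lemma card_subgroup_pos: "subgroup H G \<Longrightarrow> 0 < card H"
  using subgroup.finite_imp_card_positive finite_carrier by blast

lemma finite_group_subgroup: "subgroup A G \<Longrightarrow> finite_group (G\<lparr>carrier := A\<rparr>)"
  by (simp add: finite_group_def finite_group_axioms_def subgroup_imp_group)

lemma subgroup_carrier_iff:
  assumes "subgroup A G"
  shows "subgroup H (G\<lparr>carrier := A\<rparr>) \<longleftrightarrow> subgroup H G \<and> H \<subseteq> A"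
proof
  assume H: "subgroup H (G\<lparr>carrier := A\<rparr>)"
  show "subgroup H G \<and> H \<subseteq> A"
    using incl_subgroup[OF assms H] subgroup.subset[OF H] by simp
qed (use assms subgroup_incl in blast)

lemma normal_iff: "N \<lhd> G \<longleftrightarrow> subgroup N G \<and> (\<forall>x\<in>carrier G. \<forall>h\<in>N. x \<otimes> h \<otimes> inv x \<in> N)"
  by (rule normal_inv_iff)

lemma normal_carrier_iff:
  assumes A: "subgroup A G"
  shows "N \<lhd> (G\<lparr>carrier := A\<rparr>) \<longleftrightarrow>
    subgroup N G \<and> N \<subseteq> A \<and> (\<forall>x\<in>A. \<forall>h\<in>N. x \<otimes> h \<otimes> inv x \<in> N)"
proof -
  interpret A: finite_group "G\<lparr>carrier := A\<rparr>" by (rule finite_group_subgroup[OF A])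
  show ?thesis
    unfolding A.normal_iff subgroup_carrier_iff[OF A] using m_inv_consistent[OF A] by auto
qed

lemma maximal_subgroup_carrier_iff:
  assumes A: "subgroup A G"
  shows "maximal_subgroup (G\<lparr>carrier := A\<rparr>) M \<longleftrightarrow> subgroup M G \<and> M \<subset> A \<and>
    (\<forall>L. subgroup L G \<longrightarrow> M \<subseteq> L \<longrightarrow> L \<subseteq> A \<longrightarrow> L = M \<or> L = A)"
  unfolding maximal_subgroup_def subgroup_carrier_iff[OF A] by auto

lemma index_mult: "subgroup H G \<Longrightarrow> card (rcosets H) * card H = order G"
  by (rule lagrange)

lemma index_mult_carrier:
  assumes "subgroup A G" "subgroup H G" "H \<subseteq> A"
  shows "card (rcosets\<^bsub>G\<lparr>carrier := A\<rparr>\<^esub> H) * card H = card A"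
  using group.lagrange[OF subgroup_imp_group[OF assms(1)], of H] assms
  by (simp add: subgroup_carrier_iff order_def)

lemma card_subgroup_dvd:
  assumes "subgroup A G" "subgroup H G" "H \<subseteq> A"
  shows "card H dvd card A"
  using index_mult_carrier[OF assms] by (metis dvd_triv_right)

lemma index_pos: "subgroup H G \<Longrightarrow> 0 < card (rcosets H)"
  using index_mult[of H] card_subgroup_pos[OF subgroup_self] unfolding order_def
  by (metis mult_0 neq0_conv)

lemma index_eqI:
  assumes "subgroup H G" "order G = m * card H" shows "card (rcosets H) = m"
  using index_mult[OF assms(1)] assms(2) card_subgroup_pos[OF assms(1)]
  by (metis less_not_refl mult_right_cancel)

lemma order_Mod: "order (G Mod H) = card (rcosets H)"
  by (simp add: order_def FactGroup_def)

lemma subgroup_eq_if_card: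
  assumes "subgroup A G" "H \<subseteq> A" "card A \<le> card H" shows "H = A"
  using assms by (simp add: card_seteq)

lemma exists_maximal_subgroup:
  assumes H: "subgroup H G" "H \<noteq> carrier G"
  obtains M where "maximal_subgroup G M" "H \<subseteq> M"
proof -
  let ?S = "{L. subgroup L G \<and> H \<subseteq> L \<and> L \<noteq> carrier G}"
  have "?S \<subseteq> Pow (carrier G)" using subgroup.subset by auto
  then have "finite ?S" by (rule finite_subset) simp
  then obtain M where M: "M \<in> ?S" "\<forall>L\<in>?S. M \<subseteq> L \<longrightarrow> M = L"
    using finite_has_maximal[of ?S] H by auto
  then have "maximal_subgroup G M" unfolding maximal_subgroup_def by blast
  then show thesis using M that by auto
qed

lemma exists_maximal_subgroup_of:
  assumes A: "subgroup A G" and H: "subgroup H G" "H \<subseteq> A" "H \<noteq> A"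
  obtains M where "maximal_subgroup (G\<lparr>carrier := A\<rparr>) M" "H \<subseteq> M"
proof -
  interpret A: finite_group "G\<lparr>carrier := A\<rparr>" by (rule finite_group_subgroup[OF A])
  show thesis using A.exists_maximal_subgroup[of H] H that by (auto simp: subgroup_carrier_iff[OF A])
qed

lemma maximal_if_prime_index:
  assumes "subgroup A G" "subgroup M G" "M \<subseteq> A" and p: "prime p" "card A = p * card M"
  shows "maximal_subgroup (G\<lparr>carrier := A\<rparr>) M"
  unfolding maximal_subgroup_carrier_iff[OF assms(1)]
proof (intro conjI allI impI)
  show "M \<subset> A" using assms card_subgroup_pos[OF assms(2)] prime_gt_1_nat[OF p(1)] by auto
  fix L assume L: "subgroup L G" "M \<subseteq> L" "L \<subseteq> A"
  obtain a where a: "card A = a * card L"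
    using card_subgroup_dvd[OF assms(1) L(1,3)] by (metis dvdE mult.commute)
  obtain b where b: "card L = b * card M"
    using card_subgroup_dvd[OF L(1) assms(2) L(2)] by (metis dvdE mult.commute)
  have "p * card M = (a * b) * card M" using a b p(2) by (metis mult.assoc)
  then have "p = a * b" using card_subgroup_pos[OF assms(2)] by (metis less_not_refl mult_right_cancel)
  then have "a = 1 \<or> b = 1" using p(1) prime_product by blast
  then show "L = M \<or> L = A"
    using a b subgroup_eq_if_card[OF assms(1) L(3)] subgroup_eq_if_card[OF L(1,2)] by auto
qed (use assms in auto)

text \<open>All fibres of the map \<open>(h, k) \<mapsto> hk\<close> are in bijection with \<open>H \<inter> K\<close>.\<close>

lemma card_set_mult:
  assumes H: "subgroup H G" and K: "subgroup K G"
  shows "card (H <#> K) * card (H \<inter> K) = card H * card K"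
proof -
  have c: "\<And>x. x \<in> H \<Longrightarrow> x \<in> carrier G" "\<And>x. x \<in> K \<Longrightarrow> x \<in> carrier G"
    using H K subgroup.subset by auto
  let ?f = "\<lambda>(h, k). h \<otimes> k"
  have im: "?f ` (H \<times> K) = H <#> K" unfolding set_mult_def by force
  have fib: "card {z \<in> H \<times> K. ?f z = y} = card (H \<inter> K)" if "y \<in> H <#> K" for y
  proof -
    from that obtain h k where hk: "h \<in> H" "k \<in> K" and y: "y = h \<otimes> k" unfolding set_mult_def by auto
    note hc = c(1)[OF hk(1)] and kc = c(2)[OF hk(2)]
    let ?g = "\<lambda>d. (h \<otimes> d, inv d \<otimes> k)"
    have "{z \<in> H \<times> K. ?f z = y} = ?g ` (H \<inter> K)"
    proof (rule Set.equalityI; rule subsetI)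
      fix z assume "z \<in> {z \<in> H \<times> K. ?f z = y}"
      then obtain a b where z: "z = (a, b)" "a \<in> H" "b \<in> K" "a \<otimes> b = h \<otimes> k" using y by auto
      note ac = c(1)[OF z(2)] and bc = c(2)[OF z(3)]
      have 1: "inv h \<otimes> a = k \<otimes> inv b"
      proof -
        have "inv h \<otimes> a = inv h \<otimes> (a \<otimes> b) \<otimes> inv b" using ac bc hc by (simp add: m_assoc)
        also have "\<dots> = k \<otimes> inv b" unfolding z(4) using hc kc bc by (simp add: m_assoc[symmetric])
        finally show ?thesis .
      qed
      have "inv h \<otimes> a \<in> H" using hk z H by (simp add: subgroup.m_closed subgroup.m_inv_closed)
      moreover have "inv h \<otimes> a \<in> K" unfolding 1 using hk z K by (simp add: subgroup.m_closed subgroup.m_inv_closed)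
      moreover have "h \<otimes> (inv h \<otimes> a) = a" using hc ac by (simp add: m_assoc[symmetric])
      moreover have "inv (inv h \<otimes> a) \<otimes> k = b"
        unfolding 1 using kc bc by (simp add: inv_mult_group m_assoc)
      ultimately show "z \<in> ?g ` (H \<inter> K)" using z(1) by force
    next
      fix z assume "z \<in> ?g ` (H \<inter> K)"
      then obtain d where d: "d \<in> H" "d \<in> K" "z = (h \<otimes> d, inv d \<otimes> k)" by auto
      have "h \<otimes> d \<otimes> (inv d \<otimes> k) = h \<otimes> (d \<otimes> inv d) \<otimes> k"
        using c(1)[OF d(1)] hc kc by (simp only: m_assoc inv_closed m_closed)
      also have "\<dots> = h \<otimes> k" using c(1)[OF d(1)] hc by simp
      finally show "z \<in> {z \<in> H \<times> K. ?f z = y}"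
        using d hk H K y by (simp add: subgroup.m_closed subgroup.m_inv_closed)
    qed
    moreover have "inj_on ?g (H \<inter> K)"
      using hc c by (intro inj_onI) (auto)
    ultimately show ?thesis by (simp add: card_image)
  qed
  have "card H * card K = card (H \<times> K)" by (simp add: card_cartesian_product)
  also have "\<dots> = (\<Sum>y\<in>?f ` (H \<times> K). card {z \<in> H \<times> K. ?f z = y})"
    using sum.image_gen[of "H \<times> K" "\<lambda>_. 1::nat" ?f] H K by simp
  also have "\<dots> = card (H <#> K) * card (H \<inter> K)"
    unfolding im using fib by simp
  finally show ?thesis by simp
qed

lemma card_set_mult_le:
  assumes "subgroup H G" "subgroup K G" "subgroup A G" "H \<subseteq> A" "K \<subseteq> A"
  shows "card H * card K \<le> card A * card (H \<inter> K)"
proof -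
  have "H <#> K \<subseteq> A" using assms subgroup.m_closed[OF assms(3)] unfolding set_mult_def by blast
  then show ?thesis
    using card_set_mult[OF assms(1,2)] assms(3) by (metis card_mono finite_subgroup mult_le_mono1)
qed

end

section \<open>Fixed points of \<open>p\<close>-group actions\<close>

lemma group_actionI:
  assumes "group Q"
    and closed: "\<And>g x. g \<in> carrier Q \<Longrightarrow> x \<in> E \<Longrightarrow> f g x \<in> E"
    and one: "\<And>x. x \<in> E \<Longrightarrow> f \<one>\<^bsub>Q\<^esub> x = x"
    and comp: "\<And>g h x. g \<in> carrier Q \<Longrightarrow> h \<in> carrier Q \<Longrightarrow> x \<in> E \<Longrightarrow>
      f (g \<otimes>\<^bsub>Q\<^esub> h) x = f g (f h x)"
  shows "group_action Q E (\<lambda>g. \<lambda>x\<in>E. f g x)"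
proof -
  interpret Q: group Q by fact
  have bij: "(\<lambda>x\<in>E. f g x) \<in> Bij E" if g: "g \<in> carrier Q" for g
  proof -
    have "bij_betw (\<lambda>x\<in>E. f g x) E E"
      by (rule bij_betwI[where g = "\<lambda>x. f (inv\<^bsub>Q\<^esub> g) x"])
        (use g closed one comp[symmetric] in auto)
    then show ?thesis by (simp add: Bij_def)
  qed
  have "(\<lambda>g. \<lambda>x\<in>E. f g x) \<in> hom Q (BijGroup E)"
    by (rule homI) (use bij closed comp in \<open>auto simp: BijGroup_def compose_def fun_eq_iff\<close>)
  then show ?thesis
    unfolding group_action_def group_hom_def group_hom_axioms_def
    using Q.is_group group_BijGroup by blast
qed

text \<open>
  The orbits of an action of \<open>G\<close> in which \<open>J\<close> is trivial have lengths dividing \<open>|G : J|\<close>. When this index is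
  a power of \<open>p\<close>, every orbit that is not a fixed point has length divisible by \<open>p\<close>. Working with a
  subgroup \<open>J\<close> that acts trivially, rather than with \<open>G/J\<close>, keeps all arguments inside one group.
\<close>

lemma (in finite_group) card_fixed_points_cong:
  assumes E: "finite E"
    and closed: "\<And>g x. g \<in> carrier G \<Longrightarrow> x \<in> E \<Longrightarrow> f g x \<in> E"
    and one: "\<And>x. x \<in> E \<Longrightarrow> f \<one> x = x"
    and comp: "\<And>g h x. g \<in> carrier G \<Longrightarrow> h \<in> carrier G \<Longrightarrow> x \<in> E \<Longrightarrow> f (g \<otimes> h) x = f g (f h x)"
    and J: "subgroup J G" "\<And>j x. j \<in> J \<Longrightarrow> x \<in> E \<Longrightarrow> f j x = x"
    and p: "prime p" "order G = p ^ a * card J"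
  shows "[card E = card {x \<in> E. \<forall>g\<in>carrier G. f g x = x}] (mod p)"
proof -
  define \<phi> where "\<phi> = (\<lambda>g. \<lambda>x\<in>E. f g x)"
  have act: "group_action G E \<phi>" unfolding \<phi>_def using closed one comp
    by (intro group_actionI) auto
  interpret act: group_action G E \<phi> by (rule act)
  have orb: "orbit G \<phi> x = (\<lambda>g. f g x) ` carrier G" if "x \<in> E" for x
    using that unfolding orbit_def \<phi>_def by auto
  have card_orb: "card (orbit G \<phi> x) dvd p ^ a" if x: "x \<in> E" for x
  proof -
    have sub: "subgroup (stabilizer G \<phi> x) G" by (rule act.stabilizer_subgroup[OF x])
    have "J \<subseteq> stabilizer G \<phi> x"
      using J x subgroup.subset[OF J(1)] unfolding stabilizer_def \<phi>_def by auto
    then obtain c where c: "card (stabilizer G \<phi> x) = c * card J"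
      using card_subgroup_dvd[OF sub J(1)] by (metis dvdE mult.commute)
    have "(card (orbit G \<phi> x) * c) * card J = p ^ a * card J"
      using act.orbit_stabilizer_theorem[OF x] p(2) c by (metis mult.assoc)
    then have "card (orbit G \<phi> x) * c = p ^ a"
      using card_subgroup_pos[OF J(1)] by (metis less_not_refl mult_right_cancel)
    then show ?thesis by (metis dvd_triv_left)
  qed
  let ?F = "{x \<in> E. \<forall>g\<in>carrier G. f g x = x}"
  have fix_orb: "orbit G \<phi> x = {x}" if "x \<in> ?F" for x
    using that orb[of x] one by (auto simp: image_iff)
  have fix_iff: "x \<in> ?F" if "x \<in> E" "card (orbit G \<phi> x) = 1" for x
  proof -
    obtain y where y: "orbit G \<phi> x = {y}" using \<open>card (orbit G \<phi> x) = 1\<close> card_1_singletonE by blast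
    have mem: "f g x \<in> orbit G \<phi> x" if "g \<in> carrier G" for g using that orb[OF \<open>x \<in> E\<close>] by auto
    have "y = x" using mem[of \<one>] one[OF \<open>x \<in> E\<close>] y by simp
    then show ?thesis using mem y that by auto
  qed
  let ?O = "orbits G E \<phi>"
  have fin: "finite ?O" unfolding orbits_def using E by simp
  have sp: "?O = (\<lambda>x. {x}) ` ?F \<union> {R \<in> ?O. card R \<noteq> 1}"
  proof -
    have "R \<in> (\<lambda>x. {x}) ` ?F" if R: "R \<in> ?O" "card R = 1" for R
    proof -
      obtain x where x: "x \<in> E" "R = orbit G \<phi> x" using R(1) unfolding orbits_def by auto
      have "x \<in> ?F" using fix_iff[OF x(1)] R(2) unfolding x(2) .
      from fix_orb[OF this] this show ?thesis unfolding x(2) by (simp only: image_eqI)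
    qed
    moreover have "{x} \<in> ?O" if "x \<in> ?F" for x
      using fix_orb[OF that] that unfolding orbits_def by force
    ultimately show ?thesis by auto
  qed
  have "card E = (\<Sum>R\<in>?O. card R)"
    using act.disjoint_sum[OF E, of "\<lambda>_. 1::nat"] by simp
  also have "\<dots> = (\<Sum>R\<in>(\<lambda>x. {x}) ` ?F. card R) + (\<Sum>R\<in>{R \<in> ?O. card R \<noteq> 1}. card R)"
    using E fin by (subst sp, subst sum.union_disjoint) auto
  also have "(\<Sum>R\<in>(\<lambda>x. {x}) ` ?F. card R) = card ?F"
    by (subst sum.reindex) (auto simp: inj_on_def)
  finally have eq: "card E = card ?F + (\<Sum>R\<in>{R \<in> ?O. card R \<noteq> 1}. card R)" .
  have "p dvd (\<Sum>R\<in>{R \<in> ?O. card R \<noteq> 1}. card R)"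
  proof (rule dvd_sum)
    fix R assume R: "R \<in> {R \<in> ?O. card R \<noteq> 1}"
    then obtain x where "x \<in> E" "R = orbit G \<phi> x" unfolding orbits_def by auto
    then have "card R dvd p ^ a" using card_orb by simp
    then obtain b where "card R = p ^ b" using divides_primepow_nat[OF p(1)] by auto
    then show "p dvd card R" using R by (cases b) auto
  qed
  then show ?thesis unfolding eq by (auto simp: cong_def elim: dvdE)
qed

context finite_group
begin

lemma rcoset_fixed_iff:
  assumes H: "subgroup H G" and g: "g \<in> carrier G" and q: "q \<in> carrier G"
  shows "(H #> g) #> q = H #> g \<longleftrightarrow> g \<otimes> q \<otimes> inv g \<in> H"
proof -
  have "(H #> g) #> q = H #> (g \<otimes> q)"
    using coset_mult_assoc[OF subgroup.subset[OF H] g q] .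
  moreover have "H #> (g \<otimes> q) = H #> g \<longleftrightarrow> g \<otimes> q \<in> H #> g"
    using repr_independence[OF _ g H, of "g \<otimes> q"] rcos_self[OF _ H, of "g \<otimes> q"] g q by auto
  ultimately show ?thesis using subgroup.rcos_module[OF H is_group g, of "g \<otimes> q"] g q by simp
qed

lemma card_fixed_rcosets_cong:
  assumes H: "subgroup H G" and Q: "subgroup Q G" and J: "J \<lhd> G" "J \<subseteq> H" "J \<subseteq> Q"
    and p: "prime p" "card Q = p ^ a * card J"
  shows "[card (rcosets H) = card {R \<in> rcosets H. \<forall>q\<in>Q. R #> q = R}] (mod p)"
proof -
  interpret Q: finite_group "G\<lparr>carrier := Q\<rparr>" by (rule finite_group_subgroup[OF Q])
  have Qc: "q \<in> carrier G" if "q \<in> Q" for q using that subgroup.subset[OF Q] by auto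
  have Hs: "H \<subseteq> carrier G" by (rule subgroup.subset[OF H])
  have sJ: "subgroup J G" by (rule normal_imp_subgroup[OF J(1)])
  have closed: "R #> q \<in> rcosets H" if "R \<in> rcosets H" "q \<in> carrier G" for R q
    using that coset_mult_assoc[OF Hs] by (auto simp: RCOSETS_def)
  have sub: "R \<subseteq> carrier G" if "R \<in> rcosets H" for R
    using that r_coset_subset_G[OF Hs] by (auto simp: RCOSETS_def)
  have inv_all: "(\<forall>q\<in>Q. R #> inv q = R) \<longleftrightarrow> (\<forall>q\<in>Q. R #> q = R)" for R
    using subgroup.m_inv_closed[OF Q] inv_inv[OF Qc] by metis
  have "[card (rcosets H) = card {R \<in> rcosets H. \<forall>q\<in>carrier (G\<lparr>carrier := Q\<rparr>). R #> inv q = R}] (mod p)"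
  proof (rule Q.card_fixed_points_cong[where J = J and a = a])
    show "finite (rcosets H)" using rcosets_part_G[OF H] by (metis finite_UnionD finite_carrier)
    show "subgroup J (G\<lparr>carrier := Q\<rparr>)" using J sJ by (simp add: subgroup_carrier_iff[OF Q])
    show "order (G\<lparr>carrier := Q\<rparr>) = p ^ a * card J" using p by (simp add: order_def)
    show "R #> inv j = R" if j: "j \<in> J" and R: "R \<in> rcosets H" for j R
    proof -
      obtain g where g: "g \<in> carrier G" "R = H #> g" using R by (auto simp: RCOSETS_def)
      have "inv j \<in> J" using j sJ by (simp add: subgroup.m_inv_closed)
      then have "g \<otimes> inv j \<otimes> inv g \<in> H" using J g by (auto simp: normal_iff)
      then show ?thesis
        using rcoset_fixed_iff[OF H g(1), of "inv j"] g j J Qc by auto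
    qed
    show "R #> inv (g \<otimes>\<^bsub>G\<lparr>carrier := Q\<rparr>\<^esub> h) = R #> inv h #> inv g"
      if "g \<in> carrier (G\<lparr>carrier := Q\<rparr>)" "h \<in> carrier (G\<lparr>carrier := Q\<rparr>)" "R \<in> rcosets H" for g h R
      using that Qc sub coset_mult_assoc by (simp add: inv_mult_group)
  qed (use closed Qc sub p in auto)
  also have "{R \<in> rcosets H. \<forall>q\<in>carrier (G\<lparr>carrier := Q\<rparr>). R #> inv q = R} =
      {R \<in> rcosets H. \<forall>q\<in>Q. R #> q = R}"
    using inv_all by auto
  finally show ?thesis .
qed

end

section \<open>Sylow theory modulo a normal subgroup\<close>

lemma exists_largest_prime_divisor:
  fixes n :: nat
  assumes "n \<noteq> 0" "n \<noteq> 1"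
  obtains s where "prime s" "s dvd n" "\<And>r. prime r \<Longrightarrow> r dvd n \<Longrightarrow> r \<le> s"
proof -
  let ?Q = "{q. prime q \<and> q dvd n}"
  have "finite ?Q" using assms(1) by (intro finite_subset[OF _ finite_divisors_nat]) auto
  moreover have "?Q \<noteq> {}" using prime_factor_nat[OF assms(2)] by auto
  ultimately have "Max ?Q \<in> ?Q" "\<And>r. r \<in> ?Q \<Longrightarrow> r \<le> Max ?Q" using Max_in Max_ge by blast+
  then show thesis using that by blast
qed

text \<open>For a chain \<open>C \<subseteq> B \<subseteq> A\<close> with \<open>|A : C| = p\<^sup>n\<close>, this makes \<open>a = |A : B|\<close> a power of \<open>p\<close>; \<open>b\<close> and \<open>c\<close> are the orders of
  \<open>B\<close> and \<open>C\<close>.\<close>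

lemma prime_power_mult_cancel:
  fixes p :: nat
  assumes "prime p" "a * b = p ^ n * c" "c dvd b" "0 < c"
  obtains j where "a = p ^ j" "j \<le> n"
proof -
  obtain d where d: "b = d * c" using assms(3) by (metis dvdE mult.commute)
  have "a * d * c = p ^ n * c" using assms(2) d by (metis mult.assoc)
  then have "a * d = p ^ n" using assms(4) by (metis less_not_refl mult_right_cancel)
  then have "a dvd p ^ n" by (metis dvd_triv_left)
  then show thesis using that divides_primepow_nat[OF assms(1)] by auto
qed

context finite_group
begin

definition normalizing :: "'a set \<Rightarrow> 'a set" where
  "normalizing H = {g \<in> carrier G. \<forall>h\<in>H. g \<otimes> h \<otimes> inv g \<in> H}"

lemma conj_conj:
  "\<lbrakk>g \<in> carrier G; h \<in> carrier G; x \<in> carrier G\<rbrakk> \<Longrightarrow>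
    g \<otimes> (h \<otimes> x \<otimes> inv h) \<otimes> inv g = g \<otimes> h \<otimes> x \<otimes> inv (g \<otimes> h)"
  by (simp add: inv_mult_group m_assoc)

lemma conj_inv_cancel:
  "\<lbrakk>g \<in> carrier G; x \<in> carrier G\<rbrakk> \<Longrightarrow> inv g \<otimes> (g \<otimes> x \<otimes> inv g) \<otimes> g = x"
  "\<lbrakk>g \<in> carrier G; x \<in> carrier G\<rbrakk> \<Longrightarrow> g \<otimes> (inv g \<otimes> x \<otimes> g) \<otimes> inv g = x"
  using conj_conj[of "inv g" g x] conj_conj[of g "inv g" x] by auto

lemma inj_on_conj: "\<lbrakk>g \<in> carrier G; H \<subseteq> carrier G\<rbrakk> \<Longrightarrow> inj_on (\<lambda>x. g \<otimes> x \<otimes> inv g) H"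
  by (rule inj_on_inverseI[where g = "\<lambda>x. inv g \<otimes> x \<otimes> g"]) (auto simp: conj_inv_cancel)

lemma conj_subset_imp_eq:
  assumes g: "g \<in> carrier G" and S: "subgroup S G" and T: "subgroup T G" and "card T \<le> card S"
    and conj: "\<And>s. s \<in> S \<Longrightarrow> g \<otimes> s \<otimes> inv g \<in> T"
  shows "(\<lambda>s. g \<otimes> s \<otimes> inv g) ` S = T"
  using assms subgroup_eq_if_card[OF T, of "(\<lambda>s. g \<otimes> s \<otimes> inv g) ` S"]
    card_image[OF inj_on_conj[OF g subgroup.subset[OF S]]] by auto

lemma subgroup_conj:
  assumes g: "g \<in> carrier G" and S: "subgroup S G"
  shows "subgroup ((\<lambda>s. g \<otimes> s \<otimes> inv g) ` S) G"
    and "card ((\<lambda>s. g \<otimes> s \<otimes> inv g) ` S) = card S"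
proof -
  have h: "(\<lambda>s. g \<otimes> s \<otimes> inv g) \<in> hom G G"
    using g by (auto intro!: homI simp: m_assoc) (simp add: m_assoc[symmetric])
  interpret c: group_hom G G "\<lambda>s. g \<otimes> s \<otimes> inv g"
    by (simp add: group_hom_def group_hom_axioms_def h)
  show "subgroup ((\<lambda>s. g \<otimes> s \<otimes> inv g) ` S) G" by (rule c.subgroup_img_is_subgroup[OF S])
qed (rule card_image[OF inj_on_conj[OF g subgroup.subset[OF S]]])

lemma subgroup_normalizing:
  assumes H: "subgroup H G"
  shows "subgroup (normalizing H) G" and "H \<subseteq> normalizing H"
proof -
  have Hc: "\<And>h. h \<in> H \<Longrightarrow> h \<in> carrier G" using subgroup.subset[OF H] by auto
  show "H \<subseteq> normalizing H"
    using Hc H unfolding normalizing_def by (auto simp: subgroup.m_closed subgroup.m_inv_closed)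
  have 1: "inv g \<in> normalizing H" if g: "g \<in> normalizing H" for g
  proof -
    have gc: "g \<in> carrier G" using g unfolding normalizing_def by auto
    have im: "(\<lambda>s. g \<otimes> s \<otimes> inv g) ` H = H"
      using conj_subset_imp_eq[OF gc H H] g unfolding normalizing_def by auto
    have "inv g \<otimes> h \<otimes> g \<in> H" if "h \<in> H" for h
    proof -
      obtain s where "s \<in> H" "h = g \<otimes> s \<otimes> inv g" using \<open>h \<in> H\<close> im by blast
      then show ?thesis using conj_inv_cancel(1)[OF gc, of s] Hc by simp
    qed
    then show ?thesis using gc unfolding normalizing_def by auto
  qed
  have 2: "g \<otimes> h \<in> normalizing H" if "g \<in> normalizing H" "h \<in> normalizing H" for g h
    using that Hc unfolding normalizing_def by (auto simp: conj_conj[symmetric])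
  have "\<one> \<in> normalizing H" using Hc unfolding normalizing_def by auto
  then show "subgroup (normalizing H) G"
    using 1 2 by (intro subgroupI) (auto simp: normalizing_def)
qed

lemma normal_iff_normalizing: "N \<lhd> G \<longleftrightarrow> subgroup N G \<and> carrier G \<subseteq> normalizing N"
  unfolding normal_iff normalizing_def by auto

lemma normal_in_iff_normalizing:
  "subgroup A G \<Longrightarrow> N \<lhd> (G\<lparr>carrier := A\<rparr>) \<longleftrightarrow> subgroup N G \<and> N \<subseteq> A \<and> A \<subseteq> normalizing N"
  using subgroup.subset[of A G] unfolding normal_carrier_iff normalizing_def by auto

text \<open>Sylow's conjugacy theorem for the quotient by \<open>J\<close>: a \<open>p\<close>-group acting on a set of cosets whose number is
  prime to \<open>p\<close> fixes one of them.\<close>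

lemma conj_into_subgroup_of_coprime_index:
  assumes J: "J \<lhd> G" "J \<subseteq> S" "J \<subseteq> Q" and S: "subgroup S G" and Q: "subgroup Q G"
    and p: "prime p" "card Q = p ^ a * card J" "\<not> p dvd card (rcosets S)"
  obtains g where "g \<in> carrier G" "\<And>q. q \<in> Q \<Longrightarrow> g \<otimes> q \<otimes> inv g \<in> S"
proof -
  let ?F = "{R \<in> rcosets S. \<forall>q\<in>Q. R #> q = R}"
  have cong: "[card (rcosets S) = card ?F] (mod p)"
    using card_fixed_rcosets_cong[OF S Q J p(1,2)] .
  have "?F \<noteq> {}"
  proof
    assume "?F = {}"
    then show False using cong p(3) by (simp only: card.empty cong_0_iff)
  qed
  then obtain R where R: "R \<in> rcosets S" "\<forall>q\<in>Q. R #> q = R" by blast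
  then obtain g where g: "g \<in> carrier G" "R = S #> g" by (auto simp: RCOSETS_def)
  have "g \<otimes> q \<otimes> inv g \<in> S" if "q \<in> Q" for q
    using R(2) rcoset_fixed_iff[OF S g(1), of q] subgroup.subset[OF Q] \<open>q \<in> Q\<close> g(2) by blast
  then show thesis using g that by blast
qed

text \<open>\<open>H\<close> acts on its own cosets, whose number is divisible by \<open>p\<close>; it fixes the trivial coset, hence a
  second one, and the representatives of that coset normalize \<open>H\<close>.\<close>

lemma normalizer_grows:
  assumes K: "K \<lhd> G" "K \<subseteq> H" and H: "subgroup H G" "H \<noteq> carrier G"
    and p: "prime p" "order G = p ^ a * card K"
  obtains g where "g \<in> normalizing H" "g \<notin> H"
proof -
  have sK: "subgroup K G" by (rule normal_imp_subgroup[OF K(1)])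
  have dK: "card K dvd card H" by (rule card_subgroup_dvd[OF H(1) sK K(2)])
  obtain j where j: "card (rcosets H) = p ^ j"
    by (rule prime_power_mult_cancel[OF p(1) _ dK card_subgroup_pos[OF sK], of "card (rcosets H)" a])
      (use index_mult[OF H(1)] p in auto)
  have "j \<noteq> 0"
    using j index_mult[OF H(1)] subgroup_eq_if_card[OF subgroup_self subgroup.subset[OF H(1)]] H(2)
    by (auto simp: order_def)
  then have "p dvd card (rcosets H)" using j by simp
  obtain b where b: "card H = p ^ b * card K"
  proof -
    obtain d where d: "card H = d * card K" using dK by (metis dvdE mult.commute)
    have "d * (card (rcosets H) * card K) = p ^ a * card K"
      using index_mult[OF H(1)] p(2) d by (simp add: mult.assoc mult.left_commute)
    then obtain i where "d = p ^ i"
      by (rule prime_power_mult_cancel[OF p(1) _ _ card_subgroup_pos[OF sK]]) simp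
    then show thesis using d that[of i] by blast
  qed
  \<comment> \<open>\<open>H #> g\<close> is fixed by \<open>H\<close> exactly when \<open>g\<close> conjugates \<open>H\<close> into itself.\<close>
  let ?F = "{R \<in> rcosets H. \<forall>q\<in>H. R #> q = R}"
  have "p dvd card ?F"
    using card_fixed_rcosets_cong[OF H(1) H(1) K(1,2,2) p(1) b] \<open>p dvd card (rcosets H)\<close>
    by (simp only: cong_def dvd_eq_mod_eq_0)
  moreover have "H \<in> ?F"
    using subgroup.subgroup_in_rcosets[OF H(1) is_group] subgroup.rcos_const[OF H(1) is_group] by auto
  moreover have "finite ?F" using rcosets_part_G[OF H(1)] finite_UnionD[of "rcosets H"] by simp
  moreover have "card {H} = 1" by simp
  ultimately have "?F \<noteq> {H}" using prime_gt_1_nat[OF p(1)] by (metis nat_dvd_1_iff_1 less_irrefl)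
  then obtain R where R: "R \<in> ?F" "R \<noteq> H" using \<open>H \<in> ?F\<close> by blast
  then obtain g where g: "g \<in> carrier G" "R = H #> g" by (auto simp: RCOSETS_def)
  have "g \<in> normalizing H"
    using R(1) g rcoset_fixed_iff[OF H(1) g(1)] subgroup.subset[OF H(1)] unfolding normalizing_def by blast
  moreover have "g \<notin> H" using R g subgroup.rcos_const[OF H(1) is_group] by auto
  ultimately show thesis by (rule that)
qed

lemma exists_relative_Sylow:
  assumes K: "K \<lhd> G" and p: "prime p" "p ^ a dvd card (rcosets K)"
  obtains S where "subgroup S G" "K \<subseteq> S" "card S = p ^ a * card K"
proof -
  interpret K: normal K G by (rule K)
  have sK: "subgroup K G" by (rule normal_imp_subgroup[OF K])
  obtain m where m: "order (G Mod K) = p ^ a * m" using p(2) unfolding order_Mod by auto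
  have "finite (carrier (G Mod K))" by (simp add: carrier_FactGroup)
  then obtain T where T: "subgroup T (G Mod K)" "card T = p ^ a"
    using sylow_thm[OF p(1) K.factorgroup_is_group m] by auto
  let ?S = "\<Union>T"
  have S: "subgroup ?S G" by (rule K.factgroup_subgroup_union_subgroup[OF T(1)])
  have char: "?S = {x \<in> carrier G. K #> x \<in> T}" by (rule K.factgroup_subgroup_union_char[OF T(1)])
  have "K \<subseteq> ?S" using subgroup.one_closed[OF T(1)] by auto
  moreover have "card ?S = p ^ a * card K"
  proof -
    have "T = rcosets\<^bsub>G\<lparr>carrier := ?S\<rparr>\<^esub> K" by (rule K.factgroup_subgroup_union_factor[OF T(1)])
    then show ?thesis using index_mult_carrier[OF S sK \<open>K \<subseteq> ?S\<close>] T(2) by simp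
  qed
  ultimately show thesis using S that by blast
qed

text \<open>Cauchy's theorem in the quotient of \<open>A\<close> by \<open>H\<close>.\<close>

lemma exists_overgroup_prime_index:
  assumes H: "subgroup H G" and A: "subgroup A G" "H \<subset> A" "A \<subseteq> normalizing H"
    and p: "prime p" "p dvd card (rcosets\<^bsub>G\<lparr>carrier := A\<rparr>\<^esub> H)"
  obtains D where "subgroup D G" "H \<subseteq> D" "D \<subseteq> A" "card D = p * card H"
proof -
  interpret A: finite_group "G\<lparr>carrier := A\<rparr>" by (rule finite_group_subgroup[OF A(1)])
  have "H \<lhd> (G\<lparr>carrier := A\<rparr>)" using H A by (auto simp: normal_in_iff_normalizing)
  then obtain S where "subgroup S (G\<lparr>carrier := A\<rparr>)" "H \<subseteq> S" "card S = p ^ 1 * card H"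
    using A.exists_relative_Sylow[of H p 1] p by auto
  then show thesis using that by (auto simp: subgroup_carrier_iff[OF A(1)])
qed

lemma normal_maximal_prime_index:
  assumes A: "subgroup A G" and M: "maximal_subgroup (G\<lparr>carrier := A\<rparr>) M" "A \<subseteq> normalizing M"
  obtains p where "prime p" "card A = p * card M"
proof -
  have M': "subgroup M G" "M \<subset> A" using M(1) unfolding maximal_subgroup_carrier_iff[OF A] by auto
  let ?i = "card (rcosets\<^bsub>G\<lparr>carrier := A\<rparr>\<^esub> M)"
  have "?i * card M = card A" using index_mult_carrier[OF A] M' by auto
  then have "?i \<noteq> 1" using M' subgroup_eq_if_card[OF A, of M] by auto
  then obtain p where p: "prime p" "p dvd ?i" using prime_factor_nat by auto
  obtain D where D: "subgroup D G" "M \<subseteq> D" "D \<subseteq> A" "card D = p * card M"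
    using exists_overgroup_prime_index[OF M'(1) A M'(2) M(2) p] by auto
  moreover have "D \<noteq> M" using D(4) card_subgroup_pos[OF M'(1)] prime_gt_1_nat[OF p(1)] by auto
  ultimately have "D = A" using M(1) unfolding maximal_subgroup_carrier_iff[OF A] by blast
  then show thesis using D p that by auto
qed

text \<open>Two consequences of growing normalizers. A maximal subgroup has to be normal, and above a proper subgroup \<open>D\<close> the
  quotient of its normalizer contains a subgroup of order \<open>p\<close>, which extends a chain of maximal subgroups by one step.\<close>

lemma maximal_normal_if_prime_power_quotient:
  assumes K: "K \<lhd> G" "K \<subseteq> M" and M: "maximal_subgroup G M" and p: "prime p" "order G = p ^ a * card K"
  shows "M \<lhd> G"
proof -
  have M': "subgroup M G" "M \<noteq> carrier G" using M unfolding maximal_subgroup_def by auto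
  obtain g where g: "g \<in> normalizing M" "g \<notin> M" by (rule normalizer_grows[OF K M' p])
  then have "normalizing M = carrier G"
    using M subgroup_normalizing[OF M'(1)] unfolding maximal_subgroup_def by blast
  then show ?thesis using M' by (simp add: normal_iff_normalizing)
qed

lemma n_maximal_if_prime_power_quotient:
  assumes K: "K \<lhd> G" and p: "prime p" "order G = p ^ a * card K"
    and D: "subgroup D G" "K \<subseteq> D" "order G = p ^ j * card D"
  shows "n_maximal G j D"
  using D
proof (induction j arbitrary: D)
  case 0
  then show ?case using subgroup_eq_if_card[OF subgroup_self subgroup.subset[OF 0(1)]]
    by (simp add: order_def)
next
  case (Suc j)
  have p1: "p > 1" using prime_gt_1_nat[OF p(1)] .
  have pos: "card D > 0" by (rule card_subgroup_pos[OF Suc.prems(1)])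
  have "D \<noteq> carrier G" using Suc.prems(3) p1 pos by (auto simp: order_def)
  then obtain g where g: "g \<in> normalizing D" "g \<notin> D"
    using normalizer_grows[OF K Suc.prems(2,1) _ p] by metis
  let ?N = "normalizing D"
  have N: "subgroup ?N G" "D \<subset> ?N" using subgroup_normalizing[OF Suc.prems(1)] g by auto
  let ?i = "card (rcosets\<^bsub>G\<lparr>carrier := ?N\<rparr>\<^esub> D)"
  have i: "?i * card D = card ?N" using index_mult_carrier[OF N(1) Suc.prems(1)] N by auto
  obtain m where m: "order G = m * card ?N" using index_mult[OF N(1)] by metis
  have "?i * (m * card D) = p ^ Suc j * card D" using i m Suc.prems(3) by (metis mult.assoc mult.left_commute)
  then obtain l where l: "?i = p ^ l" by (rule prime_power_mult_cancel[OF p(1) _ _ pos]) simp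
  have "l \<noteq> 0"
    using l i N subgroup_eq_if_card[OF N(1), of D] by auto
  then have "p dvd ?i" using l by simp
  then obtain E where E: "subgroup E G" "D \<subseteq> E" "E \<subseteq> ?N" "card E = p * card D"
    using exists_overgroup_prime_index[OF Suc.prems(1) N _ p(1)] by auto
  have "n_maximal G j E"
    using Suc.IH[of E] E Suc.prems by (auto simp: mult_ac)
  moreover have "maximal_subgroup (G\<lparr>carrier := E\<rparr>) D"
    using maximal_if_prime_index[OF E(1) Suc.prems(1) E(2) p(1) E(4)] .
  ultimately show ?case by auto
qed

end

section \<open>Centralizers of normal factors\<close>

context finite_group
begin

lemma set_mult_normal_subgroup:
  assumes "N \<lhd> G" "subgroup H G"
  shows "subgroup (N <#> H) G" "N \<subseteq> N <#> H" "H \<subseteq> N <#> H"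
    "\<And>A. subgroup A G \<Longrightarrow> N \<subseteq> A \<Longrightarrow> H \<subseteq> A \<Longrightarrow> N <#> H \<subseteq> A"
proof -
  have N: "subgroup N G" by (rule normal_imp_subgroup[OF assms(1)])
  show "subgroup (N <#> H) G" by (rule mult_norm_subgroup[OF assms])
  show "N \<subseteq> N <#> H"
  proof
    fix x assume "x \<in> N"
    then have "x = x \<otimes> \<one>" using subgroup.mem_carrier[OF N] by simp
    then show "x \<in> N <#> H" using \<open>x \<in> N\<close> subgroup.one_closed[OF assms(2)] unfolding set_mult_def by blast
  qed
  show "H \<subseteq> N <#> H"
  proof
    fix x assume "x \<in> H"
    then have "x = \<one> \<otimes> x" using subgroup.mem_carrier[OF assms(2)] by simp
    then show "x \<in> N <#> H" using \<open>x \<in> H\<close> subgroup.one_closed[OF N] unfolding set_mult_def by blast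
  qed
  show "N <#> H \<subseteq> A" if "subgroup A G" "N \<subseteq> A" "H \<subseteq> A" for A
    using that subgroup.m_closed[OF that(1)] unfolding set_mult_def by blast
qed

lemma normal_in_subgroup: "N \<lhd> G \<Longrightarrow> subgroup A G \<Longrightarrow> N \<subseteq> A \<Longrightarrow> N \<lhd> (G\<lparr>carrier := A\<rparr>)"
  using subgroup.subset[of A G] unfolding normal_carrier_iff normal_iff by blast

lemma conj_mult:
  "\<lbrakk>a \<in> carrier G; u \<in> carrier G; v \<in> carrier G\<rbrakk> \<Longrightarrow>
    a \<otimes> u \<otimes> inv a \<otimes> (a \<otimes> v \<otimes> inv a) = a \<otimes> (u \<otimes> v) \<otimes> inv a"
proof -
  assume c: "a \<in> carrier G" "u \<in> carrier G" "v \<in> carrier G"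
  have "a \<otimes> u \<otimes> inv a \<otimes> (a \<otimes> v \<otimes> inv a) = a \<otimes> u \<otimes> (inv a \<otimes> a) \<otimes> v \<otimes> inv a"
    using c by (simp only: m_assoc m_closed inv_closed)
  then show ?thesis using c by (simp add: m_assoc)
qed

lemma conj_inv:
  "\<lbrakk>a \<in> carrier G; u \<in> carrier G\<rbrakk> \<Longrightarrow> inv (a \<otimes> u \<otimes> inv a) = a \<otimes> inv u \<otimes> inv a"
  by (simp add: inv_mult_group m_assoc)

lemma commutator_mem_swap:
  assumes "subgroup J G" "g \<in> carrier G" "x \<in> carrier G"
  shows "g \<otimes> x \<otimes> inv g \<otimes> inv x \<in> J \<longleftrightarrow> x \<otimes> g \<otimes> inv x \<otimes> inv g \<in> J"
proof -
  have "inv (g \<otimes> x \<otimes> inv g \<otimes> inv x) = x \<otimes> g \<otimes> inv x \<otimes> inv g" "inv (x \<otimes> g \<otimes> inv x \<otimes> inv g) = g \<otimes> x \<otimes> inv g \<otimes> inv x"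
    using assms(2,3) by (simp_all add: inv_mult_group m_assoc)
  then show ?thesis using subgroup.m_inv_closed[OF assms(1)] by metis
qed

lemma subgroup_commuting_mod:
  assumes J: "J \<lhd> G" and g: "g \<in> carrier G"
  shows "subgroup {x \<in> carrier G. g \<otimes> x \<otimes> inv g \<otimes> inv x \<in> J} G"
proof -
  have sJ: "subgroup J G" by (rule normal_imp_subgroup[OF J])
  have Jn: "\<And>h x. h \<in> carrier G \<Longrightarrow> x \<in> J \<Longrightarrow> h \<otimes> x \<otimes> inv h \<in> J" using J unfolding normal_iff by auto
  show ?thesis
  proof (rule subgroupI)
    have "\<one> \<in> {x \<in> carrier G. g \<otimes> x \<otimes> inv g \<otimes> inv x \<in> J}" using g subgroup.one_closed[OF sJ] by simp
    then show "{x \<in> carrier G. g \<otimes> x \<otimes> inv g \<otimes> inv x \<in> J} \<noteq> {}" by blast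
  next
    fix x assume x: "x \<in> {x \<in> carrier G. g \<otimes> x \<otimes> inv g \<otimes> inv x \<in> J}"
    define u where "u = g \<otimes> x \<otimes> inv g \<otimes> inv x"
    have xc: "x \<in> carrier G" and u: "u \<in> J" using x unfolding u_def by auto
    have "inv x \<otimes> inv u \<otimes> inv (inv x) \<in> J" using u Jn[of "inv x" "inv u"] xc sJ
      by (simp add: subgroup.m_inv_closed)
    moreover have "inv x \<otimes> inv u \<otimes> inv (inv x) = g \<otimes> inv x \<otimes> inv g \<otimes> inv (inv x)"
      unfolding u_def using xc g by (simp add: inv_mult_group m_assoc[symmetric])
    ultimately show "inv x \<in> {x \<in> carrier G. g \<otimes> x \<otimes> inv g \<otimes> inv x \<in> J}" using xc by simp
    fix y assume y: "y \<in> {x \<in> carrier G. g \<otimes> x \<otimes> inv g \<otimes> inv x \<in> J}"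
    define v where "v = g \<otimes> y \<otimes> inv g \<otimes> inv y"
    have yc: "y \<in> carrier G" and v: "v \<in> J" using y unfolding v_def by auto
    have "u \<otimes> (x \<otimes> v \<otimes> inv x) \<in> J" using u v Jn[OF xc] subgroup.m_closed[OF sJ] by auto
    moreover have "g \<otimes> (x \<otimes> y) \<otimes> inv g \<otimes> inv (x \<otimes> y) = u \<otimes> (x \<otimes> v \<otimes> inv x)"
    proof -
      have "u \<otimes> (x \<otimes> v \<otimes> inv x) = (g \<otimes> x \<otimes> inv g) \<otimes> (inv x \<otimes> x) \<otimes> (g \<otimes> y \<otimes> inv g) \<otimes> (inv y \<otimes> inv x)"
        unfolding u_def v_def using g xc yc by (simp only: m_assoc m_closed inv_closed)
      also have "\<dots> = g \<otimes> (x \<otimes> y) \<otimes> inv g \<otimes> (inv y \<otimes> inv x)"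
        using conj_mult[OF g xc yc] g xc by simp
      finally show ?thesis using xc yc by (simp add: inv_mult_group)
    qed
    ultimately show "x \<otimes> y \<in> {x \<in> carrier G. g \<otimes> x \<otimes> inv g \<otimes> inv x \<in> J}" using xc yc by simp
  qed auto
qed

lemma conj_rcoset_normal:
  assumes J: "J \<lhd> G" and g: "g \<in> carrier G" and x: "x \<in> carrier G"
  shows "(\<lambda>y. g \<otimes> y \<otimes> inv g) ` (J #> x) = J #> (g \<otimes> x \<otimes> inv g)"
proof (rule Set.equalityI; rule subsetI)
  have Jc: "\<And>x. x \<in> J \<Longrightarrow> x \<in> carrier G"
    using subgroup.mem_carrier[OF normal_imp_subgroup[OF J]] by blast
  have Jn: "\<And>g x. g \<in> carrier G \<Longrightarrow> x \<in> J \<Longrightarrow> g \<otimes> x \<otimes> inv g \<in> J"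
    using J unfolding normal_iff by auto
  fix y
  {
    assume "y \<in> (\<lambda>y. g \<otimes> y \<otimes> inv g) ` (J #> x)"
    then obtain j where j: "j \<in> J" "y = g \<otimes> (j \<otimes> x) \<otimes> inv g" unfolding r_coset_def by auto
    then have "y = (g \<otimes> j \<otimes> inv g) \<otimes> (g \<otimes> x \<otimes> inv g)" using conj_mult[OF g Jc x] by simp
    then show "y \<in> J #> (g \<otimes> x \<otimes> inv g)" using Jn[OF g j(1)] unfolding r_coset_def by blast
  next
    assume "y \<in> J #> (g \<otimes> x \<otimes> inv g)"
    then obtain j where j: "j \<in> J" "y = j \<otimes> (g \<otimes> x \<otimes> inv g)" unfolding r_coset_def by auto
    have j': "inv g \<otimes> j \<otimes> g \<in> J" using Jn[of "inv g" j] g j by simp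
    have "y = g \<otimes> ((inv g \<otimes> j \<otimes> g) \<otimes> x) \<otimes> inv g"
      using conj_mult[OF g Jc[OF j'] x] conj_inv_cancel(2)[OF g Jc[OF j(1)]] j(2) by simp
    then show "y \<in> (\<lambda>y. g \<otimes> y \<otimes> inv g) ` (J #> x)" using j' unfolding r_coset_def by auto
  }
qed

lemma rcoset_conj_eq_iff:
  assumes J: "subgroup J G" and g: "g \<in> carrier G" and x: "x \<in> carrier G"
  shows "J #> (g \<otimes> x \<otimes> inv g) = J #> x \<longleftrightarrow> g \<otimes> x \<otimes> inv g \<otimes> inv x \<in> J"
proof -
  have gx: "g \<otimes> x \<otimes> inv g \<in> carrier G" using g x by simp
  have "J #> (g \<otimes> x \<otimes> inv g) = J #> x \<longleftrightarrow> g \<otimes> x \<otimes> inv g \<in> J #> x"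
    using repr_independence[OF _ x J, of "g \<otimes> x \<otimes> inv g"] rcos_self[OF gx J] by auto
  then show ?thesis using subgroup.rcos_module[OF J is_group x gx] by simp
qed

text \<open>
  For normal subgroups \<open>K\<close> and \<open>L\<close> this is the centralizer \<open>C\<^sub>G(L/K)\<close>, written with commutators so that
  no quotient group appears.
\<close>

definition cent :: "'a set \<Rightarrow> 'a set \<Rightarrow> 'a set" where
  "cent L K = {g \<in> carrier G. \<forall>x\<in>L. g \<otimes> x \<otimes> inv g \<otimes> inv x \<in> K}"

lemma cent_normal:
  assumes K: "K \<lhd> G" and L: "L \<lhd> G"
  shows "cent L K \<lhd> G" and "K \<subseteq> cent L K"
proof -
  have sK: "subgroup K G" and sL: "subgroup L G" using K L normal_imp_subgroup by auto
  have Kc: "\<And>x. x \<in> K \<Longrightarrow> x \<in> carrier G" and Lc: "\<And>x. x \<in> L \<Longrightarrow> x \<in> carrier G"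
    using subgroup.mem_carrier[OF sK] subgroup.mem_carrier[OF sL] by blast+
  have Kn: "\<And>g x. g \<in> carrier G \<Longrightarrow> x \<in> K \<Longrightarrow> g \<otimes> x \<otimes> inv g \<in> K"
    and Ln: "\<And>g x. g \<in> carrier G \<Longrightarrow> x \<in> L \<Longrightarrow> g \<otimes> x \<otimes> inv g \<in> L"
    using K L unfolding normal_iff by auto
  show "K \<subseteq> cent L K"
  proof
    fix k assume k: "k \<in> K"
    have "k \<otimes> x \<otimes> inv k \<otimes> inv x \<in> K" if x: "x \<in> L" for x
    proof -
      have "k \<otimes> (x \<otimes> inv k \<otimes> inv x) \<in> K"
        using Kn[OF Lc[OF x], of "inv k"] k sK by (simp add: subgroup.m_closed subgroup.m_inv_closed)
      then show ?thesis using Kc[OF k] Lc[OF x] by (simp add: m_assoc)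
    qed
    then show "k \<in> cent L K" using Kc[OF k] unfolding cent_def by auto
  qed
  let ?F = "\<lambda>x. {g \<in> carrier G. x \<otimes> g \<otimes> inv x \<otimes> inv g \<in> K}"
  have F: "g \<in> cent L K \<longleftrightarrow> g \<in> carrier G \<and> (\<forall>x\<in>L. g \<in> ?F x)" for g
    unfolding cent_def using commutator_mem_swap[OF sK _ Lc] by blast
  have F_sub: "subgroup (?F x) G" if "x \<in> L" for x by (rule subgroup_commuting_mod[OF K Lc[OF that]])
  have mult: "g \<otimes> h \<in> cent L K" if "g \<in> cent L K" "h \<in> cent L K" for g h
    using that subgroup.m_closed[OF F_sub] unfolding F by simp
  have inv: "inv g \<in> cent L K" if "g \<in> cent L K" for g
    using that subgroup.m_inv_closed[OF F_sub] unfolding F by simp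
  have conj: "a \<otimes> g \<otimes> inv a \<in> cent L K" if a: "a \<in> carrier G" and g: "g \<in> cent L K" for a g
  proof -
    have c: "g \<in> carrier G" using g unfolding cent_def by auto
    have "(a \<otimes> g \<otimes> inv a) \<otimes> x \<otimes> inv (a \<otimes> g \<otimes> inv a) \<otimes> inv x \<in> K" if x: "x \<in> L" for x
    proof -
      define y where "y = inv a \<otimes> x \<otimes> a"
      have y: "y \<in> L" unfolding y_def using Ln[of "inv a" x] a x by simp
      have xy: "x = a \<otimes> y \<otimes> inv a" unfolding y_def using conj_inv_cancel(2)[OF a Lc[OF x]] by simp
      have "g \<otimes> y \<otimes> inv g \<otimes> inv y \<in> K" using g y unfolding cent_def by auto
      then have "a \<otimes> (g \<otimes> y \<otimes> inv g \<otimes> inv y) \<otimes> inv a \<in> K" using Kn a by simp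
      also have "a \<otimes> (g \<otimes> y \<otimes> inv g \<otimes> inv y) \<otimes> inv a =
          (a \<otimes> g \<otimes> inv a) \<otimes> x \<otimes> inv (a \<otimes> g \<otimes> inv a) \<otimes> inv x"
        unfolding xy using a c Lc[OF y] by (simp add: conj_inv conj_mult)
      finally show ?thesis .
    qed
    then show ?thesis using a c unfolding cent_def by auto
  qed
  have "\<one> \<in> cent L K" using subgroup.one_closed[OF sK] Lc unfolding cent_def by auto
  then have "subgroup (cent L K) G" using mult inv by (intro subgroupI) (auto simp: cent_def)
  then show "cent L K \<lhd> G" using conj unfolding normal_iff by auto
qed

lemma cent_subset_normalizing:
  assumes U: "subgroup U G" "J \<subseteq> U" "U \<subseteq> N"
  shows "cent N J \<subseteq> normalizing U"
proof
  fix c assume c: "c \<in> cent N J"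
  then have cc: "c \<in> carrier G" unfolding cent_def by auto
  have "c \<otimes> x \<otimes> inv c \<in> U" if x: "x \<in> U" for x
  proof -
    have xc: "x \<in> carrier G" using subgroup.mem_carrier[OF U(1) x] .
    have "c \<otimes> x \<otimes> inv c \<otimes> inv x \<in> U" using c U x unfolding cent_def by auto
    then have "c \<otimes> x \<otimes> inv c \<otimes> inv x \<otimes> x \<in> U" using x subgroup.m_closed[OF U(1)] by auto
    then show ?thesis using xc cc by (simp add: m_assoc)
  qed
  then show "c \<in> normalizing U" using cc unfolding normalizing_def by auto
qed
end

section \<open>Groups in which all maximal subgroups of subgroups have prime index\<close>

text \<open>This property is inherited by subgroups, which allows induction on the order, and suffices for
  supersolubility.\<close>

definition maximal_prime_indices :: "('a, 'b) monoid_scheme \<Rightarrow> bool" where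
  "maximal_prime_indices G \<longleftrightarrow> (\<forall>A M. subgroup A G \<longrightarrow> maximal_subgroup (G\<lparr>carrier := A\<rparr>) M \<longrightarrow>
     (\<exists>r :: nat. prime r \<and> card A = r * card M))"

context finite_group
begin

lemma maximal_prime_indices_subgroup:
  "maximal_prime_indices G \<Longrightarrow> subgroup A G \<Longrightarrow> maximal_prime_indices (G\<lparr>carrier := A\<rparr>)"
  unfolding maximal_prime_indices_def by (simp add: subgroup_carrier_iff)

lemma maximal_subgroup_iff:
  "maximal_subgroup G M \<longleftrightarrow> subgroup M G \<and> M \<subset> carrier G \<and>
    (\<forall>L. subgroup L G \<longrightarrow> M \<subseteq> L \<longrightarrow> L \<subseteq> carrier G \<longrightarrow> L = M \<or> L = carrier G)"
  unfolding maximal_subgroup_def using subgroup.subset[of _ G] by blast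

lemma maximal_subgroup_prime_index:
  assumes "maximal_prime_indices G" "maximal_subgroup G M"
  obtains r where "prime r" "order G = r * card M"
proof -
  have "maximal_subgroup (G\<lparr>carrier := carrier G\<rparr>) M"
    using assms(2) unfolding maximal_subgroup_carrier_iff[OF subgroup_self] maximal_subgroup_iff .
  then show thesis
    using assms(1) that subgroup_self unfolding maximal_prime_indices_def order_def by blast
qed

text \<open>The Frattini argument: the conjugate of \<open>S\<close> by \<open>g\<close> lies in \<open>U\<close>, and Sylow's theorem in \<open>U\<close> moves it back to \<open>S\<close>.\<close>

lemma conj_Sylow_in_subgroup:
  assumes J: "J \<lhd> G" "J \<subseteq> S" and S: "subgroup S G" "S \<subseteq> U" and U: "subgroup U G"
    and s: "prime s" "card S = s ^ a * card J" "\<not> s dvd card (rcosets\<^bsub>G\<lparr>carrier := U\<rparr>\<^esub> S)"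
    and g: "g \<in> carrier G" "\<And>q. q \<in> S \<Longrightarrow> g \<otimes> q \<otimes> inv g \<in> U"
  obtains u where "u \<in> U" "u \<otimes> g \<in> normalizing S"
proof -
  interpret U: finite_group "G\<lparr>carrier := U\<rparr>" by (rule finite_group_subgroup[OF U])
  have sJ: "subgroup J G" by (rule normal_imp_subgroup[OF J(1)])
  define T where "T = (\<lambda>q. g \<otimes> q \<otimes> inv g) ` S"
  have T: "subgroup T G" "card T = card S" using subgroup_conj[OF g(1) S(1)] unfolding T_def by auto
  have TU: "T \<subseteq> U" using g(2) unfolding T_def by auto
  have "J \<subseteq> T"
  proof
    fix j assume j: "j \<in> J"
    have "inv g \<otimes> j \<otimes> inv (inv g) \<in> J" using J(1) j g(1) unfolding normal_iff by blast
    then show "j \<in> T" unfolding T_def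
      using J(2) conj_inv_cancel(2)[OF g(1) subgroup.mem_carrier[OF sJ j]] g(1)
      by (metis (no_types, lifting) image_eqI inv_inv subsetD)
  qed
  obtain u where u: "u \<in> U" "\<And>q. q \<in> T \<Longrightarrow> u \<otimes> q \<otimes> inv u \<in> S"
    by (rule U.conj_into_subgroup_of_coprime_index[of J S T s a])
      (use normal_in_subgroup[OF J(1) U] J(2) S T TU \<open>J \<subseteq> T\<close> s m_inv_consistent[OF U]
        in \<open>auto simp: subgroup_carrier_iff[OF U]\<close>)
  have uc: "u \<in> carrier G" using u(1) subgroup.mem_carrier[OF U] by auto
  have "(u \<otimes> g) \<otimes> q \<otimes> inv (u \<otimes> g) \<in> S" if "q \<in> S" for q
    using u(2)[of "g \<otimes> q \<otimes> inv g"] that conj_conj[OF uc g(1) subgroup.mem_carrier[OF S(1) that]]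
    unfolding T_def by auto
  then have "u \<otimes> g \<in> normalizing S" using uc g(1) unfolding normalizing_def by auto
  then show thesis using u(1) that by blast
qed

text \<open>
  Let \<open>S/J\<close> be a Sylow \<open>s\<close>-subgroup of \<open>G/J\<close> for the largest prime divisor \<open>s\<close> of its order. If \<open>S\<close> were not normal, let \<open>M\<close> be a
  maximal subgroup above its normalizer. Acting on the cosets of \<open>M\<close>, the group \<open>S\<close> fixes exactly one, by Sylow's theorem in \<open>M\<close>. Then
  the prime \<open>|G : M|\<close> is congruent to \<open>1\<close> modulo \<open>s\<close>, hence larger than \<open>s\<close>.
\<close>

lemma normal_Sylow_of_largest_prime:
  assumes hyp: "maximal_prime_indices G" and J: "J \<lhd> G"
    and "J \<noteq> carrier G"
  obtains s S a where "prime s" "s dvd card (rcosets J)"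
    "S \<lhd> G" "J \<subseteq> S" "card S = s ^ a * card J" "1 < s ^ a" "\<not> s dvd card (rcosets S)"
proof -
  have sJ: "subgroup J G" by (rule normal_imp_subgroup[OF J])
  have posJ: "card J > 0" by (rule card_subgroup_pos[OF sJ])
  let ?n = "card (rcosets J)"
  have n0: "?n > 0" by (rule index_pos[OF sJ])
  have "?n \<noteq> 1"
    using index_mult[OF sJ] subgroup_eq_if_card[OF subgroup_self subgroup.subset[OF sJ]] assms(3)
    by (auto simp: order_def)
  then obtain s where s: "prime s" "s dvd ?n" and largest: "\<And>r. prime r \<Longrightarrow> r dvd ?n \<Longrightarrow> r \<le> s"
    using exists_largest_prime_divisor n0 by blast
  define a where "a = multiplicity s ?n"
  have a: "s ^ a dvd ?n" unfolding a_def by (rule multiplicity_dvd)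
  have "\<not> is_unit s" using s(1) by auto
  then have a': "\<not> s ^ Suc a dvd ?n" unfolding a_def using n0 by (simp add: power_dvd_iff_le_multiplicity del: power_Suc)
  have "0 < a" using a' s(2) by (cases a) auto
  then have "1 < s ^ a" by (rule one_less_power[OF prime_gt_1_nat[OF s(1)]])
  obtain S where S: "subgroup S G" "J \<subseteq> S" "card S = s ^ a * card J"
    by (rule exists_relative_Sylow[OF J s(1) a])
  have "card (rcosets S) * s ^ a * card J = ?n * card J"
    using index_mult[OF S(1)] index_mult[OF sJ] S(3) by (simp add: mult.assoc)
  then have n: "?n = card (rcosets S) * s ^ a" using posJ by (metis less_not_refl mult_right_cancel)
  have nS: "\<not> s dvd card (rcosets S)"
  proof
    assume "s dvd card (rcosets S)"
    then have "s * s ^ a dvd ?n" unfolding n by (rule mult_dvd_mono) simp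
    then show False using a' by simp
  qed
  have "normalizing S = carrier G"
  proof (rule ccontr)
    assume "normalizing S \<noteq> carrier G"
    then obtain M where M: "maximal_subgroup G M" "normalizing S \<subseteq> M"
      using exists_maximal_subgroup subgroup_normalizing[OF S(1)] by metis
    have sM: "subgroup M G" using M unfolding maximal_subgroup_def by auto
    have SM: "S \<subseteq> M" using M subgroup_normalizing[OF S(1)] by auto
    obtain r where r: "prime r" "order G = r * card M"
      by (rule maximal_subgroup_prime_index[OF hyp M(1)])
    have ri: "card (rcosets M) = r" by (rule index_eqI[OF sM r(2)])
    have JM: "J \<subseteq> M" using S SM by auto
    obtain c where c: "card M = c * card J"
      using card_subgroup_dvd[OF sM sJ JM] by (metis dvdE mult.commute)
    have "?n * card J = (r * c) * card J" using index_mult[OF sJ] r c by (simp add: mult.assoc)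
    then have "?n = r * c" using posJ by (metis less_not_refl mult_right_cancel)
    then have "r \<le> s" using largest[OF r(1)] by simp
    have nSM: "\<not> s dvd card (rcosets\<^bsub>G\<lparr>carrier := M\<rparr>\<^esub> S)"
    proof
      assume "s dvd card (rcosets\<^bsub>G\<lparr>carrier := M\<rparr>\<^esub> S)"
      moreover have "card (rcosets S) * card S = (r * card (rcosets\<^bsub>G\<lparr>carrier := M\<rparr>\<^esub> S)) * card S"
        using index_mult[OF S(1)] r index_mult_carrier[OF sM S(1) SM] by (simp add: mult.assoc)
      then have "card (rcosets S) = r * card (rcosets\<^bsub>G\<lparr>carrier := M\<rparr>\<^esub> S)"
        using card_subgroup_pos[OF S(1)] by (metis less_not_refl mult_right_cancel)
      ultimately show False using nS by simp
    qed
    have fixed: "g \<in> M" if g: "g \<in> carrier G" and gS: "\<And>q. q \<in> S \<Longrightarrow> g \<otimes> q \<otimes> inv g \<in> M" for g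
    proof -
      obtain m where m: "m \<in> M" "m \<otimes> g \<in> normalizing S"
        by (rule conj_Sylow_in_subgroup[OF J S(2,1) SM sM s(1) S(3) nSM g gS])
      have mc: "m \<in> carrier G" using m(1) subgroup.mem_carrier[OF sM] by auto
      have "m \<otimes> g \<in> M" using m(2) M(2) by auto
      then have "inv m \<otimes> (m \<otimes> g) \<in> M" using m(1) sM by (simp add: subgroup.m_closed subgroup.m_inv_closed)
      then show "g \<in> M" using mc g by (simp add: m_assoc[symmetric])
    qed
    \<comment> \<open>A fixed coset \<open>M #> g\<close> means that \<open>g\<close> conjugates \<open>S\<close> into \<open>M\<close>; by Sylow's theorem in \<open>M\<close>, a multiple of \<open>g\<close> by an
      element of \<open>M\<close> normalizes \<open>S\<close>, so \<open>g \<in> M\<close>.\<close>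
    have "{R \<in> rcosets M. \<forall>q\<in>S. R #> q = R} = {M}"
    proof (rule Set.equalityI; rule subsetI)
      fix R assume R: "R \<in> {R \<in> rcosets M. \<forall>q\<in>S. R #> q = R}"
      then obtain g where g: "g \<in> carrier G" "R = M #> g" by (auto simp: RCOSETS_def)
      have "g \<otimes> q \<otimes> inv g \<in> M" if "q \<in> S" for q
        using R g(2) rcoset_fixed_iff[OF sM g(1) subgroup.mem_carrier[OF S(1) that]] that by blast
      then have "g \<in> M" by (rule fixed[OF g(1)])
      then show "R \<in> {M}" using g subgroup.rcos_const[OF sM is_group] by simp
    next
      fix R assume "R \<in> {M}"
      then show "R \<in> {R \<in> rcosets M. \<forall>q\<in>S. R #> q = R}"
        using subgroup.subgroup_in_rcosets[OF sM is_group] subgroup.rcos_const[OF sM is_group] SM by auto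
    qed
    then have "[r = 1] (mod s)"
      using card_fixed_rcosets_cong[OF sM S(1) J JM S(2) s(1) S(3)] ri by simp
    then show False
      using \<open>r \<le> s\<close> prime_gt_1_nat[OF r(1)] prime_gt_1_nat[OF s(1)] by (cases "r = s") (auto simp: cong_def)
  qed
  then have "S \<lhd> G" using S(1) by (simp add: normal_iff_normalizing)
  then show thesis using that[OF s] S \<open>1 < s ^ a\<close> nS by blast
qed

text \<open>
  In general it is a consequence of the Schur--Zassenhaus theorem that a normal Sylow subgroup \<open>L/J\<close> does not lie
  in the Frattini subgroup; here a Frattini argument suffices. Let \<open>T/L\<close> be the normal Sylow subgroup of \<open>G/L\<close> for the largest
  prime, and \<open>S/J\<close> a Sylow subgroup of \<open>T/J\<close> for that prime, so \<open>T = LS\<close>. Then \<open>G = L N(S)\<close>.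
  If \<open>S\<close> is not normal in \<open>G\<close>, a maximal subgroup above \<open>N(S)\<close> does not contain \<open>L\<close>; if \<open>S\<close> is normal,
  the claim for \<open>J\<close> and \<open>L\<close> reduces to that for \<open>S\<close> and \<open>T\<close>.
\<close>

lemma normal_Sylow_not_Frattini:
  assumes hyp: "maximal_prime_indices G" and p: "prime p"
    and J: "J \<lhd> G" and L: "L \<lhd> G" and JL: "J \<subset> L"
    and card: "card L = p ^ a * card J" "\<not> p dvd card (rcosets L)"
  obtains M where "maximal_subgroup G M" "J \<subseteq> M" "\<not> L \<subseteq> M"
proof -
  have "\<exists>M. maximal_subgroup G M \<and> J \<subseteq> M \<and> \<not> L \<subseteq> M"
    using J L JL card
  proof (induction "order G - card J" arbitrary: J L rule: less_induct)
    case less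
    note J = less.prems(1) and L = less.prems(2) and JL = less.prems(3)
    have sJ: "subgroup J G" and sL: "subgroup L G" using J L normal_imp_subgroup by auto
    have posJ: "card J > 0" by (rule card_subgroup_pos[OF sJ])
    show ?case
    proof (cases "L = carrier G")
      case True
      then obtain M where "maximal_subgroup G M" "J \<subseteq> M"
        using exists_maximal_subgroup[OF sJ] JL by auto
      then show ?thesis using True unfolding maximal_subgroup_iff by blast
    next
      case False
      obtain s T b where s: "prime s" "s dvd card (rcosets L)"
        and T: "T \<lhd> G" "L \<subseteq> T" "card T = s ^ b * card L" "1 < s ^ b" "\<not> s dvd card (rcosets T)"
        by (rule normal_Sylow_of_largest_prime[OF hyp L False])
      have "s \<noteq> p" using s less.prems(5) by auto
      then have sp: "\<not> s dvd p ^ a" "\<not> p dvd s ^ b" for b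
        using s(1) p prime_dvd_power[of s p a] prime_dvd_power[of p s b] primes_dvd_imp_eq[of s p]
          primes_dvd_imp_eq[of p s] by auto
      have sT: "subgroup T G" by (rule normal_imp_subgroup[OF T(1)])
      have JT: "J \<subseteq> T" using JL T by auto
      interpret T: finite_group "G\<lparr>carrier := T\<rparr>" by (rule finite_group_subgroup[OF sT])
      have cT: "card T = (p ^ a * s ^ b) * card J" using T(3) less.prems(4) by simp
      have JTn: "J \<lhd> (G\<lparr>carrier := T\<rparr>)" by (rule normal_in_subgroup[OF J sT JT])
      have iT: "card (rcosets\<^bsub>G\<lparr>carrier := T\<rparr>\<^esub> J) = p ^ a * s ^ b"
        using index_mult_carrier[OF sT sJ JT] cT posJ by (metis less_not_refl mult_right_cancel)
      obtain S where S': "subgroup S (G\<lparr>carrier := T\<rparr>)" "J \<subseteq> S" "card S = s ^ b * card J"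
        by (rule T.exists_relative_Sylow[OF JTn s(1), of b]) (simp_all add: iT)
      have S: "subgroup S G" "S \<subseteq> T" using S'(1) by (auto simp: subgroup_carrier_iff[OF sT])
      have posS: "card S > 0" by (rule card_subgroup_pos[OF S(1)])
      have sLS: "subgroup (L \<inter> S) G" using sL S(1) by (rule subgroups_Inter_pair)
      \<comment> \<open>The orders of \<open>L/J\<close> and \<open>S/J\<close> are powers of different primes.\<close>
      have LS: "L \<inter> S = J"
      proof -
        have JLS: "J \<subseteq> L \<inter> S" using JL S'(2) by auto
        obtain c where c: "card (L \<inter> S) = c * card J"
          using card_subgroup_dvd[OF sLS sJ JLS] by (metis dvdE mult.commute)
        have "c * card J dvd s ^ b * card J" "c * card J dvd p ^ a * card J"
          using card_subgroup_dvd[OF S(1) sLS] card_subgroup_dvd[OF sL sLS] c S'(3) less.prems(4) by auto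
        then have "c dvd s ^ b" "c dvd p ^ a" using posJ by auto
        moreover have "coprime (s ^ b) (p ^ a)"
          using \<open>s \<noteq> p\<close> s(1) p by (simp add: primes_coprime)
        ultimately have "c = 1" using coprime_common_divisor_nat by blast
        then show ?thesis using c subgroup_eq_if_card[OF sLS JLS] by simp
      qed
      have LST: "L <#> S = T"
      proof (rule subgroup_eq_if_card[OF sT])
        show "L <#> S \<subseteq> T" using set_mult_normal_subgroup(4)[OF L S(1) sT] T S by auto
        have "card (L <#> S) * card J = card T * card J"
          using card_set_mult[OF sL S(1)] LS T(3) S'(3) by (simp add: mult_ac)
        then show "card T \<le> card (L <#> S)" using posJ by simp
      qed
      show ?thesis
      proof (cases "normalizing S = carrier G")
        case True
        then have Sn: "S \<lhd> G" using S by (simp add: normal_iff_normalizing)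
        have lt: "card J < card S" using S'(3) posJ T(4) by simp
        moreover have "card S \<le> order G" using subgroup.subset[OF S(1)] by (simp add: order_def card_mono)
        ultimately have dec: "order G - card S < order G - card J" by simp
        have cTS: "card T = p ^ a * card S" using cT S'(3) by simp
        have "S \<noteq> T"
        proof
          assume "S = T"
          then have "L = J" using LS T(2) by auto
          then show False using JL by simp
        qed
        have "\<not> p dvd card (rcosets T)"
        proof
          assume "p dvd card (rcosets T)"
          moreover have "card (rcosets L) * card L = (card (rcosets T) * s ^ b) * card L"
            using index_mult[OF sL] index_mult[OF sT] T(3) by (simp add: mult.assoc)
          then have "card (rcosets L) = card (rcosets T) * s ^ b"
            using card_subgroup_pos[OF sL] by (metis less_not_refl mult_right_cancel)
          ultimately show False using less.prems(5) by simp
        qed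
        then obtain M where M: "maximal_subgroup G M" "S \<subseteq> M" "\<not> T \<subseteq> M"
          using less.hyps[OF dec Sn T(1) _ cTS] S(2) \<open>S \<noteq> T\<close> by auto
        have "\<not> L \<subseteq> M"
          using M set_mult_normal_subgroup(4)[OF L S(1), of M] LST unfolding maximal_subgroup_iff by auto
        then show ?thesis using M(1,2) S'(2) by blast
      next
        case False
        then obtain M where M: "maximal_subgroup G M" "normalizing S \<subseteq> M"
          using exists_maximal_subgroup subgroup_normalizing[OF S(1)] by metis
        have sM: "subgroup M G" "M \<noteq> carrier G" using M unfolding maximal_subgroup_def by auto
        have SM: "S \<subseteq> M" using M subgroup_normalizing[OF S(1)] by auto
        have "\<not> L \<subseteq> M"
        proof
          assume "L \<subseteq> M"
          then have TM: "T \<subseteq> M" using set_mult_normal_subgroup(4)[OF L S(1) sM(1)] SM LST by auto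
          have "card (rcosets\<^bsub>G\<lparr>carrier := T\<rparr>\<^esub> S) * card S = p ^ a * card S"
            unfolding index_mult_carrier[OF sT S] unfolding cT S'(3) by (simp only: mult.assoc)
          then have iS: "card (rcosets\<^bsub>G\<lparr>carrier := T\<rparr>\<^esub> S) = p ^ a"
            using posS by (metis less_not_refl mult_right_cancel)
          have "g \<in> M" if g: "g \<in> carrier G" for g
          proof -
            have gS: "g \<otimes> q \<otimes> inv g \<in> T" if "q \<in> S" for q
              using T(1) S(2) g that unfolding normal_iff by auto
            obtain t where t: "t \<in> T" "t \<otimes> g \<in> normalizing S"
              by (rule conj_Sylow_in_subgroup[OF J S'(2) S sT s(1) S'(3) _ g gS]) (simp_all add: iS sp)
            have tc: "t \<in> carrier G" using t(1) subgroup.mem_carrier[OF sT] by auto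
            have "t \<otimes> g \<in> M" using t(2) M(2) by auto
            moreover have "t \<in> M" using t(1) TM by auto
            ultimately have "inv t \<otimes> (t \<otimes> g) \<in> M"
              using sM(1) by (simp add: subgroup.m_closed subgroup.m_inv_closed)
            then show "g \<in> M" using tc g by (simp add: m_assoc[symmetric])
          qed
          then have "M = carrier G" using subgroup.subset[OF sM(1)] by auto
          then show False using sM by simp
        qed
        then show ?thesis using M(1) SM S'(2) by blast
      qed
    qed
  qed
  then show thesis using that by auto
qed

lemma exists_chief_factor:
  assumes "K \<lhd> G" "N \<lhd> G" "K \<subset> N"
  obtains U where "chief_factor G U K" "U \<subseteq> N"
proof -
  let ?S = "{U. U \<lhd> G \<and> K \<subset> U \<and> U \<subseteq> N}"
  have "?S \<subseteq> Pow (carrier G)" using normal_imp_subgroup subgroup.subset by blast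
  then have fin: "finite ?S" by (rule finite_subset) simp
  have "N \<in> ?S" using assms by auto
  then have "?S \<noteq> {}" by (simp only: ex_in_conv[symmetric]) (rule exI)
  from finite_has_minimal[OF fin this] obtain U where U: "U \<in> ?S" "\<forall>V\<in>?S. V \<subseteq> U \<longrightarrow> U = V"
    by (elim bexE)
  have "V = K \<or> V = U" if "V \<lhd> G" "K \<subseteq> V" "V \<subseteq> U" for V
  proof (cases "V = K")
    case False
    then have "V \<in> ?S" using that U(1) by auto
    then show ?thesis using U(2) that(3) by auto
  qed simp
  then have "chief_factor G U K" unfolding chief_factor_def using assms(1) U(1) by auto
  then show thesis using U that by auto
qed

text \<open>Either \<open>N \<inter> S = J\<close>, which contains all commutators of \<open>S\<close> and \<open>N\<close>, or \<open>N \<subseteq> S\<close>. In the second case the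
  \<open>s\<close>-group \<open>S/J\<close> has nontrivial fixed points on \<open>N/J\<close>, and they form a subgroup normal in \<open>G\<close>, which must be all of
  \<open>N/J\<close>.\<close>

lemma chief_factor_centralized:
  assumes chief: "chief_factor G N J" and S: "S \<lhd> G" "J \<subseteq> S"
    and s: "prime s" "card S = s ^ a * card J"
  shows "S \<subseteq> cent N J"
proof -
  have N: "N \<lhd> G" and J: "J \<lhd> G" and JN: "J \<subset> N"
    and min: "\<And>V. V \<lhd> G \<Longrightarrow> J \<subseteq> V \<Longrightarrow> V \<subseteq> N \<Longrightarrow> V = J \<or> V = N"
    using chief unfolding chief_factor_def by auto
  have sN: "subgroup N G" and sJ: "subgroup J G" and sS: "subgroup S G"
    using N J S normal_imp_subgroup by auto
  have Nc: "\<And>x. x \<in> N \<Longrightarrow> x \<in> carrier G" and Jc: "\<And>x. x \<in> J \<Longrightarrow> x \<in> carrier G"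
    and Sc: "\<And>x. x \<in> S \<Longrightarrow> x \<in> carrier G"
    using subgroup.mem_carrier[OF sN] subgroup.mem_carrier[OF sJ] subgroup.mem_carrier[OF sS] by blast+
  have Nn: "\<And>g x. g \<in> carrier G \<Longrightarrow> x \<in> N \<Longrightarrow> g \<otimes> x \<otimes> inv g \<in> N"
    and Jn: "\<And>g x. g \<in> carrier G \<Longrightarrow> x \<in> J \<Longrightarrow> g \<otimes> x \<otimes> inv g \<in> J"
    and Sn: "\<And>g x. g \<in> carrier G \<Longrightarrow> x \<in> S \<Longrightarrow> g \<otimes> x \<otimes> inv g \<in> S"
    using N J S(1) unfolding normal_iff by auto
  have "N \<inter> S \<lhd> G" using N S(1) by (rule normal_subgroup_intersect)
  then have "N \<inter> S = J \<or> N \<inter> S = N" using min JN S(2) by blast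
  then show ?thesis
  proof
    assume NS: "N \<inter> S = J"
    show ?thesis
    proof
      fix g assume g: "g \<in> S"
      have "g \<otimes> x \<otimes> inv g \<otimes> inv x \<in> J" if x: "x \<in> N" for x
      proof -
        have "g \<otimes> x \<otimes> inv g \<otimes> inv x \<in> N"
          using Nn[OF Sc[OF g] x] x sN by (simp add: subgroup.m_closed subgroup.m_inv_closed)
        moreover have "g \<otimes> (x \<otimes> inv g \<otimes> inv x) \<in> S"
          using Sn[OF Nc[OF x], of "inv g"] g sS by (simp add: subgroup.m_closed subgroup.m_inv_closed)
        then have "g \<otimes> x \<otimes> inv g \<otimes> inv x \<in> S" using Sc[OF g] Nc[OF x] by (simp add: m_assoc)
        ultimately show ?thesis using NS by blast
      qed
      then show "g \<in> cent N J" using Sc[OF g] unfolding cent_def by auto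
    qed
  next
    assume "N \<inter> S = N"
    then have NS: "N \<subseteq> S" by auto
    interpret S: finite_group "G\<lparr>carrier := S\<rparr>" by (rule finite_group_subgroup[OF sS])
    define Z where "Z = {x \<in> N. \<forall>g\<in>S. g \<otimes> x \<otimes> inv g \<otimes> inv x \<in> J}"
    let ?E = "(\<lambda>x. J #> x) ` N"
    let ?f = "\<lambda>g R. (\<lambda>y. g \<otimes> y \<otimes> inv g) ` R"
    have f: "?f g (J #> x) = J #> (g \<otimes> x \<otimes> inv g)" if "g \<in> carrier G" "x \<in> carrier G" for g x
      by (rule conj_rcoset_normal[OF J that])
    have eq_iff: "J #> (g \<otimes> x \<otimes> inv g) = J #> x \<longleftrightarrow> g \<otimes> x \<otimes> inv g \<otimes> inv x \<in> J"
      if "g \<in> carrier G" "x \<in> N" for g x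
      by (rule rcoset_conj_eq_iff[OF sJ that(1) Nc[OF that(2)]])
    let ?F = "{R \<in> ?E. \<forall>g\<in>carrier (G\<lparr>carrier := S\<rparr>). ?f g R = R}"
    have cong: "[card ?E = card ?F] (mod s)"
    proof (rule S.card_fixed_points_cong[where J = J and a = a])
      show "finite ?E" using sN by simp
      show "subgroup J (G\<lparr>carrier := S\<rparr>)" using sJ S by (simp add: subgroup_carrier_iff[OF sS])
      show "order (G\<lparr>carrier := S\<rparr>) = s ^ a * card J" using s by (simp add: order_def)
      show "?f j R = R" if jJ: "j \<in> J" and RE: "R \<in> ?E" for j R
      proof -
        obtain x where x: "x \<in> N" "R = J #> x" using RE by (elim imageE)
        have "j \<otimes> (x \<otimes> inv j \<otimes> inv x) \<in> J"
          using Jn[OF Nc[OF x(1)], of "inv j"] jJ sJ by (simp add: subgroup.m_closed subgroup.m_inv_closed)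
        then have "j \<otimes> x \<otimes> inv j \<otimes> inv x \<in> J" using Jc[OF jJ] Nc[OF x(1)] by (simp add: m_assoc)
        then show ?thesis
          unfolding x(2) f[OF Jc[OF jJ] Nc[OF x(1)]] eq_iff[OF Jc[OF jJ] x(1)] .
      qed
      show "?f g R \<in> ?E" if gS: "g \<in> carrier (G\<lparr>carrier := S\<rparr>)" and RE: "R \<in> ?E" for g R
      proof -
        obtain x where x: "x \<in> N" "R = J #> x" using RE by (elim imageE)
        have g: "g \<in> carrier G" using gS Sc by simp
        show ?thesis unfolding x(2) f[OF g Nc[OF x(1)]] by (rule imageI[OF Nn[OF g x(1)]])
      qed
      show "?f \<one>\<^bsub>G\<lparr>carrier := S\<rparr>\<^esub> R = R" if RE: "R \<in> ?E" for R
      proof -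
        obtain x where x: "x \<in> N" "R = J #> x" using RE by (elim imageE)
        show ?thesis using f[OF one_closed Nc[OF x(1)]] Nc[OF x(1)] unfolding x(2) by simp
      qed
      show "?f (g \<otimes>\<^bsub>G\<lparr>carrier := S\<rparr>\<^esub> h) R = ?f g (?f h R)"
        if gh: "g \<in> carrier (G\<lparr>carrier := S\<rparr>)" "h \<in> carrier (G\<lparr>carrier := S\<rparr>)" and "R \<in> ?E" for g h R
      proof -
        obtain x where x: "x \<in> N" "R = J #> x" using \<open>R \<in> ?E\<close> by (elim imageE)
        have c: "g \<in> carrier G" "h \<in> carrier G" "x \<in> carrier G" using gh x Sc Nc by auto
        show ?thesis unfolding x(2) using c by (simp add: f conj_conj)
      qed
    qed (use s in auto)
    have E_eq: "?E = rcosets\<^bsub>G\<lparr>carrier := N\<rparr>\<^esub> J" unfolding RCOSETS_def by auto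
    have "card ?E * card J = card N" unfolding E_eq using index_mult_carrier[OF sN sJ] JN by auto
    moreover obtain d where "card S = d * card N"
      using card_subgroup_dvd[OF sS sN NS] by (metis dvdE mult.commute)
    ultimately have "card ?E * (d * card J) = s ^ a * card J" using s(2) by (simp add: mult_ac)
    then obtain j where j: "card ?E = s ^ j"
      by (rule prime_power_mult_cancel[OF s(1) _ _ card_subgroup_pos[OF sJ]]) simp
    have "j \<noteq> 0"
      using j \<open>card ?E * card J = card N\<close> subgroup_eq_if_card[OF sN, of J] JN by auto
    then have "s dvd card ?E" using j by simp
    then have dvd: "s dvd card ?F" using cong by (simp only: cong_def dvd_eq_mod_eq_0)
    have JF: "J \<in> ?F"
    proof -
      have "J = J #> \<one>" using subgroup.subset[OF sJ] by simp
      moreover have "\<one> \<in> N" using subgroup.one_closed[OF sN] .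
      moreover have "?f g J = J" if "g \<in> S" for g
        using f[OF Sc[OF that] one_closed] Sc[OF that] subgroup.subset[OF sJ] by simp
      ultimately show ?thesis by auto
    qed
    have "?F \<noteq> {J}"
    proof
      assume eq: "?F = {J}"
      have "s dvd 1" using dvd unfolding eq by simp
      then show False using prime_gt_1_nat[OF s(1)] by simp
    qed
    moreover have "\<exists>y\<in>A. y \<noteq> x" if "A \<noteq> {x}" "x \<in> A" for A :: "'a set set" and x
      using that by blast
    ultimately obtain R where R: "R \<in> ?F" "R \<noteq> J" using JF by (metis (no_types, lifting))
    then obtain x where x: "x \<in> N" "R = J #> x" by (elim CollectE conjE imageE)
    have "x \<notin> J" using R x subgroup.rcos_const[OF sJ is_group] by auto
    have "g \<otimes> x \<otimes> inv g \<otimes> inv x \<in> J" if "g \<in> S" for g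
      using R x f[OF Sc[OF that] Nc[OF x(1)]] eq_iff[OF Sc[OF that] x(1)] that by simp
    then have xZ: "x \<in> Z" using x unfolding Z_def by auto
    have JZ: "J \<subseteq> Z"
    proof
      fix j assume j: "j \<in> J"
      then have "g \<otimes> j \<otimes> inv g \<otimes> inv j \<in> J" if "g \<in> S" for g
        using Jn[OF Sc[OF that] j] sJ by (simp add: subgroup.m_closed subgroup.m_inv_closed)
      then show "j \<in> Z" using j JN unfolding Z_def by auto
    qed
    have comm: "subgroup {x \<in> carrier G. g \<otimes> x \<otimes> inv g \<otimes> inv x \<in> J} G" if "g \<in> S" for g
      by (rule subgroup_commuting_mod[OF J Sc[OF that]])
    have "subgroup Z G"
    proof (rule subgroupI)
      show "Z \<subseteq> carrier G" "Z \<noteq> {}" using xZ Nc unfolding Z_def by auto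
    next
      fix x assume x: "x \<in> Z"
      then have xN: "x \<in> N" unfolding Z_def by simp
      have xg: "x \<in> {x \<in> carrier G. g \<otimes> x \<otimes> inv g \<otimes> inv x \<in> J}" if "g \<in> S" for g
        using x that Nc[OF xN] unfolding Z_def by simp
      have "g \<otimes> inv x \<otimes> inv g \<otimes> inv (inv x) \<in> J" if "g \<in> S" for g
        using subgroup.m_inv_closed[OF comm[OF that] xg[OF that]] by blast
      then show "inv x \<in> Z" using subgroup.m_inv_closed[OF sN xN] unfolding Z_def by blast
      fix y assume y: "y \<in> Z"
      then have yN: "y \<in> N" unfolding Z_def by simp
      have yg: "y \<in> {x \<in> carrier G. g \<otimes> x \<otimes> inv g \<otimes> inv x \<in> J}" if "g \<in> S" for g
        using y that Nc[OF yN] unfolding Z_def by simp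
      have "g \<otimes> (x \<otimes> y) \<otimes> inv g \<otimes> inv (x \<otimes> y) \<in> J" if "g \<in> S" for g
        using subgroup.m_closed[OF comm[OF that] xg[OF that] yg[OF that]] by blast
      then show "x \<otimes> y \<in> Z" using subgroup.m_closed[OF sN xN yN] unfolding Z_def by blast
    qed
    moreover have "h \<otimes> x \<otimes> inv h \<in> Z" if h: "h \<in> carrier G" and x: "x \<in> Z" for h x
    proof -
      have c: "x \<in> N" using x unfolding Z_def by auto
      have "g \<otimes> (h \<otimes> x \<otimes> inv h) \<otimes> inv g \<otimes> inv (h \<otimes> x \<otimes> inv h) \<in> J" if g: "g \<in> S" for g
      proof -
        define k where "k = inv h \<otimes> g \<otimes> h"
        have k: "k \<in> S" unfolding k_def using Sn[of "inv h" g] h g by simp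
        have gk: "g = h \<otimes> k \<otimes> inv h" unfolding k_def using conj_inv_cancel(2)[OF h Sc[OF g]] by simp
        have "h \<otimes> (k \<otimes> x \<otimes> inv k \<otimes> inv x) \<otimes> inv h \<in> J" using Jn[OF h] x k unfolding Z_def by auto
        then show ?thesis unfolding gk using h Sc[OF k] Nc[OF c] by (simp add: conj_inv conj_mult)
      qed
      then show ?thesis using Nn[OF h c] unfolding Z_def by auto
    qed
    ultimately have "Z \<lhd> G" unfolding normal_iff by auto
    then have "Z = J \<or> Z = N" using min JZ unfolding Z_def by auto
    then have "Z = N" using xZ \<open>x \<notin> J\<close> by auto
    then show ?thesis unfolding Z_def cent_def using Sc by blast
  qed
qed

end

text \<open>
  Let \<open>C = C\<^sub>G(N/J)\<close>. A maximal subgroup \<open>M\<close> that contains \<open>J\<close> but not \<open>C\<close> satisfies \<open>MC = G\<close>, so every subgroup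
  between \<open>J\<close> and \<open>N\<close> that \<open>M\<close> normalizes is normal in \<open>G\<close>: the claim then follows either from the prime
  index of \<open>M\<close> or from the claim for \<open>M\<close>. Such an \<open>M\<close> exists, because \<open>C/J\<close> contains a normal Sylow
  subgroup of \<open>G/J\<close>, which does not lie in the Frattini subgroup.
\<close>

lemma chief_factor_prime_order:
  assumes "finite_group G" "maximal_prime_indices G" "chief_factor G N J"
  shows "\<exists>p. prime p \<and> card N = p * card J"
  using assms
proof (induction "order G" arbitrary: G N J rule: less_induct)
  case (less G N J)
  interpret finite_group G by fact
  note hyp = less.prems(2)
  have N: "N \<lhd> G" and J: "J \<lhd> G" and JN: "J \<subset> N"
    and min: "\<And>V. V \<lhd> G \<Longrightarrow> J \<subseteq> V \<Longrightarrow> V \<subseteq> N \<Longrightarrow> V = J \<or> V = N"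
    using less.prems(3) unfolding chief_factor_def by auto
  have sN: "subgroup N G" and sJ: "subgroup J G" using N J normal_imp_subgroup by auto
  have posJ: "card J > 0" by (rule card_subgroup_pos[OF sJ])
  let ?C = "cent N J"
  obtain M where M: "maximal_subgroup G M" "J \<subseteq> M" "\<not> ?C \<subseteq> M"
  proof -
    have Jne: "J \<noteq> carrier G" using JN subgroup.subset[OF sN] by auto
    obtain s S a where s: "prime s" and S: "S \<lhd> G" "J \<subseteq> S" "card S = s ^ a * card J" "1 < s ^ a"
      "\<not> s dvd card (rcosets\<^bsub>G\<^esub> S)"
      by (rule normal_Sylow_of_largest_prime[OF hyp J Jne])
    have "J \<subset> S" using S(2-4) posJ by auto
    then obtain M where "maximal_subgroup G M" "J \<subseteq> M" "\<not> S \<subseteq> M"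
      using normal_Sylow_not_Frattini[OF hyp s J S(1) _ S(3,5)] by metis
    then show thesis using that chief_factor_centralized[OF less.prems(3) S(1,2) s S(3)] by blast
  qed
  have sM: "subgroup M G" "M \<noteq> carrier G" using M unfolding maximal_subgroup_def by auto
  have all_normal: "U \<lhd> G" if U: "subgroup U G" "J \<subseteq> U" "U \<subseteq> N" "M \<subseteq> normalizing U" for U
  proof -
    have "?C \<subseteq> normalizing U" by (rule cent_subset_normalizing[OF U(1-3)])
    then have "normalizing U \<noteq> M" using M(3) by auto
    then have "normalizing U = carrier G"
      using M(1) U(4) subgroup_normalizing[OF U(1)] unfolding maximal_subgroup_def by blast
    then show ?thesis using U(1) by (simp add: normal_iff_normalizing)
  qed
  show ?case
  proof (cases "N \<subseteq> M")
    case False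
    have sNM: "subgroup (N \<inter> M) G" using sN sM(1) by (rule subgroups_Inter_pair)
    have "M \<subseteq> normalizing (N \<inter> M)"
      using N subgroup.mem_carrier[OF sM(1)] subgroup.m_closed[OF sM(1)] subgroup.m_inv_closed[OF sM(1)]
      unfolding normalizing_def normal_iff by auto
    then have "N \<inter> M \<lhd> G" using all_normal[OF sNM] JN M(2) by auto
    then have NM: "N \<inter> M = J" using min[of "N \<inter> M"] JN M(2) False by auto
    obtain r where r: "prime r" "order G = r * card M" by (rule maximal_subgroup_prime_index[OF hyp M(1)])
    have "N <#>\<^bsub>G\<^esub> M = carrier G"
      using set_mult_normal_subgroup[OF N sM(1)] M(1) False unfolding maximal_subgroup_def by metis
    then have "r * card M * card J = card N * card M"
      using card_set_mult[OF sN sM(1)] NM r(2) by (simp add: order_def)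
    then have "card N = r * card J" using card_subgroup_pos[OF sM(1)] by simp
    then show ?thesis using r by blast
  next
    case True
    interpret M: finite_group "G\<lparr>carrier := M\<rparr>" by (rule finite_group_subgroup[OF sM(1)])
    obtain U where U: "chief_factor (G\<lparr>carrier := M\<rparr>) U J" "U \<subseteq> N"
      by (rule M.exists_chief_factor[of J N])
        (use normal_in_subgroup[OF N sM(1) True] normal_in_subgroup[OF J sM(1) M(2)] JN in auto)
    have "card M < card (carrier G)"
      using sM subgroup.subset[OF sM(1)] by (intro psubset_card_mono) auto
    then have "\<exists>p. prime p \<and> card U = p * card J"
      using less.hyps[of "G\<lparr>carrier := M\<rparr>" U J] U M.finite_group_axioms
        maximal_prime_indices_subgroup[OF hyp sM(1)] by (simp add: order_def)
    moreover have "U = N"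
    proof -
      have "U \<lhd> (G\<lparr>carrier := M\<rparr>)" "J \<subset> U" using U(1) unfolding chief_factor_def by auto
      then have "U \<lhd> G" using all_normal[of U] U(2) by (auto simp: normal_in_iff_normalizing[OF sM(1)])
      then show ?thesis using min[of U] \<open>J \<subset> U\<close> U(2) by auto
    qed
    ultimately show ?thesis by simp
  qed
qed

section \<open>Automorphisms induced on factors of prime order\<close>

lemma (in group) prime_order_generator:
  assumes fin: "finite (carrier G)" and p: "prime p" "order G = p" and a: "a \<in> carrier G" "a \<noteq> \<one>"
  shows "ord a = p" and "generate G {a} = carrier G"
proof -
  have "ord a dvd p" using ord_dvd_group_order[OF a(1)] p(2) by simp
  then show ord: "ord a = p" using p(1) ord_eq_1[OF a(1)] a(2) by (metis prime_nat_iff)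
  then have "card (generate G {a}) = card (carrier G)"
    using generate_pow_card[OF a(1)] p(2) by (simp add: order_def)
  then show "generate G {a} = carrier G"
    using generate_incl[of "{a}"] a(1) fin by (simp add: card_subset_eq)
qed

context finite_group
begin

text \<open>
  \<open>G\<close> acts on the group \<open>N/J\<close> of prime order \<open>p\<close> by raising a generator to powers prime to \<open>p\<close>, that is, to powers
  of a primitive root \<open>\<rho>\<close>. The exponents of \<open>\<rho>\<close> that occur are the multiples of the least positive one,
  and an element with that exponent generates \<open>G\<close> modulo \<open>C\<^sub>G(N/J)\<close>.
\<close>

lemma prime_factor_cent_generator:
  assumes J: "J \<lhd> G" and N: "N \<lhd> G" and JN: "J \<subseteq> N" and p: "prime p" "card N = p * card J"
  obtains g where "g \<in> carrier G"
    "\<And>h. h \<in> carrier G \<Longrightarrow> \<exists>i::nat. h \<otimes> inv (g [^] i) \<in> cent N J"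
proof -
  have sN: "subgroup N G" and sJ: "subgroup J G" using N J normal_imp_subgroup by auto
  have Nc: "\<And>x. x \<in> N \<Longrightarrow> x \<in> carrier G" using subgroup.mem_carrier[OF sN] by blast
  have Jc: "\<And>x. x \<in> J \<Longrightarrow> x \<in> carrier G" using subgroup.mem_carrier[OF sJ] by blast
  have Nn: "\<And>g x. g \<in> carrier G \<Longrightarrow> x \<in> N \<Longrightarrow> g \<otimes> x \<otimes> inv g \<in> N"
    and Jn: "\<And>g x. g \<in> carrier G \<Longrightarrow> x \<in> J \<Longrightarrow> g \<otimes> x \<otimes> inv g \<in> J"
    using N J unfolding normal_iff by auto
  have p1: "p > 1" using prime_gt_1_nat[OF p(1)] .
  interpret N: finite_group "G\<lparr>carrier := N\<rparr>" by (rule finite_group_subgroup[OF sN])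
  have JNn: "J \<lhd> (G\<lparr>carrier := N\<rparr>)" by (rule normal_in_subgroup[OF J sN JN])
  interpret JN: normal J "G\<lparr>carrier := N\<rparr>" by (rule JNn)
  define Q where "Q = G\<lparr>carrier := N\<rparr> Mod J"
  interpret Q: group Q unfolding Q_def by (rule JN.factorgroup_is_group)
  have carrier_Q: "carrier Q = (\<lambda>x. J #> x) ` N" unfolding Q_def by (simp add: carrier_FactGroup)
  have "card (carrier Q) * card J = card N"
    using index_mult_carrier[OF sN sJ JN] unfolding Q_def by (simp add: FactGroup_def)
  then have order_Q: "order Q = p" using p(2) card_subgroup_pos[OF sJ] unfolding order_def by simp
  have "J \<noteq> N" using p p1 card_subgroup_pos[OF sJ] by auto
  then obtain x where x: "x \<in> N" "x \<notin> J" using JN by auto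
  define a where "a = J #> x"
  have aQ: "a \<in> carrier Q" using x carrier_Q a_def by auto
  have pow_Q: "(J #> y) [^]\<^bsub>Q\<^esub> (k::nat) = J #> y [^] k" if "y \<in> N" for y k
    using JN.FactGroup_pow[of y k] that nat_pow_consistent[of y k N] unfolding Q_def by simp
  have "a \<noteq> \<one>\<^bsub>Q\<^esub>"
    using x rcos_self[OF Nc[OF x(1)] sJ] unfolding a_def Q_def by auto
  have fin_Q: "finite (carrier Q)" using carrier_Q sN by simp
  note generator = Q.prime_order_generator[OF fin_Q p(1) order_Q aQ \<open>a \<noteq> \<one>\<^bsub>Q\<^esub>\<close>]
  have ord_a: "Q.ord a = p" by (rule generator(1))
  have gen: "\<exists>k::nat. R = a [^]\<^bsub>Q\<^esub> k" if "R \<in> carrier Q" for R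
    using Q.generate_pow_on_finite_carrier[OF fin_Q aQ] generator(2) that by auto
  have pow_eq: "a [^]\<^bsub>Q\<^esub> k = a [^]\<^bsub>Q\<^esub> l \<longleftrightarrow> [k = l] (mod p)" for k l :: nat
  proof -
    have "a [^]\<^bsub>Q\<^esub> k = a [^]\<^bsub>Q\<^esub> l \<longleftrightarrow> int p dvd int l - int k"
      using Q.int_pow_eq[OF aQ, of "int k" "int l"] ord_a by (simp add: int_pow_int)
    then show ?thesis
      unfolding cong_iff_dvd_diff[symmetric] cong_int_iff using cong_sym_eq by blast
  qed
  \<comment> \<open>\<open>act g k\<close>: conjugation by \<open>g\<close> raises the generator \<open>a\<close>, hence every element of \<open>N/J\<close>, to the power \<open>k\<close>. The
    exponent is determined modulo \<open>p\<close> and multiplicative in \<open>g\<close>.\<close>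
  define act where "act g k \<longleftrightarrow> J #> (g \<otimes> x \<otimes> inv g) = a [^]\<^bsub>Q\<^esub> k" for g and k :: nat
  have act_ex: "\<exists>k. act g k" if "g \<in> carrier G" for g
    unfolding act_def using gen Nn[OF that x(1)] carrier_Q by auto
  have act_cong: "act g l" if "act g k" "[k = l] (mod p)" for g k l
    using that pow_eq unfolding act_def by auto
  have act_unique: "[k = l] (mod p)" if "act g k" "act g l" for g k l
    using that pow_eq[of k l] unfolding act_def by simp
  have conj_pow: "g \<otimes> y [^] (l::nat) \<otimes> inv g = (g \<otimes> y \<otimes> inv g) [^] l"
    if "g \<in> carrier G" "y \<in> carrier G" for g y l
    by (induction l) (use that in \<open>simp_all add: conj_mult[symmetric]\<close>)
  have act_on: "J #> (g \<otimes> y \<otimes> inv g) = a [^]\<^bsub>Q\<^esub> (k * l)"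
    if g: "g \<in> carrier G" "act g k" and y: "y \<in> N" "J #> y = a [^]\<^bsub>Q\<^esub> l" for g k y l
  proof -
    have "J #> y = J #> x [^] l" using y pow_Q[OF x(1)] unfolding a_def by simp
    then have "y \<in> J #> x [^] l" using rcos_self[OF Nc[OF y(1)] sJ] by auto
    then obtain j where j: "j \<in> J" "y = j \<otimes> x [^] l" unfolding r_coset_def by auto
    have xl: "x [^] l \<in> carrier G" using Nc[OF x(1)] by simp
    have "g \<otimes> y \<otimes> inv g = (g \<otimes> j \<otimes> inv g) \<otimes> (g \<otimes> x \<otimes> inv g) [^] l"
      using conj_mult[OF g(1) Jc[OF j(1)] xl] conj_pow[OF g(1) Nc[OF x(1)], of l] unfolding j(2) by simp
    then have "J #> (g \<otimes> y \<otimes> inv g) = J #> (g \<otimes> x \<otimes> inv g) [^] l"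
      using coset_mult_assoc[OF subgroup.subset[OF sJ] Jc[OF Jn[OF g(1) j(1)]],
          of "(g \<otimes> x \<otimes> inv g) [^] l"]
        coset_join2[OF Jc[OF Jn[OF g(1) j(1)]] sJ Jn[OF g(1) j(1)]] g(1) Nc[OF x(1)] by simp
    also have "\<dots> = (J #> (g \<otimes> x \<otimes> inv g)) [^]\<^bsub>Q\<^esub> l" using pow_Q[OF Nn[OF g(1) x(1)]] by simp
    also have "\<dots> = a [^]\<^bsub>Q\<^esub> (k * l)" using g(2) Q.nat_pow_pow[OF aQ] unfolding act_def by simp
    finally show ?thesis .
  qed
  have act_mult: "act (g \<otimes> h) (k * l)" if "g \<in> carrier G" "h \<in> carrier G" "act g k" "act h l" for g h k l
    using act_on[OF that(1,3) Nn[OF that(2) x(1)], of l] that conj_conj[OF that(1,2) Nc[OF x(1)]]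
    unfolding act_def by simp
  have act_one: "act \<one> 1" unfolding act_def using Nc[OF x(1)] aQ a_def by simp
  have act_cent: "g \<in> cent N J" if g: "g \<in> carrier G" "act g 1" for g
  proof -
    have "g \<otimes> y \<otimes> inv g \<otimes> inv y \<in> J" if y: "y \<in> N" for y
    proof -
      obtain l :: nat where l: "J #> y = a [^]\<^bsub>Q\<^esub> l" using gen carrier_Q y by blast
      have "J #> (g \<otimes> y \<otimes> inv g) = J #> y" using act_on[OF g y l] l by simp
      then have "g \<otimes> y \<otimes> inv g \<in> J #> y" using rcos_self[OF Nc[OF Nn[OF g(1) y]] sJ] by simp
      then show ?thesis using subgroup.rcos_module[OF sJ is_group Nc[OF y] Nc[OF Nn[OF g(1) y]]] by simp
    qed
    then show ?thesis using g unfolding cent_def by auto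
  qed
  obtain \<rho> where \<rho>: "residue_primroot p \<rho>" using prime_primitive_root_exists[OF p1 p(1)] by auto
  \<comment> \<open>The exponent is a unit modulo \<open>p\<close>, its inverse being the exponent of \<open>inv g\<close>.\<close>
  have act_root: "\<exists>i. act g (\<rho> ^ i)" if g: "g \<in> carrier G" for g
  proof -
    obtain k where k: "act g k" using act_ex[OF g] by auto
    obtain l where l: "act (inv g) l" using act_ex[of "inv g"] g by auto
    have "act \<one> (k * l)" using act_mult[OF g _ k l] g by simp
    then have "[k * l = 1] (mod p)" using act_unique act_one by blast
    then have "coprime (k * l) p" using cong_imp_coprime[OF cong_sym, of "k * l" 1 p] by simp
    then have cop: "coprime k p" by simp
    have "0 < k mod p"
    proof (rule Nat.gr0I)
      assume "k mod p = 0"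
      then have "p dvd k" by (simp only: dvd_eq_mod_eq_0)
      then show False using cop p1 coprime_common_divisor[OF cop, of p] by simp
    qed
    moreover have "k mod p \<le> p" using p1 by (simp add: less_imp_le)
    ultimately have "k mod p \<in> totatives p" using cop by (simp add: totatives_def)
    then have "k mod p \<in> (\<lambda>i. \<rho> ^ i mod p) ` {..<totient p}"
      unfolding bij_betw_imp_surj_on[OF residue_primroot_is_generator[OF p1 \<rho>]] .
    then obtain i where "k mod p = \<rho> ^ i mod p" by (elim imageE)
    then show ?thesis using act_cong[OF k, of "\<rho> ^ i"] unfolding cong_def by auto
  qed
  define d where "d = (LEAST i. 0 < i \<and> (\<exists>g\<in>carrier G. act g (\<rho> ^ i)))"
  have "[\<rho> ^ totient p = 1] (mod p)" using \<rho> euler_theorem[of \<rho> p]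
    unfolding residue_primroot_def by (simp add: coprime_commute)
  then have "act \<one> (\<rho> ^ totient p)" using act_cong[OF act_one] cong_sym by blast
  then have "0 < totient p \<and> (\<exists>g\<in>carrier G. act g (\<rho> ^ totient p))"
    using p1 by (auto intro!: bexI[of _ \<one>])
  from LeastI[of "\<lambda>i. 0 < i \<and> (\<exists>g\<in>carrier G. act g (\<rho> ^ i))", OF this]
  have d: "0 < d" "\<exists>g\<in>carrier G. act g (\<rho> ^ d)" unfolding d_def by blast+
  have least: "r = 0" if "r < d" "g \<in> carrier G" "act g (\<rho> ^ r)" for r g
    using not_less_Least[of r "\<lambda>i. 0 < i \<and> (\<exists>g\<in>carrier G. act g (\<rho> ^ i))"] that unfolding d_def by auto
  obtain g where g: "g \<in> carrier G" "act g (\<rho> ^ d)" using d by auto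
  obtain m where m: "act (inv g) (\<rho> ^ m)" using act_root[of "inv g"] g by auto
  have "act \<one> (\<rho> ^ d * \<rho> ^ m)" using act_mult[OF g(1) _ g(2) m] g(1) by simp
  then have dm: "[\<rho> ^ d * \<rho> ^ m = 1] (mod p)" using act_unique act_one by blast
  have act_pow: "act (inv g [^] i) ((\<rho> ^ m) ^ i)" for i :: nat
  proof (induction i)
    case (Suc i)
    show ?case using act_mult[OF _ _ Suc m] g(1) by (simp add: mult.commute)
  qed (use act_one in simp)
  have "\<exists>i::nat. h \<otimes> inv (g [^] i) \<in> cent N J" if h: "h \<in> carrier G" for h
  proof -
    obtain i where i: "act h (\<rho> ^ i)" using act_root[OF h] by auto
    let ?q = "i div d" and ?r = "i mod d"
    have hg: "h \<otimes> inv g [^] ?q \<in> carrier G" using h g(1) by simp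
    have 1: "act (h \<otimes> inv g [^] ?q) (\<rho> ^ i * (\<rho> ^ m) ^ ?q)"
      using act_mult[OF h _ i act_pow[of ?q]] g(1) by simp
    have "\<rho> ^ i = \<rho> ^ ?r * (\<rho> ^ d) ^ ?q"
      by (simp add: power_mult[symmetric] power_add[symmetric])
    then have "\<rho> ^ i * (\<rho> ^ m) ^ ?q = \<rho> ^ ?r * (\<rho> ^ d * \<rho> ^ m) ^ ?q" by (simp add: power_mult_distrib)
    moreover have "[\<rho> ^ ?r * (\<rho> ^ d * \<rho> ^ m) ^ ?q = \<rho> ^ ?r * 1 ^ ?q] (mod p)"
      by (intro cong_mult cong_pow dm) simp
    ultimately have 2: "act (h \<otimes> inv g [^] ?q) (\<rho> ^ ?r)" using act_cong[OF 1] by simp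
    moreover have "?r = 0" using least[OF _ hg 2] d(1) by simp
    ultimately have "act (h \<otimes> inv g [^] ?q) 1" by simp
    then have "h \<otimes> inv g [^] ?q \<in> cent N J" by (rule act_cent[OF hg])
    then show ?thesis using nat_pow_inv[OF g(1)] by auto
  qed
  then show thesis using that g(1) by blast
qed
end

section \<open>Cores and modular embeddings\<close>

context finite_group
begin

text \<open>Some term of the lower central series is not contained in \<open>M/K\<close> while the next one is; commutators of
  elements \<open>y\<close> of the former with \<open>M/K\<close> lie in the latter, so \<open>y\<close> normalizes \<open>M/K\<close>.\<close>

lemma maximal_normal_if_nilpotent_quotient:
  assumes K: "K \<lhd> G" "K \<subseteq> M" and M: "maximal_subgroup G M" and nil: "nilpotent_group (G Mod K)"
  shows "M \<lhd> G"
proof -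
  interpret K: normal K G by (rule K)
  interpret Q: group "G Mod K" by (rule K.factorgroup_is_group)
  have sM: "subgroup M G" "M \<noteq> carrier G" using M unfolding maximal_subgroup_def by auto
  have Mc: "\<And>x. x \<in> M \<Longrightarrow> x \<in> carrier G" using subgroup.mem_carrier[OF sM(1)] by blast
  let ?\<pi> = "\<lambda>g. K #> g"
  interpret \<pi>: group_hom G "G Mod K" ?\<pi>
    unfolding group_hom_def group_hom_axioms_def using K.r_coset_hom_Mod Q.is_group by auto
  have in_M: "g \<in> M" if g: "g \<in> carrier G" "?\<pi> g \<in> ?\<pi> ` M" for g
  proof -
    obtain m where m: "m \<in> M" "K #> g = K #> m" using g by auto
    then have "g \<in> K #> m" using rcos_self[OF g(1) K.subgroup_axioms] by auto
    then show ?thesis using K(2) m(1) subgroup.m_closed[OF sM(1)] unfolding r_coset_def by auto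
  qed
  obtain n where n: "lower_central (G Mod K) n = {\<one>\<^bsub>G Mod K\<^esub>}" using nil unfolding nilpotent_group_def by auto
  have "\<one>\<^bsub>G Mod K\<^esub> = ?\<pi> \<one>" using K.subset by simp
  then have ex: "lower_central (G Mod K) n \<subseteq> ?\<pi> ` M" using imageI[OF subgroup.one_closed[OF sM(1)], of ?\<pi>] unfolding n
    by (metis empty_subsetI insert_subset)
  define l where "l = (LEAST n. lower_central (G Mod K) n \<subseteq> ?\<pi> ` M)"
  have l: "lower_central (G Mod K) l \<subseteq> ?\<pi> ` M" unfolding l_def using ex by (rule LeastI)
  have "l \<noteq> 0"
  proof
    assume "l = 0"
    then have "?\<pi> g \<in> ?\<pi> ` M" if "g \<in> carrier G" for g
      using l that by (auto simp: carrier_FactGroup)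
    then show False using in_M sM subgroup.subset[OF sM(1)] by blast
  qed
  then obtain i where i: "l = Suc i" by (cases l) auto
  have "\<not> lower_central (G Mod K) i \<subseteq> ?\<pi> ` M" using not_less_Least[of i "\<lambda>n. lower_central (G Mod K) n \<subseteq> ?\<pi> ` M"] i
    unfolding l_def by auto
  then obtain y where y: "y \<in> lower_central (G Mod K) i" "y \<notin> ?\<pi> ` M" by auto
  have lc: "lower_central (G Mod K) j \<subseteq> carrier (G Mod K)" for j
  proof (induction j)
    case (Suc j)
    have "a \<otimes>\<^bsub>G Mod K\<^esub> b \<otimes>\<^bsub>G Mod K\<^esub> inv\<^bsub>G Mod K\<^esub> a \<otimes>\<^bsub>G Mod K\<^esub> inv\<^bsub>G Mod K\<^esub> b \<in> carrier (G Mod K)"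
      if "a \<in> lower_central (G Mod K) j" "b \<in> carrier (G Mod K)" for a b
      using that Suc by (intro Q.m_closed Q.inv_closed) auto
    then show ?case unfolding lower_central.simps by (intro Q.generate_incl) blast
  qed simp
  then obtain g where g: "g \<in> carrier G" "y = ?\<pi> g" using y(1) by (force simp: carrier_FactGroup)
  have "g \<otimes> m \<otimes> inv g \<in> M" if m: "m \<in> M" for m
  proof -
    have "?\<pi> (g \<otimes> m \<otimes> inv g \<otimes> inv m) =
        ?\<pi> g \<otimes>\<^bsub>G Mod K\<^esub> ?\<pi> m \<otimes>\<^bsub>G Mod K\<^esub> inv\<^bsub>G Mod K\<^esub> ?\<pi> g \<otimes>\<^bsub>G Mod K\<^esub> inv\<^bsub>G Mod K\<^esub> ?\<pi> m"
      using g(1) Mc[OF m] by (simp only: \<pi>.hom_mult \<pi>.hom_inv m_closed inv_closed)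
    also have "\<dots> \<in> lower_central (G Mod K) (Suc i)"
      unfolding lower_central.simps
      by (rule generate.incl) (use y(1) g(2) \<pi>.hom_closed[OF Mc[OF m]] in blast)
    finally have "g \<otimes> m \<otimes> inv g \<otimes> inv m \<in> M" using l i in_M g(1) Mc[OF m] by auto
    then have "g \<otimes> m \<otimes> inv g \<otimes> inv m \<otimes> m \<in> M" using m subgroup.m_closed[OF sM(1)] by auto
    then show ?thesis using g(1) Mc[OF m] by (simp add: m_assoc)
  qed
  then have "g \<in> normalizing M" using g(1) unfolding normalizing_def by auto
  moreover have "g \<notin> M" using y(2) g(2) by auto
  ultimately have "normalizing M = carrier G"
    using M subgroup_normalizing[OF sM(1)] unfolding maximal_subgroup_def by blast
  then show ?thesis using sM by (simp add: normal_iff_normalizing)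
qed

lemma mem_core_iff:
  assumes H: "subgroup H G"
  shows "x \<in> core G H \<longleftrightarrow> x \<in> carrier G \<and> (\<forall>g\<in>carrier G. g \<otimes> x \<otimes> inv g \<in> H)"
proof -
  have Hc: "\<And>h. h \<in> H \<Longrightarrow> h \<in> carrier G" using subgroup.mem_carrier[OF H] by blast
  have mem: "x \<in> (g <# H) #> inv g \<longleftrightarrow> x \<in> carrier G \<and> inv g \<otimes> x \<otimes> g \<in> H" if g: "g \<in> carrier G" for g
  proof
    assume "x \<in> (g <# H) #> inv g"
    then obtain h where h: "h \<in> H" "x = g \<otimes> h \<otimes> inv g" unfolding l_coset_def r_coset_def by auto
    then show "x \<in> carrier G \<and> inv g \<otimes> x \<otimes> g \<in> H" using conj_inv_cancel(1)[OF g Hc] g Hc by auto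
  next
    assume x: "x \<in> carrier G \<and> inv g \<otimes> x \<otimes> g \<in> H"
    then have "x = g \<otimes> (inv g \<otimes> x \<otimes> g) \<otimes> inv g" using conj_inv_cancel(2)[OF g] by simp
    then show "x \<in> (g <# H) #> inv g" using x unfolding l_coset_def r_coset_def by blast
  qed
  have "x \<in> core G H \<longleftrightarrow> (\<forall>g\<in>carrier G. x \<in> carrier G \<and> inv g \<otimes> x \<otimes> g \<in> H)"
    unfolding core_def using mem by simp
  also have "\<dots> \<longleftrightarrow> x \<in> carrier G \<and> (\<forall>g\<in>carrier G. inv g \<otimes> x \<otimes> g \<in> H)" by auto
  also have "(\<forall>g\<in>carrier G. inv g \<otimes> x \<otimes> g \<in> H) \<longleftrightarrow> (\<forall>g\<in>carrier G. g \<otimes> x \<otimes> inv g \<in> H)"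
    by (metis inv_closed inv_inv)
  finally show ?thesis .
qed

lemma core_normal:
  assumes H: "subgroup H G"
  shows "core G H \<lhd> G" "core G H \<subseteq> H"
proof -
  have Hc: "\<And>h. h \<in> H \<Longrightarrow> h \<in> carrier G" using subgroup.mem_carrier[OF H] by blast
  show "core G H \<subseteq> H" using mem_core_iff[OF H] by (force dest: bspec[of _ _ \<one>])
  have "subgroup (core G H) G"
  proof (rule subgroupI)
    show "core G H \<subseteq> carrier G" using mem_core_iff[OF H] by auto
    have "\<one> \<in> core G H" using mem_core_iff[OF H] subgroup.one_closed[OF H] by simp
    then show "core G H \<noteq> {}" by auto
  next
    fix a assume a: "a \<in> core G H"
    show "inv a \<in> core G H" unfolding mem_core_iff[OF H]
    proof (intro conjI ballI)
      fix g assume g: "g \<in> carrier G"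
      have "inv (g \<otimes> a \<otimes> inv g) \<in> H" using a g subgroup.m_inv_closed[OF H] by (simp add: mem_core_iff[OF H])
      then show "g \<otimes> inv a \<otimes> inv g \<in> H" using a g by (simp add: conj_inv mem_core_iff[OF H])
    qed (use a mem_core_iff[OF H] in auto)
    fix b assume b: "b \<in> core G H"
    show "a \<otimes> b \<in> core G H" unfolding mem_core_iff[OF H]
    proof (intro conjI ballI)
      fix g assume g: "g \<in> carrier G"
      have c: "a \<in> carrier G" "b \<in> carrier G" using a b mem_core_iff[OF H] by auto
      have "(g \<otimes> a \<otimes> inv g) \<otimes> (g \<otimes> b \<otimes> inv g) \<in> H"
        using a b g subgroup.m_closed[OF H] by (simp add: mem_core_iff[OF H])
      then show "g \<otimes> (a \<otimes> b) \<otimes> inv g \<in> H" using conj_mult[OF g c] by simp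
    qed (use a b mem_core_iff[OF H] in auto)
  qed
  moreover have "g \<otimes> x \<otimes> inv g \<in> core G H" if "g \<in> carrier G" "x \<in> core G H" for g x
    using that by (simp add: mem_core_iff[OF H] conj_conj)
  ultimately show "core G H \<lhd> G" unfolding normal_iff by auto
qed

lemma normal_subset_core:
  assumes "subgroup H G" "K \<lhd> G" "K \<subseteq> H"
  shows "K \<subseteq> core G H"
proof
  fix x assume x: "x \<in> K"
  have "g \<otimes> x \<otimes> inv g \<in> H" if "g \<in> carrier G" for g
    using assms(2,3) that x unfolding normal_iff by blast
  then show "x \<in> core G H"
    using x subgroup.mem_carrier[OF normal_imp_subgroup[OF assms(2)]] by (simp add: mem_core_iff[OF assms(1)])
qed

text \<open>Commutators of the core with \<open>L\<close> lie in \<open>L \<inter> M = K\<close>. In the other direction, \<open>M \<inter> C\<^sub>G(L/K)\<close> is normalized by \<open>M\<close> and by \<open>L\<close>.\<close>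

lemma core_eq_Int_cent:
  assumes K: "K \<lhd> G" and L: "L \<lhd> G" and M: "subgroup M G"
    and prod: "L <#> M = carrier G" "L \<inter> M = K"
  shows "core G M = M \<inter> cent L K"
proof
  have sL: "subgroup L G" and sK: "subgroup K G" using K L normal_imp_subgroup by auto
  have Lc: "\<And>x. x \<in> L \<Longrightarrow> x \<in> carrier G" and Mc: "\<And>x. x \<in> M \<Longrightarrow> x \<in> carrier G"
    using subgroup.mem_carrier[OF sL] subgroup.mem_carrier[OF M] by blast+
  show "core G M \<subseteq> M \<inter> cent L K"
  proof
    fix g assume g: "g \<in> core G M"
    have gc: "g \<in> carrier G" using g mem_core_iff[OF M] by auto
    have "g \<otimes> x \<otimes> inv g \<otimes> inv x \<in> K" if x: "x \<in> L" for x
    proof -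
      have "inv g \<in> core G M" using g normal_imp_subgroup[OF core_normal(1)[OF M]]
        by (simp add: subgroup.m_inv_closed)
      then have "x \<otimes> inv g \<otimes> inv x \<in> M" using Lc[OF x] by (simp add: mem_core_iff[OF M])
      then have "g \<otimes> (x \<otimes> inv g \<otimes> inv x) \<in> M" using g core_normal(2)[OF M] subgroup.m_closed[OF M] by blast
      then have "g \<otimes> x \<otimes> inv g \<otimes> inv x \<in> M" using Lc[OF x] gc by (simp add: m_assoc)
      moreover have "g \<otimes> x \<otimes> inv g \<in> L" using L x gc unfolding normal_iff by auto
      then have "g \<otimes> x \<otimes> inv g \<otimes> inv x \<in> L"
        using x sL by (simp add: subgroup.m_closed subgroup.m_inv_closed)
      ultimately show ?thesis using prod(2) by auto
    qed
    then show "g \<in> M \<inter> cent L K" using g core_normal(2)[OF M] gc unfolding cent_def by auto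
  qed
  let ?D = "M \<inter> cent L K"
  have Cn: "cent L K \<lhd> G" "K \<subseteq> cent L K" using cent_normal[OF K L] by auto
  have sD: "subgroup ?D G" using M normal_imp_subgroup[OF Cn(1)] by (rule subgroups_Inter_pair)
  have "M \<subseteq> normalizing ?D"
    using Cn(1) Mc subgroup.m_closed[OF M] subgroup.m_inv_closed[OF M]
    unfolding normalizing_def normal_iff by auto
  moreover have "L \<subseteq> normalizing ?D"
  proof
    fix x assume x: "x \<in> L"
    have "x \<otimes> d \<otimes> inv x \<in> ?D" if d: "d \<in> ?D" for d
    proof -
      have dc: "d \<in> carrier G" using d Mc by auto
      have "d \<otimes> x \<otimes> inv d \<otimes> inv x \<in> K" using d x unfolding cent_def by auto
      then have "x \<otimes> d \<otimes> inv x \<otimes> inv d \<in> ?D"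
        using commutator_mem_swap[OF sK dc Lc[OF x]] prod(2) Cn(2) by blast
      then have "x \<otimes> d \<otimes> inv x \<otimes> inv d \<otimes> d \<in> ?D" using d subgroup.m_closed[OF sD] by blast
      then show ?thesis using Lc[OF x] dc by (simp add: m_assoc)
    qed
    then show "x \<in> normalizing ?D" using Lc[OF x] unfolding normalizing_def by auto
  qed
  ultimately have "carrier G \<subseteq> normalizing ?D"
    using set_mult_normal_subgroup(4)[OF L M subgroup_normalizing(1)[OF sD]] prod(1) by auto
  then have "?D \<lhd> G" using sD by (simp add: normal_iff_normalizing)
  then show "M \<inter> cent L K \<subseteq> core G M" using normal_subset_core[OF M] by auto
qed

lemma modularly_embeddedD:
  assumes "modularly_embedded n G H" "\<not> H \<lhd> G"
  obtains p q where "prime p" "prime q" "order G = p * card H" "order G = p * q ^ n * card (core G H)"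
proof -
  have H: "subgroup H G" using assms(1) unfolding modularly_embedded_def by auto
  obtain p q where pq: "prime p" "prime q" "order (G Mod core G H) = p * q ^ n" "card (rcosets H) = p"
    using assms unfolding modularly_embedded_def by auto
  show thesis
  proof (rule that[OF pq(1,2)])
    show "order G = p * card H" using pq(4) index_mult[OF H] by simp
    show "order G = p * q ^ n * card (core G H)"
      using pq(3) index_mult[OF normal_imp_subgroup[OF core_normal(1)[OF H]]] unfolding order_Mod by simp
  qed
qed

lemma maximal_subgroup_of_prime_index:
  "subgroup M G \<Longrightarrow> prime p \<Longrightarrow> order G = p * card M \<Longrightarrow> maximal_subgroup G M"
  using maximal_if_prime_index[OF subgroup_self, of M p] subgroup.subset[of M G]
  unfolding maximal_subgroup_carrier_iff[OF subgroup_self] maximal_subgroup_iff by (auto simp: order_def)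

text \<open>The quotient by the core cannot be nilpotent unless \<open>H\<close> is normal: a subgroup of prime index is maximal.\<close>

lemma modularly_embeddedI:
  assumes H: "subgroup H G" and p: "prime p" "prime q"
    and card: "order G = p * card H" "order G = p * q ^ n * card (core G H)"
  shows "modularly_embedded n G H"
proof (cases "H \<lhd> G")
  case False
  have "\<not> nilpotent_group (G Mod core G H)"
    using maximal_normal_if_nilpotent_quotient[OF core_normal[OF H]
        maximal_subgroup_of_prime_index[OF H p(1) card(1)]] False by blast
  moreover have "order (G Mod core G H) = p * q ^ n"
    unfolding order_Mod using index_eqI[OF normal_imp_subgroup[OF core_normal(1)[OF H]] card(2)] .
  moreover have "card (rcosets H) = p" by (rule index_eqI[OF H card(1)])
  ultimately show ?thesis using H p unfolding modularly_embedded_def by blast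
qed (use H in \<open>simp add: modularly_embedded_def\<close>)

lemma submodularI:
  assumes "modularly_embedded n G H" "1 \<le> n" "n \<le> k"
  shows "submodular k G H"
proof -
  have "subgroup H G" using assms(1) unfolding modularly_embedded_def by auto
  then show ?thesis unfolding submodular_def
    by (intro exI[of _ "\<lambda>i. if i = 0 then H else carrier G"] exI[of _ 1])
      (use assms subgroup_self subgroup.subset[of H G] in auto)
qed

text \<open>The last proper term of a chain from a maximal subgroup is that subgroup itself.\<close>

lemma maximal_submodular_iff:
  assumes M: "maximal_subgroup G M"
  shows "submodular k G M \<longleftrightarrow> (\<exists>n. 1 \<le> n \<and> n \<le> k \<and> modularly_embedded n G M)"
proof
  assume "submodular k G M"
  then obtain C m where C: "C 0 = M" "C m = carrier G" "\<And>i. i \<le> m \<Longrightarrow> subgroup (C i) G"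
    "\<And>i. i < m \<Longrightarrow> C i \<subseteq> C (Suc i) \<and>
        (\<exists>n. 1 \<le> n \<and> n \<le> k \<and> modularly_embedded n (G\<lparr>carrier := C (Suc i)\<rparr>) (C i))"
    unfolding submodular_def by blast
  define i where "i = (LEAST i. C i \<noteq> M)"
  have "C m \<noteq> M" using C(2) M unfolding maximal_subgroup_def by auto
  then have i: "C i \<noteq> M" "i \<le> m" unfolding i_def by (rule LeastI, rule Least_le)
  then obtain j where j: "i = Suc j" using C(1) by (cases i) auto
  have Cj: "C j = M" using not_less_Least[of j "\<lambda>i. C i \<noteq> M"] j unfolding i_def by auto
  have "C i = carrier G" using M C(3)[OF i(2)] C(4)[of j] i j Cj unfolding maximal_subgroup_def by auto
  then show "\<exists>n. 1 \<le> n \<and> n \<le> k \<and> modularly_embedded n G M" using C(4)[of j] i j Cj by auto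
qed (use submodularI in blast)

lemma submodular_trans:
  assumes M: "submodular k G M" and H: "submodular k (G\<lparr>carrier := M\<rparr>) H"
  shows "submodular k G H"
proof -
  obtain C m where C: "C 0 = M" "C m = carrier G" "\<And>i. i \<le> m \<Longrightarrow> subgroup (C i) G"
    "\<And>i. i < m \<Longrightarrow> C i \<subseteq> C (Suc i) \<and>
        (\<exists>n. 1 \<le> n \<and> n \<le> k \<and> modularly_embedded n (G\<lparr>carrier := C (Suc i)\<rparr>) (C i))"
    using M unfolding submodular_def by blast
  have sM: "subgroup M G" using C(3)[of 0] C(1) by simp
  obtain D l where D: "D 0 = H" "D l = M" "\<And>i. i \<le> l \<Longrightarrow> subgroup (D i) G"
    "\<And>i. i < l \<Longrightarrow> D i \<subseteq> D (Suc i) \<and>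
        (\<exists>n. 1 \<le> n \<and> n \<le> k \<and> modularly_embedded n (G\<lparr>carrier := D (Suc i)\<rparr>) (D i))"
    using H subgroup_carrier_iff[OF sM] unfolding submodular_def by auto
  define E where "E i = (if i \<le> l then D i else C (i - l))" for i
  have 1: "E 0 = H" "E (l + m) = carrier G" using C D unfolding E_def by auto
  have 2: "subgroup (E i) G" if "i \<le> l + m" for i using that C(3)[of "i - l"] D(3)[of i] unfolding E_def by auto
  have 3: "E i \<subseteq> E (Suc i) \<and>
        (\<exists>n. 1 \<le> n \<and> n \<le> k \<and> modularly_embedded n (G\<lparr>carrier := E (Suc i)\<rparr>) (E i))" if i: "i < l + m" for i
  proof -
    consider "i < l" | "i = l" | "l < i" by linarith
    then show ?thesis
    proof cases
      case 1
      then show ?thesis using D(4)[OF 1] unfolding E_def by simp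
    next
      case 2
      then have "0 < m" using i by simp
      moreover have "E i = C 0" "E (Suc i) = C (Suc 0)" using 2 C(1) D(2) unfolding E_def by auto
      ultimately show ?thesis using C(4)[of 0] by simp
    next
      case 3
      then have "E i = C (i - l)" "E (Suc i) = C (Suc (i - l))" "i - l < m"
        using i unfolding E_def by (auto simp: Suc_diff_le)
      then show ?thesis using C(4)[of "i - l"] by simp
    qed
  qed
  show ?thesis unfolding submodular_def
    by (rule exI[of _ E], rule exI[of _ "l + m"]) (use 1 2 3 in blast)
qed

text \<open>Here \<open>a\<close> is \<open>|KA : K| = |A : K \<inter> A|\<close>.\<close>

lemma relative_order:
  assumes K: "K \<lhd> G" and A: "subgroup A G" and E: "subgroup E G" "K \<subseteq> E" "A \<subseteq> E" "card E = m * card K"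
  obtains a where "card A = a * card (K \<inter> A)" "a dvd m"
proof -
  have sK: "subgroup K G" by (rule normal_imp_subgroup[OF K])
  have pos: "card K > 0" by (rule card_subgroup_pos[OF sK])
  note KA = set_mult_normal_subgroup[OF K A]
  obtain a where a: "card (K <#> A) = a * card K"
    using card_subgroup_dvd[OF KA(1) sK KA(2)] by (metis dvdE mult.commute)
  have "a * card K dvd m * card K"
    using card_subgroup_dvd[OF E(1) KA(1) KA(4)[OF E(1-3)]] a E(4) by simp
  then have "a dvd m" using pos by simp
  have "a * card K * card (K \<inter> A) = card K * card A"
    using card_set_mult[OF sK A] unfolding a .
  then have "card A * card K = (a * card (K \<inter> A)) * card K" by (simp only: mult_ac)
  then have "card A = a * card (K \<inter> A)" using pos by (metis less_not_refl mult_right_cancel)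
  then show thesis using that \<open>a dvd m\<close> by blast
qed

text \<open>The core of \<open>M\<close> contains \<open>N\<close>, so its index in \<open>M\<close> is a power \<open>q\<^sup>l\<close> with \<open>l \<le> b\<close>; for \<open>l = 0\<close> the subgroup \<open>M\<close> is normal.\<close>

lemma modularly_embedded_if_prime_power_index:
  assumes M: "subgroup M G" and N: "N \<lhd> G" "N \<subseteq> M" and p: "prime p" "prime q"
    and card: "order G = p * card M" "card M = q ^ b * card N" "b \<le> n" "1 \<le> n"
  shows "\<exists>l. 1 \<le> l \<and> l \<le> n \<and> modularly_embedded l G M"
proof -
  have sN: "subgroup N G" by (rule normal_imp_subgroup[OF N(1)])
  let ?C = "core G M"
  have sC: "subgroup ?C G" "?C \<subseteq> M" using core_normal[OF M] normal_imp_subgroup by auto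
  have NC: "N \<subseteq> ?C" by (rule normal_subset_core[OF M N])
  obtain f where f: "card M = f * card ?C" using card_subgroup_dvd[OF M sC] by (metis dvdE mult.commute)
  have "f * card ?C = q ^ b * card N" using f card by simp
  then obtain l where l: "f = q ^ l" "l \<le> b"
    by (rule prime_power_mult_cancel[OF p(2) _ card_subgroup_dvd[OF sC(1) sN NC] card_subgroup_pos[OF sN]])
  show ?thesis
  proof (cases "l = 0")
    case True
    then have "?C = M" using f l subgroup_eq_if_card[OF M sC(2)] by simp
    then have "modularly_embedded 1 G M"
      using core_normal(1)[OF M] M unfolding modularly_embedded_def by simp
    then show ?thesis using card(4) by blast
  next
    case False
    have "order G = p * q ^ l * card ?C" using card(1) f l by simp
    then have "modularly_embedded l G M" by (rule modularly_embeddedI[OF M p card(1)])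
    moreover have "1 \<le> l" using False by simp
    ultimately show ?thesis using l(2) card(3) by (meson le_trans)
  qed
qed

text \<open>
  Let \<open>E\<close> be modularly embedded but not normal, with core \<open>K\<close>. A subgroup \<open>B\<close> acts on the \<open>p\<close> cosets of \<open>E\<close>:
  if \<open>p\<close> divides \<open>|B : B \<inter> K|\<close> this action is transitive, and otherwise \<open>B/(B \<inter> K)\<close> is a \<open>q\<close>-group.
\<close>

lemma modularly_embedded_dichotomy:
  assumes E: "modularly_embedded n G E" "\<not> E \<lhd> G" and B: "subgroup B G"
  obtains p q K where "prime p" "prime q" "K \<lhd> G" "K \<subseteq> E"
    "(\<exists>c\<le>n. card B = q ^ c * card (K \<inter> B)) \<or>
     (\<exists>b\<le>n. card B = p * card (E \<inter> B) \<and> card (E \<inter> B) = q ^ b * card (K \<inter> B))"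
proof -
  have sE: "subgroup E G" using E unfolding modularly_embedded_def by auto
  obtain p q where pq: "prime p" "prime q" and card: "order G = p * card E" "order G = p * q ^ n * card (core G E)"
    by (rule modularly_embeddedD[OF E])
  define K where "K = core G E"
  have K: "K \<lhd> G" "K \<subseteq> E" using core_normal[OF sE] unfolding K_def by auto
  have sK: "subgroup K G" by (rule normal_imp_subgroup[OF K(1)])
  have maxE: "maximal_subgroup G E" by (rule maximal_subgroup_of_prime_index[OF sE pq(1) card(1)])
  \<comment> \<open>For \<open>p = q\<close> the quotient by the core would be a \<open>p\<close>-group, in which \<open>E\<close>, being maximal, would be normal.\<close>
  have "p \<noteq> q"
  proof
    assume "p = q"
    then have "order G = p ^ Suc n * card K" using card(2) unfolding K_def by simp
    then show False using maximal_normal_if_prime_power_quotient[OF K maxE pq(1)] E(2) by blast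
  qed
  have cE: "card E = q ^ n * card K"
    using card prime_gt_0_nat[OF pq(1)] unfolding K_def by (simp add: mult.assoc)
  have KcG: "K \<subseteq> carrier G" "B \<subseteq> carrier G" using subgroup.subset[OF sK] subgroup.subset[OF B] by auto
  have "card (carrier G) = (p * q ^ n) * card K" using card(2) unfolding K_def order_def .
  then obtain a where a: "card B = a * card (K \<inter> B)" "a dvd p * q ^ n"
    by (rule relative_order[OF K(1) B subgroup_self KcG])
  show thesis
  proof (cases "p dvd a")
    case False
    then have "coprime a p" using prime_imp_coprime[OF pq(1)] coprime_commute by blast
    then have "a dvd q ^ n" using a(2) by (simp add: coprime_dvd_mult_right_iff)
    then obtain c where "c \<le> n" "a = q ^ c" using divides_primepow_nat[OF pq(2)] by auto
    then show thesis using a that[OF pq K] by blast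
  next
    case True
    have sEB: "subgroup (E \<inter> B) G" using sE B by (rule subgroups_Inter_pair)
    have posEB: "card (E \<inter> B) > 0" by (rule card_subgroup_pos[OF sEB])
    have eq: "K \<inter> (E \<inter> B) = K \<inter> B" using K by auto
    obtain d where d: "card (E \<inter> B) = d * card (K \<inter> (E \<inter> B))" "d dvd q ^ n"
      by (rule relative_order[OF K(1) sEB sE K(2) _ cE]) auto
    obtain b where b: "b \<le> n" "d = q ^ b" using divides_primepow_nat[OF pq(2)] d(2) by auto
    obtain c where c: "card B = c * card (E \<inter> B)"
      using card_subgroup_dvd[OF B sEB] by (metis Int_lower2 dvdE mult.commute)
    have posKB: "card (K \<inter> B) > 0" by (rule card_subgroup_pos[OF subgroups_Inter_pair[OF sK B]])
    have "a * card (K \<inter> B) = (c * d) * card (K \<inter> B)" using a(1) c d(1) unfolding eq by (metis mult.assoc)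
    then have "a = c * d" using posKB by (metis less_not_refl mult_right_cancel)
    moreover have "\<not> p dvd d"
      using b(2) \<open>p \<noteq> q\<close> pq prime_dvd_power[of p q b] primes_dvd_imp_eq by blast
    ultimately have "p dvd c" using True pq(1) by (simp add: prime_dvd_mult_iff)
    have "card E * card B \<le> order G * card (E \<inter> B)"
      using card_set_mult_le[OF sE B subgroup_self subgroup.subset[OF sE] KcG(2)] by (simp add: order_def)
    then have "card E * (c * card (E \<inter> B)) \<le> card E * (p * card (E \<inter> B))" using c card(1) by (simp add: mult_ac)
    then have "c \<le> p" using posEB card_subgroup_pos[OF sE] by simp
    moreover have "c > 0" using c card_subgroup_pos[OF B] by (auto intro: Nat.gr0I)
    ultimately have "c = p" using \<open>p dvd c\<close> by (simp add: dvd_imp_le le_antisym)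
    then show thesis using c d(1) b that[OF pq K] unfolding eq by blast
  qed
qed

lemma modularly_embedded_Int_maximal:
  assumes E: "modularly_embedded n G E" "1 \<le> n" and A: "subgroup A G"
    and M: "maximal_subgroup (G\<lparr>carrier := A\<rparr>) (E \<inter> A)"
  shows "\<exists>l. 1 \<le> l \<and> l \<le> n \<and> modularly_embedded l (G\<lparr>carrier := A\<rparr>) (E \<inter> A)"
proof -
  interpret A: finite_group "G\<lparr>carrier := A\<rparr>" by (rule finite_group_subgroup[OF A])
  have sE: "subgroup E G" using E unfolding modularly_embedded_def by auto
  have sEA: "subgroup (E \<inter> A) (G\<lparr>carrier := A\<rparr>)"
    using subgroups_Inter_pair[OF sE A] by (simp add: subgroup_carrier_iff[OF A])
  have Int_normal: "N \<inter> A \<lhd> (G\<lparr>carrier := A\<rparr>)" if "N \<lhd> G" for N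
    using normal_Int_subgroup[OF A that] by (simp add: Int_commute)
  have normal: ?thesis if "E \<inter> A \<lhd> (G\<lparr>carrier := A\<rparr>)"
    using that sEA E(2) unfolding modularly_embedded_def by blast
  show ?thesis
  proof (cases "E \<lhd> G")
    case True
    then show ?thesis using normal Int_normal by blast
  next
    case False
    obtain p q K where pq: "prime p" "prime q" and K: "K \<lhd> G" "K \<subseteq> E" and
      alt: "(\<exists>c\<le>n. card A = q ^ c * card (K \<inter> A)) \<or>
        (\<exists>b\<le>n. card A = p * card (E \<inter> A) \<and> card (E \<inter> A) = q ^ b * card (K \<inter> A))"
      by (rule modularly_embedded_dichotomy[OF E(1) False A])
    have KEA: "K \<inter> A \<subseteq> E \<inter> A" using K by auto
    show ?thesis using alt
    proof (elim disjE exE conjE)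
      fix c assume "c \<le> n" "card A = q ^ c * card (K \<inter> A)"
      then have "E \<inter> A \<lhd> (G\<lparr>carrier := A\<rparr>)"
        using A.maximal_normal_if_prime_power_quotient[OF Int_normal[OF K(1)] KEA M pq(2), of c]
        by (simp add: order_def)
      then show ?thesis by (rule normal)
    next
      fix b assume "b \<le> n" "card A = p * card (E \<inter> A)" "card (E \<inter> A) = q ^ b * card (K \<inter> A)"
      then show ?thesis
        using A.modularly_embedded_if_prime_power_index[OF sEA Int_normal[OF K(1)] KEA pq, of b n] E(2)
        by (simp add: order_def)
    qed
  qed
qed

text \<open>Intersecting a submodular chain of \<open>M\<close> with \<open>A\<close> gives only \<open>M\<close> and \<open>A\<close>, so a single step matters.\<close>

lemma submodular_maximal_in_subgroup:
  assumes A: "subgroup A G" and M: "maximal_subgroup (G\<lparr>carrier := A\<rparr>) M" and sub: "submodular k G M"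
  shows "\<exists>l. 1 \<le> l \<and> l \<le> k \<and> modularly_embedded l (G\<lparr>carrier := A\<rparr>) M"
proof -
  have M': "subgroup M G" "M \<subset> A" "\<And>L. subgroup L G \<Longrightarrow> M \<subseteq> L \<Longrightarrow> L \<subseteq> A \<Longrightarrow> L = M \<or> L = A"
    using M unfolding maximal_subgroup_carrier_iff[OF A] by auto
  obtain C m where C: "C 0 = M" "C m = carrier G" "\<And>i. i \<le> m \<Longrightarrow> subgroup (C i) G"
    "\<And>i. i < m \<Longrightarrow> C i \<subseteq> C (Suc i) \<and>
        (\<exists>n. 1 \<le> n \<and> n \<le> k \<and> modularly_embedded n (G\<lparr>carrier := C (Suc i)\<rparr>) (C i))"
    using sub unfolding submodular_def by blast
  define i where "i = (LEAST i. A \<subseteq> C i)"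
  have "A \<subseteq> C m" using C(2) subgroup.subset[OF A] by simp
  then have i: "A \<subseteq> C i" "i \<le> m" unfolding i_def by (rule LeastI, rule Least_le)
  then obtain j where j: "i = Suc j" using C(1) M'(2) by (cases i) auto
  have nj: "\<not> A \<subseteq> C j" using not_less_Least[of j "\<lambda>i. A \<subseteq> C i"] j unfolding i_def by auto
  have jm: "j < m" using i j by simp
  have MC: "M \<subseteq> C l" if "l \<le> m" for l using that
  proof (induction l)
    case (Suc l)
    then show ?case using C(4)[of l] by auto
  qed (use C(1) in simp)
  have sCj: "subgroup (C j) G" and sCi: "subgroup (C i) G" using C(3) jm i(2) by auto
  interpret D: finite_group "G\<lparr>carrier := C i\<rparr>" by (rule finite_group_subgroup[OF sCi])
  have "subgroup (C j \<inter> A) G" using sCj A by (rule subgroups_Inter_pair)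
  then have Int: "C j \<inter> A = M" using M'(3)[of "C j \<inter> A"] MC[of j] jm M'(2) nj by auto
  obtain n where n: "1 \<le> n" "n \<le> k" "modularly_embedded n (G\<lparr>carrier := C i\<rparr>) (C j)"
    using C(4)[OF jm] j by auto
  have "subgroup A (G\<lparr>carrier := C i\<rparr>)" using A i(1) by (simp add: subgroup_carrier_iff[OF sCi])
  then show ?thesis
    using D.modularly_embedded_Int_maximal[OF n(3,1), of A] M n(2) unfolding Int by (auto intro: le_trans)
qed

lemma prime_index_if_modularly_embedded:
  assumes A: "subgroup A G" and M: "maximal_subgroup (G\<lparr>carrier := A\<rparr>) M"
    and emb: "modularly_embedded n (G\<lparr>carrier := A\<rparr>) M"
  shows "\<exists>r. prime r \<and> card A = r * card M"
proof -
  interpret A: finite_group "G\<lparr>carrier := A\<rparr>" by (rule finite_group_subgroup[OF A])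
  show ?thesis
  proof (cases "M \<lhd> (G\<lparr>carrier := A\<rparr>)")
    case True
    then show ?thesis using normal_maximal_prime_index[OF A M] by (metis normal_in_iff_normalizing[OF A])
  next
    case False
    then show ?thesis using A.modularly_embeddedD[OF emb] by (simp add: order_def) metis
  qed
qed

lemma n_maximal_subgroup:
  "n_maximal G n L \<Longrightarrow> subgroup L G \<and> (n \<noteq> 0 \<longrightarrow> L \<subset> carrier G)"
proof (induction n arbitrary: L)
  case (Suc n)
  then obtain U where U: "n_maximal G n U" "maximal_subgroup (G\<lparr>carrier := U\<rparr>) L" by auto
  have sU: "subgroup U G" using Suc.IH[OF U(1)] by simp
  show ?case using U(2) subgroup.subset[OF sU] unfolding maximal_subgroup_carrier_iff[OF sU] by auto
qed (simp add: subgroup_self)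

lemma n_maximal_maximal_eq_one:
  assumes M: "maximal_subgroup G M" and n: "n_maximal G n M"
  shows "n = 1"
proof (cases n)
  case 0
  then show ?thesis using M n unfolding maximal_subgroup_def by simp
next
  case (Suc i)
  then obtain L where L: "n_maximal G i L" "maximal_subgroup (G\<lparr>carrier := L\<rparr>) M" using n by auto
  have sL: "subgroup L G" using n_maximal_subgroup[OF L(1)] by simp
  have "M \<subset> L" using L(2) unfolding maximal_subgroup_carrier_iff[OF sL] by simp
  then have "L = carrier G" using M sL unfolding maximal_subgroup_def by auto
  then have "i = 0" using n_maximal_subgroup[OF L(1)] by auto
  then show ?thesis using Suc by simp
qed

lemma n_maximal_one_if_prime_index:
  assumes "subgroup B G" "subgroup D G" "D \<subseteq> B" "prime p" "card B = p * card D"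
  shows "n_maximal (G\<lparr>carrier := B\<rparr>) 1 D"
  using maximal_if_prime_index[OF assms] by simp

text \<open>If \<open>B\<close> is transitive on the cosets of \<open>E\<close>, the intersection has prime index in \<open>B\<close>. Otherwise \<open>B\<close> is a
  \<open>q\<close>-group modulo the core, where every subgroup of index \<open>q\<^sup>l\<close> is \<open>l\<close>-maximal.\<close>

lemma modularly_embedded_imp_n_maximal_Int:
  assumes E: "modularly_embedded n G E" "1 \<le> n" "maximal_subgroup G E"
    and B: "subgroup B G" "\<not> B \<subseteq> E"
  shows "\<exists>(q :: nat) l. prime q \<and> 1 \<le> l \<and> l \<le> n \<and> n_maximal (G\<lparr>carrier := B\<rparr>) l (E \<inter> B) \<and>
    card (rcosets\<^bsub>G\<lparr>carrier := B\<rparr>\<^esub> (E \<inter> B)) = q ^ l"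
proof -
  interpret B: finite_group "G\<lparr>carrier := B\<rparr>" by (rule finite_group_subgroup[OF B(1)])
  have sE: "subgroup E G" using E unfolding modularly_embedded_def by auto
  have sEB: "subgroup (E \<inter> B) G" using sE B(1) by (rule subgroups_Inter_pair)
  have sEB': "subgroup (E \<inter> B) (G\<lparr>carrier := B\<rparr>)" using sEB by (simp add: subgroup_carrier_iff[OF B(1)])
  have index: "card (rcosets\<^bsub>G\<lparr>carrier := B\<rparr>\<^esub> (E \<inter> B)) = i" if "card B = i * card (E \<inter> B)" for i
    using B.index_eqI[OF sEB'] that by (simp add: order_def)
  have prime_case: ?thesis if "prime r" "card B = r * card (E \<inter> B)" for r
    using index[OF that(2)] n_maximal_one_if_prime_index[OF B(1) sEB _ that] that(1) E(2)
    by (metis Int_lower2 order_refl power_one_right)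
  show ?thesis
  proof (cases "E \<lhd> G")
    case True
    have "maximal_subgroup (G\<lparr>carrier := carrier G\<rparr>) E"
      using E(3) unfolding maximal_subgroup_carrier_iff[OF subgroup_self] maximal_subgroup_iff .
    then obtain r where r: "prime r" "card (carrier G) = r * card E"
      using normal_maximal_prime_index[OF subgroup_self] True normal_iff_normalizing by metis
    note EB = set_mult_normal_subgroup[OF True B(1)]
    have "E <#> B = carrier G"
      using E(3) EB(1-3) B(2) unfolding maximal_subgroup_def by metis
    then have "card E * (r * card (E \<inter> B)) = card E * card B"
      using card_set_mult[OF sE B(1)] r(2) by (simp add: mult_ac)
    then have "card B = r * card (E \<inter> B)" using card_subgroup_pos[OF sE] by simp
    then show ?thesis by (rule prime_case[OF r(1)])
  next
    case False
    obtain p q K where pq: "prime p" "prime q" and K: "K \<lhd> G" "K \<subseteq> E" and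
      alt: "(\<exists>c\<le>n. card B = q ^ c * card (K \<inter> B)) \<or>
        (\<exists>b\<le>n. card B = p * card (E \<inter> B) \<and> card (E \<inter> B) = q ^ b * card (K \<inter> B))"
      by (rule modularly_embedded_dichotomy[OF E(1) False B(1)])
    have KEB: "K \<inter> B \<subseteq> E \<inter> B" using K by auto
    show ?thesis using alt
    proof (elim disjE exE conjE)
      fix c assume c: "c \<le> n" "card B = q ^ c * card (K \<inter> B)"
      have KB: "K \<inter> B \<lhd> (G\<lparr>carrier := B\<rparr>)"
        using normal_Int_subgroup[OF B(1) K(1)] by (simp add: Int_commute)
      have sKB: "subgroup (K \<inter> B) G"
        using subgroups_Inter_pair[OF normal_imp_subgroup[OF K(1)] B(1)] .
      obtain f where f: "card B = f * card (E \<inter> B)"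
        using card_subgroup_dvd[OF B(1) sEB] by (metis Int_lower2 dvdE mult.commute)
      have "f * card (E \<inter> B) = q ^ c * card (K \<inter> B)" using f c by simp
      then obtain j where j: "f = q ^ j" "j \<le> c"
        by (rule prime_power_mult_cancel[OF pq(2) _ card_subgroup_dvd[OF sEB sKB KEB] card_subgroup_pos[OF sKB]])
      have "j \<noteq> 0"
      proof
        assume "j = 0"
        then have "E \<inter> B = B" using f j subgroup_eq_if_card[OF B(1), of "E \<inter> B"] by simp
        then show False using B(2) by auto
      qed
      have "n_maximal (G\<lparr>carrier := B\<rparr>) j (E \<inter> B)"
        using B.n_maximal_if_prime_power_quotient[OF KB pq(2) _ sEB' KEB, of c j] c f j
        by (simp add: order_def)
      then show ?thesis using index[OF f] j \<open>j \<noteq> 0\<close> c(1) pq(2)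
        by (intro exI[of _ q] exI[of _ j]) auto
    next
      fix b assume "card B = p * card (E \<inter> B)"
      then show ?thesis by (rule prime_case[OF pq(1)])
    qed
  qed
qed

end

section \<open>The index of the centralizer of a chief factor\<close>

context finite_group
begin

lemma cent_subgroup_eq:
  assumes A: "subgroup A G" "L \<subseteq> A"
  shows "finite_group.cent (G\<lparr>carrier := A\<rparr>) L K = A \<inter> cent L K"
proof -
  interpret A: finite_group "G\<lparr>carrier := A\<rparr>" by (rule finite_group_subgroup[OF A(1)])
  have inv_A: "inv\<^bsub>G\<lparr>carrier := A\<rparr>\<^esub> x = inv x" if "x \<in> A" for x by (rule m_inv_consistent[OF A(1) that])
  show ?thesis
    unfolding A.cent_def cent_def using A(2) subgroup.subset[OF A(1)] by (auto simp: inv_A subset_iff)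
qed

text \<open>As \<open>|N : J|\<close> is prime, every element of \<open>N - J\<close> generates \<open>N\<close> modulo \<open>J\<close>.\<close>

lemma mem_cent_if_commutes_with_one:
  assumes J: "J \<lhd> G" and N: "N \<lhd> G" and JN: "J \<subseteq> N" and p: "prime p" "card N = p * card J"
    and g: "g \<in> carrier G" and x: "x \<in> N" "x \<notin> J" "g \<otimes> x \<otimes> inv g \<otimes> inv x \<in> J"
  shows "g \<in> cent N J"
proof -
  have sN: "subgroup N G" and sJ: "subgroup J G" using N J normal_imp_subgroup by auto
  let ?F = "{x \<in> carrier G. g \<otimes> x \<otimes> inv g \<otimes> inv x \<in> J}"
  have F: "subgroup (N \<inter> ?F) G" by (rule subgroups_Inter_pair[OF sN subgroup_commuting_mod[OF J g]])
  have JF: "J \<subseteq> N \<inter> ?F"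
  proof
    fix j assume j: "j \<in> J"
    have "g \<otimes> j \<otimes> inv g \<in> J" using J g j unfolding normal_iff by auto
    then have "g \<otimes> j \<otimes> inv g \<otimes> inv j \<in> J" using j sJ by (simp add: subgroup.m_closed subgroup.m_inv_closed)
    then show "j \<in> N \<inter> ?F" using j JN subgroup.mem_carrier[OF sJ j] by auto
  qed
  have "x \<in> N \<inter> ?F" using x subgroup.mem_carrier[OF sN x(1)] by simp
  then have "N \<inter> ?F \<noteq> J" using x(2) by (metis (no_types))
  moreover have "L = J \<or> L = N" if "subgroup L G" "J \<subseteq> L" "L \<subseteq> N" for L
    using maximal_if_prime_index[OF sN sJ JN p] that unfolding maximal_subgroup_carrier_iff[OF sN] by blast
  ultimately have "N \<inter> ?F = N" using F JF Int_lower1 by (metis (no_types))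
  then show ?thesis using g unfolding cent_def by blast
qed

text \<open>
  Let \<open>g\<close> generate \<open>G\<close> modulo \<open>C = C\<^sub>G(N/J)\<close>, and suppose that \<open>C \<noteq> G\<close>. The subgroup \<open>M = J\<langle>g\<rangle>\<close> meets \<open>N\<close> in \<open>J\<close>: an
  element of \<open>\<langle>g\<rangle> \<inter> N\<close> outside \<open>J\<close> would commute with \<open>g\<close> and force \<open>g \<in> C\<close>. Hence \<open>M\<close> is a maximal
  subgroup of \<open>NM\<close> of index \<open>|N : J|\<close> with core \<open>M \<inter> C\<close>, and \<open>|M : M \<inter> C| = |G : C|\<close>.
\<close>

lemma noncentral_factor_witness:
  assumes J: "J \<lhd> G" and N: "N \<lhd> G" and JN: "J \<subseteq> N" and p: "prime p" "card N = p * card J"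
    and noncentral: "cent N J \<noteq> carrier G"
  obtains A M where "subgroup A G" "subgroup M G" "M \<subseteq> A" "N \<subseteq> A" "N \<inter> M = J" "card A = p * card M"
    "\<not> M \<subseteq> cent N J" "core (G\<lparr>carrier := A\<rparr>) M = M \<inter> cent N J"
    "M \<inter> cent N J \<lhd> (G\<lparr>carrier := A\<rparr>)"
    "\<And>m. card M = m * card (M \<inter> cent N J) \<Longrightarrow> order G = m * card (cent N J)"
proof -
  have sN: "subgroup N G" and sJ: "subgroup J G" using N J normal_imp_subgroup by auto
  let ?C = "cent N J"
  have Cn: "?C \<lhd> G" "J \<subseteq> ?C" by (rule cent_normal[OF J N])+
  have sC: "subgroup ?C G" by (rule normal_imp_subgroup[OF Cn(1)])
  obtain g where g: "g \<in> carrier G" "\<And>h. h \<in> carrier G \<Longrightarrow> \<exists>i::nat. h \<otimes> inv (g [^] i) \<in> ?C"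
    by (rule prime_factor_cent_generator[OF J N JN p]) auto
  have decomp: "h \<in> ?C <#> U" if h: "h \<in> carrier G" and U: "subgroup U G" "g \<in> U" for h U
  proof -
    obtain i :: nat where i: "h \<otimes> inv (g [^] i) \<in> ?C" using g(2)[OF h] by auto
    have "g [^] i \<in> U"
    proof (induction i)
      case (Suc i)
      then show ?case using U subgroup.m_closed[OF U(1)] by simp
    qed (use subgroup.one_closed[OF U(1)] in simp)
    moreover have "h = h \<otimes> inv (g [^] i) \<otimes> g [^] i" using h g(1) by (simp add: m_assoc)
    ultimately show ?thesis using i unfolding set_mult_def by blast
  qed
  have gC: "g \<notin> ?C"
  proof
    assume "g \<in> ?C"
    then have "carrier G \<subseteq> ?C <#> ?C" using decomp[OF _ sC] by auto
    then show False
      using noncentral set_mult_normal_subgroup(4)[OF Cn(1) sC sC] subgroup.subset[OF sC] by blast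
  qed
  let ?g = "generate G {g}"
  have sg: "subgroup ?g G" using generate_is_subgroup g(1) by simp
  define M where "M = J <#> ?g"
  have M: "subgroup M G" "J \<subseteq> M" "?g \<subseteq> M"
    unfolding M_def by (rule set_mult_normal_subgroup[OF J sg])+
  have gM: "g \<in> M" using M(3) generate.incl[of g "{g}" G] by auto
  have NM: "N \<inter> M = J"
  proof (rule Set.equalityI; rule subsetI)
    fix y assume y: "y \<in> N \<inter> M"
    then obtain j u where ju: "j \<in> J" "u \<in> ?g" "y = j \<otimes> u" unfolding M_def set_mult_def by auto
    have jc: "j \<in> carrier G" and uc: "u \<in> carrier G"
      using ju subgroup.mem_carrier[OF sJ] subgroup.mem_carrier[OF sg] by auto
    have "u = inv j \<otimes> y" using ju(3) jc uc by (simp add: m_assoc[symmetric])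
    then have uN: "u \<in> N" using y ju(1) JN sN by (auto simp: subgroup.m_closed subgroup.m_inv_closed)
    obtain k :: int where k: "u = g [^] k" using ju(2) generate_pow[OF g(1)] by auto
    have "g \<otimes> u = g [^] (1 + k)" unfolding k using int_pow_mult[OF g(1), of 1 k] g(1) by simp
    also have "\<dots> = g [^] (k + 1)" by (simp add: add.commute)
    also have "\<dots> = u \<otimes> g" unfolding k using int_pow_mult[OF g(1), of k 1] g(1) by simp
    finally have "g \<otimes> u \<otimes> inv g \<otimes> inv u = \<one>" using g(1) uc by (simp add: m_assoc)
    then have "g \<otimes> u \<otimes> inv g \<otimes> inv u \<in> J" using subgroup.one_closed[OF sJ] by simp
    then have "u \<in> J" using mem_cent_if_commutes_with_one[OF J N JN p g(1) uN] gC by blast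
    then show "y \<in> J" using ju subgroup.m_closed[OF sJ] by simp
  qed (use JN M(2) in auto)
  define A where "A = N <#> M"
  have A: "subgroup A G" "N \<subseteq> A" "M \<subseteq> A"
    unfolding A_def by (rule set_mult_normal_subgroup[OF N M(1)])+
  have "card A * card J = card N * card M" using card_set_mult[OF sN M(1)] unfolding NM A_def .
  then have "card A * card J = (p * card M) * card J" unfolding p(2) by (simp only: mult_ac)
  then have cA: "card A = p * card M"
    using card_subgroup_pos[OF sJ] by (metis less_not_refl mult_right_cancel)
  interpret A: finite_group "G\<lparr>carrier := A\<rparr>" by (rule finite_group_subgroup[OF A(1)])
  have sMA: "subgroup M (G\<lparr>carrier := A\<rparr>)" using M A by (simp add: subgroup_carrier_iff[OF A(1)])
  have JA: "J \<lhd> (G\<lparr>carrier := A\<rparr>)" and NA: "N \<lhd> (G\<lparr>carrier := A\<rparr>)"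
    using normal_in_subgroup[OF J A(1)] normal_in_subgroup[OF N A(1) A(2)] JN A(2) by auto
  have "core (G\<lparr>carrier := A\<rparr>) M = M \<inter> A.cent N J"
    by (rule A.core_eq_Int_cent[OF JA NA sMA _ NM]) (simp add: A_def)
  then have core: "core (G\<lparr>carrier := A\<rparr>) M = M \<inter> ?C"
    unfolding cent_subgroup_eq[OF A(1,2)] using A(3) by auto
  have normal: "M \<inter> ?C \<lhd> (G\<lparr>carrier := A\<rparr>)" using A.core_normal(1)[OF sMA] unfolding core .
  have CM: "?C <#> M = carrier G"
    using decomp[OF _ M(1) gM] set_mult_normal_subgroup(1)[OF Cn(1) M(1)] subgroup.subset by blast
  have "order G = m * card ?C" if m: "card M = m * card (M \<inter> ?C)" for m
  proof -
    have "order G * card (M \<inter> ?C) = card ?C * card M"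
      using card_set_mult[OF sC M(1)] unfolding CM order_def by (simp add: Int_commute)
    then have "order G * card (M \<inter> ?C) = (m * card ?C) * card (M \<inter> ?C)" unfolding m by (simp only: mult_ac)
    then show ?thesis
      using card_subgroup_pos[OF subgroups_Inter_pair[OF M(1) sC]] by (metis less_not_refl mult_right_cancel)
  qed
  moreover have "\<not> M \<subseteq> ?C" using gM gC by auto
  ultimately show thesis using that[OF A(1) M(1) A(3,2) NM cA _ core normal] by blast
qed

lemma cent_index_if_modularly_embedded:
  assumes emb: "\<And>A M. subgroup A G \<Longrightarrow> maximal_subgroup (G\<lparr>carrier := A\<rparr>) M \<Longrightarrow>
      \<exists>n. 1 \<le> n \<and> n \<le> k \<and> modularly_embedded n (G\<lparr>carrier := A\<rparr>) M"
    and J: "J \<lhd> G" and N: "N \<lhd> G" and JN: "J \<subseteq> N" and p: "prime p" "card N = p * card J"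
    and noncentral: "cent N J \<noteq> carrier G"
  shows "\<exists>(q :: nat) n. prime q \<and> 1 \<le> n \<and> n \<le> k \<and> order G = q ^ n * card (cent N J)"
proof -
  obtain A M where A: "subgroup A G" and M: "subgroup M G" "M \<subseteq> A" and card: "card A = p * card M"
    and nC: "\<not> M \<subseteq> cent N J" and core: "core (G\<lparr>carrier := A\<rparr>) M = M \<inter> cent N J"
    and index: "\<And>m. card M = m * card (M \<inter> cent N J) \<Longrightarrow> order G = m * card (cent N J)"
    by (rule noncentral_factor_witness[OF J N JN p noncentral]) blast
  interpret A: finite_group "G\<lparr>carrier := A\<rparr>" by (rule finite_group_subgroup[OF A])
  have sMA: "subgroup M (G\<lparr>carrier := A\<rparr>)" using M by (simp add: subgroup_carrier_iff[OF A])
  obtain n where n: "1 \<le> n" "n \<le> k" "modularly_embedded n (G\<lparr>carrier := A\<rparr>) M"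
    using emb[OF A maximal_if_prime_index[OF A M p(1) card]] by blast
  have "\<not> M \<lhd> (G\<lparr>carrier := A\<rparr>)"
    using A.normal_subset_core[OF sMA _ order_refl] core nC by blast
  then obtain r q where rq: "prime r" "prime q" "card A = r * card M"
      "card A = r * q ^ n * card (M \<inter> cent N J)"
    by (rule A.modularly_embeddedD[OF n(3), unfolded core order_def partial_object.simps partial_object.update_convs])
      simp
  have "r * card M = r * (q ^ n * card (M \<inter> cent N J))" using rq(3,4) by (metis mult.assoc)
  then have "card M = q ^ n * card (M \<inter> cent N J)" using prime_gt_0_nat[OF rq(1)] by (metis less_not_refl mult_left_cancel)
  then show ?thesis using index rq(2) n(1,2) by blast
qed

text \<open>
  In the situation of \<open>noncentral_factor_witness\<close>, \<open>M\<close> and its conjugate by an element \<open>x\<close>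
  of \<open>N - J\<close> intersect in \<open>M \<inter> C\<close>: if \<open>m\<close> and its conjugate by \<open>x\<close> both lie in \<open>M\<close>, then their quotient lies in
  \<open>M \<inter> N = J\<close>, so \<open>m\<close> centralizes \<open>N/J\<close>. The LM-condition for these two subgroups
  therefore determines \<open>|M : M \<inter> C| = |G : C|\<close>.
\<close>

lemma cent_index_if_LM_group:
  assumes LM: "LM_group k G"
    and J: "J \<lhd> G" and N: "N \<lhd> G" and JN: "J \<subseteq> N" and p: "prime p" "card N = p * card J"
    and noncentral: "cent N J \<noteq> carrier G"
  shows "\<exists>(q :: nat) n. prime q \<and> 1 \<le> n \<and> n \<le> k \<and> order G = q ^ n * card (cent N J)"
proof -
  let ?C = "cent N J"
  have sN: "subgroup N G" and sJ: "subgroup J G" using N J normal_imp_subgroup by auto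
  have Cn: "?C \<lhd> G" by (rule cent_normal[OF J N])
  obtain A M where A: "subgroup A G" "N \<subseteq> A" and M: "subgroup M G" "M \<subseteq> A" and NM: "N \<inter> M = J"
    and card: "card A = p * card M" and nC: "\<not> M \<subseteq> ?C" and normal: "M \<inter> ?C \<lhd> (G\<lparr>carrier := A\<rparr>)"
    and index: "\<And>m. card M = m * card (M \<inter> ?C) \<Longrightarrow> order G = m * card ?C"
    by (rule noncentral_factor_witness[OF J N JN p noncentral]) blast
  have "J \<noteq> N" using p prime_gt_1_nat[OF p(1)] card_subgroup_pos[OF sJ] by auto
  then obtain x where x: "x \<in> N" "x \<notin> J" using JN by auto
  have xc: "x \<in> carrier G" and xA: "x \<in> A" using x subgroup.mem_carrier[OF sN] A(2) by auto
  define B where "B = (\<lambda>s. x \<otimes> s \<otimes> inv x) ` M"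
  have B: "subgroup B G" "card B = card M" using subgroup_conj[OF xc M(1)] unfolding B_def by auto
  have BA: "B \<subseteq> A"
  proof
    fix y assume "y \<in> B"
    then obtain m where "m \<in> M" "y = x \<otimes> m \<otimes> inv x" unfolding B_def by auto
    then show "y \<in> A" using M(2) xA subgroup.m_closed[OF A(1)] subgroup.m_inv_closed[OF A(1)] by blast
  qed
  have MB: "M \<inter> B = M \<inter> ?C"
  proof (rule Set.equalityI; rule subsetI)
    fix y assume y: "y \<in> M \<inter> B"
    then obtain m where m: "m \<in> M" "y = x \<otimes> m \<otimes> inv x" unfolding B_def by auto
    have mc: "m \<in> carrier G" using subgroup.mem_carrier[OF M(1) m(1)] .
    have "x \<otimes> m \<otimes> inv x \<otimes> inv m \<in> M"
      using y m M(1) by (auto simp: subgroup.m_closed subgroup.m_inv_closed)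
    moreover have "m \<otimes> inv x \<otimes> inv m \<in> N"
      using N x(1) mc sN unfolding normal_iff by (auto simp: subgroup.m_inv_closed)
    then have "x \<otimes> (m \<otimes> inv x \<otimes> inv m) \<in> N" using x(1) subgroup.m_closed[OF sN] by blast
    then have "x \<otimes> m \<otimes> inv x \<otimes> inv m \<in> N" using xc mc by (simp add: m_assoc)
    ultimately have "m \<otimes> x \<otimes> inv m \<otimes> inv x \<in> J" using NM commutator_mem_swap[OF sJ mc xc] by blast
    then have "m \<in> ?C" by (rule mem_cent_if_commutes_with_one[OF J N JN p mc x])
    then have "y \<in> ?C" unfolding m(2) using Cn xc unfolding normal_iff by auto
    then show "y \<in> M \<inter> ?C" using y by auto
  next
    fix d assume d: "d \<in> M \<inter> ?C"
    have dc: "d \<in> carrier G" using d subgroup.mem_carrier[OF M(1)] by auto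
    have "inv x \<in> A" using subgroup.m_inv_closed[OF A(1) xA] .
    then have "inv x \<otimes> d \<otimes> inv (inv x) \<in> M \<inter> ?C" using normal d unfolding normal_carrier_iff[OF A(1)] by blast
    then have "inv x \<otimes> d \<otimes> x \<in> M" using xc by simp
    moreover have "d = x \<otimes> (inv x \<otimes> d \<otimes> x) \<otimes> inv x" using conj_inv_cancel(2)[OF xc dc] by simp
    ultimately show "d \<in> M \<inter> B" using d unfolding B_def by blast
  qed
  have max: "maximal_subgroup (G\<lparr>carrier := A\<rparr>) M" by (rule maximal_if_prime_index[OF A(1) M p(1) card])
  have "\<not> B \<subseteq> M"
  proof
    assume "B \<subseteq> M"
    then have "B = M" using subgroup_eq_if_card[OF M(1)] B(2) by simp
    then show False using MB nC by blast
  qed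
  have c: "M \<union> B \<subseteq> carrier G" using subgroup.subset[OF M(1)] subgroup.subset[OF B(1)] by auto
  have "generate G (M \<union> B) = A"
  proof -
    have "subgroup (generate G (M \<union> B)) G" by (rule generate_is_subgroup[OF c])
    moreover have "M \<union> B \<subseteq> generate G (M \<union> B)" by (auto intro: generate.incl)
    moreover have "generate G (M \<union> B) \<subseteq> A" using generate_subgroup_incl[OF _ A(1)] M(2) BA by simp
    ultimately show ?thesis
      using max \<open>\<not> B \<subseteq> M\<close> unfolding maximal_subgroup_carrier_iff[OF A(1)] by (metis Un_subset_iff)
  qed
  then obtain q n where qn: "prime (q :: nat)" "1 \<le> n" "n \<le> k"
      "card (rcosets\<^bsub>G\<lparr>carrier := B\<rparr>\<^esub> (M \<inter> B)) = q ^ n"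
    using LM M(1) B(1) max unfolding LM_group_def by metis
  have "subgroup (M \<inter> B) G" using M(1) B(1) by (rule subgroups_Inter_pair)
  then have "card M = q ^ n * card (M \<inter> ?C)"
    using index_mult_carrier[OF B(1) _ Int_lower2] qn(4) B(2) MB by metis
  then show ?thesis using index qn(1-3) by blast
qed

text \<open>The LM-condition for \<open>M\<close> and \<open>A\<close> itself: as \<open>M = M \<inter> A\<close> is maximal in \<open>A\<close>, it is \<open>n\<close>-maximal only for \<open>n = 1\<close>.\<close>

lemma LM_group_imp_maximal_prime_indices:
  assumes LM: "LM_group k G"
  shows "maximal_prime_indices G"
  unfolding maximal_prime_indices_def
proof (intro allI impI)
  fix A M assume A: "subgroup A G" and M: "maximal_subgroup (G\<lparr>carrier := A\<rparr>) M"
  have M': "subgroup M G" "M \<subseteq> A" using M unfolding maximal_subgroup_carrier_iff[OF A] by auto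
  interpret A: finite_group "G\<lparr>carrier := A\<rparr>" by (rule finite_group_subgroup[OF A])
  have "generate G (M \<union> A) = A"
    using M'(2) generate_subgroup_incl[OF _ A, of A] generate.incl[of _ A G]
    by (metis Un_absorb1 order_refl subset_antisym subsetI)
  moreover have "M \<inter> A = M" using M'(2) by auto
  ultimately obtain q n where qn: "prime (q :: nat)" "n_maximal (G\<lparr>carrier := A\<rparr>) n M"
      "card (rcosets\<^bsub>G\<lparr>carrier := A\<rparr>\<^esub> M) = q ^ n"
    using LM A M M'(1) unfolding LM_group_def by metis
  then have "n = 1" using A.n_maximal_maximal_eq_one[OF M] by simp
  then have "card A = q * card M" using index_mult_carrier[OF A M'] qn(3) by simp
  then show "\<exists>r. prime r \<and> card A = r * card M" using qn(1) by blast
qed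

end

section \<open>Normal series and supersoluble groups\<close>

inductive normal_series ::
  "('a, 'b) monoid_scheme \<Rightarrow> ('a set \<Rightarrow> 'a set \<Rightarrow> bool) \<Rightarrow> 'a set \<Rightarrow> bool" for G R where
  trivial: "normal_series G R {\<one>\<^bsub>G\<^esub>}"
| step: "\<lbrakk>normal_series G R K; L \<lhd> G; K \<subseteq> L; R K L\<rbrakk> \<Longrightarrow> normal_series G R L"

lemma (in group) normal_series_normal: "normal_series G R L \<Longrightarrow> L \<lhd> G"
  by (induction rule: normal_series.induct) (auto intro: one_is_normal)

lemma (in group) supersoluble_iff_normal_series:
  "supersoluble G \<longleftrightarrow> normal_series G (\<lambda>K L. cyclic_group (G\<lparr>carrier := L\<rparr> Mod K)) (carrier G)"
  (is "_ \<longleftrightarrow> normal_series G ?R _")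
proof
  assume "supersoluble G"
  then obtain N m where N: "N 0 = {\<one>}" "N m = carrier G" "\<And>i. i \<le> m \<Longrightarrow> N i \<lhd> G"
    "\<And>i. i < m \<Longrightarrow> N i \<subseteq> N (Suc i) \<and> ?R (N i) (N (Suc i))"
    unfolding supersoluble_def by blast
  have "normal_series G ?R (N i)" if "i \<le> m" for i using that
  proof (induction i)
    case (Suc i)
    then show ?case using N(3)[of "Suc i"] N(4)[of i] by (auto intro: normal_series.step)
  qed (simp add: N(1) normal_series.trivial)
  then show "normal_series G ?R (carrier G)" using N(2) by (metis order_refl)
next
  have "\<exists>(N :: nat \<Rightarrow> 'a set) m. N 0 = {\<one>} \<and> N m = L \<and> (\<forall>i\<le>m. N i \<lhd> G) \<and>
      (\<forall>i<m. N i \<subseteq> N (Suc i) \<and> ?R (N i) (N (Suc i)))" if "normal_series G ?R L" for L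
    using that
  proof induction
    case trivial
    show ?case by (rule exI[of _ "\<lambda>_. {\<one>}"], rule exI[of _ 0]) (simp add: one_is_normal)
  next
    case (step K L)
    then obtain N m where N: "N 0 = {\<one>}" "N m = K" "\<forall>i\<le>m. N i \<lhd> G"
      "\<forall>i<m. N i \<subseteq> N (Suc i) \<and> ?R (N i) (N (Suc i))" by blast
    show ?case
      by (rule exI[of _ "\<lambda>i. if i \<le> m then N i else L"], rule exI[of _ "Suc m"])
        (use N step.hyps in \<open>auto simp: less_Suc_eq le_Suc_eq\<close>)
  qed
  then show "normal_series G ?R (carrier G) \<Longrightarrow> supersoluble G" unfolding supersoluble_def by blast
qed

context finite_group
begin

lemma factor_centralizer_eq_cent:
  assumes K: "K \<lhd> G" and L: "L \<lhd> G"
  shows "factor_centralizer G L K = cent L K"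
proof -
  have sK: "subgroup K G" and sL: "subgroup L G" using K L normal_imp_subgroup by auto
  have "(\<forall>S\<in>carrier (G\<lparr>carrier := L\<rparr> Mod K). (g <# S) #> inv g = S) \<longleftrightarrow>
      (\<forall>x\<in>L. g \<otimes> x \<otimes> inv g \<otimes> inv x \<in> K)" if g: "g \<in> carrier G" for g
  proof -
    have "(g <# S) #> inv g = (\<lambda>y. g \<otimes> y \<otimes> inv g) ` S" for S
      unfolding l_coset_def r_coset_def by blast
    then have "(g <# (K #> x)) #> inv g = K #> x \<longleftrightarrow> g \<otimes> x \<otimes> inv g \<otimes> inv x \<in> K" if "x \<in> L" for x
      using conj_rcoset_normal[OF K g] rcoset_conj_eq_iff[OF sK g] subgroup.mem_carrier[OF sL that] by simp
    then show ?thesis by (simp add: carrier_FactGroup)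
  qed
  then show ?thesis unfolding factor_centralizer_def cent_def by auto
qed

lemma cyclic_Mod_if_prime_index:
  assumes K: "K \<lhd> G" and p: "prime p" "order G = p * card K"
  shows "cyclic_group (G Mod K)"
proof -
  interpret K: normal K G by (rule K)
  interpret Q: group "G Mod K" by (rule K.factorgroup_is_group)
  have oQ: "order (G Mod K) = p" unfolding order_Mod by (rule index_eqI[OF K.subgroup_axioms p(2)])
  have fin: "finite (carrier (G Mod K))" by (simp add: carrier_FactGroup)
  have "carrier (G Mod K) \<noteq> {\<one>\<^bsub>G Mod K\<^esub>}" using oQ p(1) unfolding order_def by auto
  then obtain a where a: "a \<in> carrier (G Mod K)" "a \<noteq> \<one>\<^bsub>G Mod K\<^esub>" using Q.one_closed by blast
  have "generate (G Mod K) {a} = carrier (G Mod K)" by (rule Q.prime_order_generator(2)[OF fin p(1) oQ a])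
  then show ?thesis unfolding Q.cyclic_group using Q.generate_pow[OF a(1)] a(1)
    by (auto simp: full_SetCompr_eq)
qed

lemma supersoluble_if_chief_factors_prime:
  assumes prime: "\<And>N J. chief_factor G N J \<Longrightarrow> \<exists>p. prime p \<and> card N = p * card J"
  shows "supersoluble G"
proof -
  let ?R = "\<lambda>K L. cyclic_group (G\<lparr>carrier := L\<rparr> Mod K)"
  have "normal_series G ?R L" if "L \<lhd> G" for L using that
  proof (induction "card L" arbitrary: L rule: less_induct)
    case less
    have sL: "subgroup L G" by (rule normal_imp_subgroup[OF less.prems])
    show ?case
    proof (cases "L = {\<one>}")
      case True
      then show ?thesis by (simp add: normal_series.trivial)
    next
      case False
      let ?S = "{J. J \<lhd> G \<and> J \<subset> L}"
      have "{\<one>} \<in> ?S" using one_is_normal False subgroup.one_closed[OF sL] by auto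
      then have "?S \<noteq> {}" by (simp only: ex_in_conv[symmetric]) (rule exI)
      moreover have "?S \<subseteq> Pow L" by auto
      then have "finite ?S" by (rule finite_subset) (simp add: sL)
      ultimately have "\<exists>J\<in>?S. \<forall>V\<in>?S. J \<subseteq> V \<longrightarrow> J = V" by (intro finite_has_maximal)
      then obtain J where J: "J \<in> ?S" "\<forall>V\<in>?S. J \<subseteq> V \<longrightarrow> J = V" by (elim bexE)
      have "V = J \<or> V = L" if "V \<lhd> G" "J \<subseteq> V" "V \<subseteq> L" for V
      proof (cases "V = L")
        case False
        then have "V \<in> ?S" using that by auto
        then show ?thesis using J(2) that(2) by auto
      qed simp
      then have "chief_factor G L J" unfolding chief_factor_def using less.prems J(1) by auto
      then obtain p where p: "prime p" "card L = p * card J" using prime by blast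
      have J': "J \<lhd> G" "J \<subset> L" using J(1) by auto
      interpret L: finite_group "G\<lparr>carrier := L\<rparr>" by (rule finite_group_subgroup[OF sL])
      have "cyclic_group (G\<lparr>carrier := L\<rparr> Mod J)"
        using L.cyclic_Mod_if_prime_index[OF normal_in_subgroup[OF J'(1) sL] p(1)] p(2) J'(2)
        by (simp add: order_def)
      moreover have "normal_series G ?R J"
        using less.hyps[of J] J' psubset_card_mono[OF _ J'(2)] sL by simp
      ultimately show ?thesis using normal_series.step[of G ?R J L] less.prems J'(2) by auto
    qed
  qed
  then show ?thesis unfolding supersoluble_iff_normal_series using normal_self by blast
qed

lemma cyclic_factor_centralizer:
  assumes J: "J \<lhd> G" and N: "N \<lhd> G" and JN: "J \<subseteq> N" and p: "prime p" "card N = p * card J"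
  shows "cyclic_group (G Mod cent N J)"
proof -
  let ?C = "cent N J"
  interpret C: normal ?C G by (rule cent_normal[OF J N])
  interpret Q: group "G Mod ?C" by (rule C.factorgroup_is_group)
  obtain g where g: "g \<in> carrier G" "\<And>h. h \<in> carrier G \<Longrightarrow> \<exists>i::nat. h \<otimes> inv (g [^] i) \<in> ?C"
    by (rule prime_factor_cent_generator[OF J N JN p]) auto
  have gQ: "?C #> g \<in> carrier (G Mod ?C)" using g(1) by (simp add: carrier_FactGroup)
  have "\<exists>i::int. R = (?C #> g) [^]\<^bsub>G Mod ?C\<^esub> i" if R: "R \<in> carrier (G Mod ?C)" for R
  proof -
    obtain h where h: "h \<in> carrier G" "R = ?C #> h" using R by (auto simp: carrier_FactGroup)
    obtain i :: nat where "h \<otimes> inv (g [^] i) \<in> ?C" using g(2)[OF h(1)] by auto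
    then have "h \<in> ?C #> g [^] i" using C.rcos_module[OF is_group _ h(1), of "g [^] i"] g(1) by simp
    then have "?C #> h = ?C #> g [^] i" using repr_independence[OF _ _ C.subgroup_axioms] g(1) by simp
    also have "\<dots> = (?C #> g) [^]\<^bsub>G Mod ?C\<^esub> int i"
      using C.FactGroup_int_pow[OF g(1), of "int i"] by (simp add: int_pow_int)
    finally show ?thesis using h(2) by blast
  qed
  then show ?thesis unfolding Q.cyclic_group using gQ Q.int_pow_closed[OF gQ] by blast
qed

text \<open>
  A normal series with good factors is the form of the condition on chief factors that passes to
  subgroups. The exponent \<open>n = 0\<close> stands for a central factor.
\<close>

definition good_factor :: "nat \<Rightarrow> 'a set \<Rightarrow> 'a set \<Rightarrow> bool" where
  "good_factor k K L \<longleftrightarrow> (\<exists>p q n. prime p \<and> prime q \<and> n \<le> k \<and> card L = p * card K \<and>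
     order G = q ^ n * card (cent L K))"

lemma normal_series_good_Int:
  assumes ser: "normal_series G (good_factor k) L" and A: "subgroup A G"
  shows "normal_series (G\<lparr>carrier := A\<rparr>) (finite_group.good_factor (G\<lparr>carrier := A\<rparr>) k) (L \<inter> A)"
  using ser
proof induction
  case trivial
  have "{\<one>} \<inter> A = {\<one>\<^bsub>G\<lparr>carrier := A\<rparr>\<^esub>}" using subgroup.one_closed[OF A] by auto
  then show ?case by (simp only: normal_series.trivial)
next
  case (step K L)
  interpret A: finite_group "G\<lparr>carrier := A\<rparr>" by (rule finite_group_subgroup[OF A])
  have K: "K \<lhd> G" and L: "L \<lhd> G" using normal_series_normal step.hyps by auto
  have sK: "subgroup K G" and sL: "subgroup L G" using K L normal_imp_subgroup by auto
  obtain p q n where pq: "prime p" "prime q" "n \<le> k" "card L = p * card K" "order G = q ^ n * card (cent L K)"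
    using step.hyps(4) unfolding good_factor_def by blast
  have nLA: "L \<inter> A \<lhd> (G\<lparr>carrier := A\<rparr>)" and nKA: "K \<inter> A \<lhd> (G\<lparr>carrier := A\<rparr>)"
    using normal_Int_subgroup[OF A L] normal_Int_subgroup[OF A K] by (simp_all add: Int_commute)
  have sLA: "subgroup (L \<inter> A) G" using sL A by (rule subgroups_Inter_pair)
  show ?case
  proof (cases "K \<inter> A = L \<inter> A")
    case True
    then show ?thesis using step.IH by simp
  next
    case False
    have eq: "K \<inter> (L \<inter> A) = K \<inter> A" using step.hyps(3) by auto
    obtain a where a: "card (L \<inter> A) = a * card (K \<inter> A)" "a dvd p"
      by (rule relative_order[OF K sLA sL step.hyps(3) _ pq(4)]) (auto simp: eq)
    have "a \<noteq> 1"
    proof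
      assume "a = 1"
      then have "K \<inter> A = L \<inter> A" using a(1) step.hyps(3) by (intro subgroup_eq_if_card[OF sLA]) auto
      then show False using False by simp
    qed
    then have ap: "a = p" using a(2) pq(1) by (metis prime_nat_iff)
    let ?C = "cent L K" and ?D = "A.cent (L \<inter> A) (K \<inter> A)"
    have C: "?C \<lhd> G" "subgroup ?C G" using cent_normal[OF K L] normal_imp_subgroup by auto
    have sD: "subgroup ?D G" "?D \<subseteq> A"
      using normal_imp_subgroup[OF A.cent_normal(1)[OF nKA nLA]] unfolding subgroup_carrier_iff[OF A] by auto
    have sCA: "subgroup (?C \<inter> A) G" using C(2) A by (rule subgroups_Inter_pair)
    have CD: "?C \<inter> A \<subseteq> ?D"
    proof
      fix g assume g: "g \<in> ?C \<inter> A"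
      have "g \<otimes> x \<otimes> inv g \<otimes> inv x \<in> K \<inter> A" if "x \<in> L \<inter> A" for x
        using g that subgroup.m_closed[OF A] subgroup.m_inv_closed[OF A] unfolding cent_def by auto
      then show "g \<in> ?D" using g subgroup.mem_carrier[OF A] cent_subgroup_eq[OF A, of "L \<inter> A" "K \<inter> A"]
        unfolding cent_def by auto
    qed
    have "card (carrier G) = q ^ n * card ?C" using pq(5) by (simp add: order_def)
    then obtain b where b: "card A = b * card (?C \<inter> A)" "b dvd q ^ n"
      by (rule relative_order[OF C(1) A subgroup_self subgroup.subset[OF C(2)] subgroup.subset[OF A]])
    then obtain j where j: "b = q ^ j" "j \<le> n" using divides_primepow_nat[OF pq(2)] by auto
    obtain f where f: "card A = f * card ?D" using card_subgroup_dvd[OF A sD] by (metis dvdE mult.commute)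
    have "f * card ?D = q ^ j * card (?C \<inter> A)" using f b j by simp
    then obtain l where l: "f = q ^ l" "l \<le> j"
      by (rule prime_power_mult_cancel[OF pq(2) _ card_subgroup_dvd[OF sD(1) sCA CD] card_subgroup_pos[OF sCA]])
    have "A.good_factor k (K \<inter> A) (L \<inter> A)"
      unfolding A.good_factor_def
      by (rule exI[of _ p], rule exI[of _ q], rule exI[of _ l])
        (use pq(1-3) a ap f l j in \<open>simp add: order_def\<close>)
    then show ?thesis using step.IH nLA step.hyps(3) by (auto intro: normal_series.step)
  qed
qed

text \<open>
  Let \<open>L/K\<close> be the first factor of the series with \<open>L\<close> not contained in the maximal subgroup \<open>M\<close>. Then \<open>M\<close> is a
  complement of \<open>L/K\<close> modulo \<open>K\<close>, and \<open>M \<inter> C\<^sub>G(L/K)\<close> is normal, of index dividing \<open>|G : C\<^sub>G(L/K)|\<close> in \<open>M\<close>.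
\<close>

lemma maximal_modularly_embedded_if_good_series:
  assumes ser: "normal_series G (good_factor k) (carrier G)" and k: "1 \<le> k" and M: "maximal_subgroup G M"
  shows "\<exists>n. 1 \<le> n \<and> n \<le> k \<and> modularly_embedded n G M"
proof -
  have sM: "subgroup M G" "M \<noteq> carrier G" using M unfolding maximal_subgroup_def by auto
  have first: "\<exists>K L. K \<lhd> G \<and> L \<lhd> G \<and> K \<subseteq> L \<and> good_factor k K L \<and> K \<subseteq> M \<and> \<not> L \<subseteq> M"
    if "normal_series G (good_factor k) L" "\<not> L \<subseteq> M" for L
    using that
  proof induction
    case trivial
    then show ?case using subgroup.one_closed[OF sM(1)] by simp
  next
    case (step K L)
    show ?case
    proof (cases "K \<subseteq> M")
      case True
      have "K \<lhd> G" by (rule normal_series_normal[OF step.hyps(1)])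
      then have "K \<lhd> G \<and> L \<lhd> G \<and> K \<subseteq> L \<and> good_factor k K L \<and> K \<subseteq> M \<and> \<not> L \<subseteq> M"
        using step.hyps(2-4) step.prems True by (intro conjI)
      then show ?thesis by (intro exI)
    next
      case False
      then show ?thesis by (rule step.IH)
    qed
  qed
  have "\<not> carrier G \<subseteq> M" using sM(2) subgroup.subset[OF sM(1)] by blast
  from first[OF ser this] obtain K L where K: "K \<lhd> G" and L: "L \<lhd> G" and KL: "K \<subseteq> L" and good: "good_factor k K L"
    and KM: "K \<subseteq> M" and LM: "\<not> L \<subseteq> M" by (elim exE conjE)
  obtain p q n where pq: "prime p" "prime q" "n \<le> k" "card L = p * card K" "order G = q ^ n * card (cent L K)"
    using good unfolding good_factor_def by blast
  have sK: "subgroup K G" and sL: "subgroup L G" using K L normal_imp_subgroup by auto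
  have LM_G: "L <#> M = carrier G"
    using M set_mult_normal_subgroup[OF L sM(1)] LM unfolding maximal_subgroup_def by metis
  have sLM: "subgroup (L \<inter> M) G" using sL sM(1) by (rule subgroups_Inter_pair)
  have LMK: "L \<inter> M = K"
    using maximal_if_prime_index[OF sL sK KL pq(1,4)] sLM KL KM LM
    unfolding maximal_subgroup_carrier_iff[OF sL] by (metis Int_lower1 Int_lower2 le_inf_iff)
  have "order G * card K = card L * card M"
    using card_set_mult[OF sL sM(1)] unfolding LM_G LMK order_def .
  then have "order G * card K = (p * card M) * card K" unfolding pq(4) by (simp only: mult_ac)
  then have oG: "order G = p * card M" using card_subgroup_pos[OF sK] by (metis less_not_refl mult_right_cancel)
  let ?C = "cent L K"
  have C: "?C \<lhd> G" "subgroup ?C G" using cent_normal[OF K L] normal_imp_subgroup by auto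
  have core: "core G M = M \<inter> ?C" by (rule core_eq_Int_cent[OF K L sM(1) LM_G LMK])
  have "card (carrier G) = q ^ n * card ?C" using pq(5) by (simp add: order_def)
  then obtain b where b: "card M = b * card (?C \<inter> M)" "b dvd q ^ n"
    by (rule relative_order[OF C(1) sM(1) subgroup_self subgroup.subset[OF C(2)] subgroup.subset[OF sM(1)]])
  then obtain j where j: "b = q ^ j" "j \<le> n" using divides_primepow_nat[OF pq(2)] by auto
  have "card M = q ^ j * card (core G M)" using b j unfolding core by (simp add: Int_commute)
  then show ?thesis
    using modularly_embedded_if_prime_power_index[OF sM(1) core_normal[OF sM(1)] pq(1,2) oG _ _ k] j(2) pq(3)
    by (meson le_trans)
qed

text \<open>If conjugation maps each element of \<open>L\<close> to one of its powers modulo \<open>K\<close>, then all subgroups between \<open>K\<close> and \<open>L\<close> are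
  normal in \<open>G\<close>, so that \<open>L/K\<close> has a series with normal terms and factors of prime order.\<close>

lemma refine_to_prime_factors:
  assumes K: "normal_series G R K"
    and R: "\<And>U L p. U \<lhd> G \<Longrightarrow> L \<lhd> G \<Longrightarrow> U \<subseteq> L \<Longrightarrow> prime p \<Longrightarrow> card L = p * card U \<Longrightarrow> R U L"
    and L: "subgroup L G" "K \<subseteq> L"
    and pow: "\<And>g x. g \<in> carrier G \<Longrightarrow> x \<in> L \<Longrightarrow> \<exists>a::int. g \<otimes> x \<otimes> inv g \<in> K #> x [^] a"
  shows "normal_series G R L"
  using L pow
proof (induction "card L" arbitrary: L rule: less_induct)
  case less
  have normal: "U \<lhd> G" if U: "subgroup U G" "K \<subseteq> U" "U \<subseteq> L" for U
    unfolding normal_iff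
  proof (intro conjI ballI)
    fix g x assume g: "g \<in> carrier G" and x: "x \<in> U"
    obtain a :: int where "g \<otimes> x \<otimes> inv g \<in> K #> x [^] a" using less.prems(3) g x U(3) by blast
    then obtain k where "k \<in> K" "g \<otimes> x \<otimes> inv g = k \<otimes> x [^] a" unfolding r_coset_def by auto
    then show "g \<otimes> x \<otimes> inv g \<in> U"
      using U(2) x subgroup.m_closed[OF U(1)] subgroup_int_pow_closed[OF U(1) x] by auto
  qed (rule U(1))
  have nK: "K \<lhd> G" by (rule normal_series_normal[OF K])
  have nL: "L \<lhd> G" by (rule normal[OF less.prems(1,2) order_refl])
  show ?case
  proof (cases "K = L")
    case False
    obtain U where U: "maximal_subgroup (G\<lparr>carrier := L\<rparr>) U" "K \<subseteq> U"
      by (rule exists_maximal_subgroup_of[OF less.prems(1) normal_imp_subgroup[OF nK] less.prems(2) False])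
    have U': "subgroup U G" "U \<subset> L" using U(1) unfolding maximal_subgroup_carrier_iff[OF less.prems(1)] by auto
    have nU: "U \<lhd> G" using normal[OF U'(1) U(2)] U'(2) by simp
    then have "L \<subseteq> normalizing U" using subgroup.subset[OF less.prems(1)] by (auto simp: normal_iff_normalizing)
    then obtain p where p: "prime p" "card L = p * card U"
      by (rule normal_maximal_prime_index[OF less.prems(1) U(1)])
    have "normal_series G R U"
      using less.hyps[of U] U' U(2) less.prems(1,3) psubset_card_mono[OF _ U'(2)] by auto
    then show ?thesis using nL U'(2) R[OF nU nL _ p] by (auto intro: normal_series.step)
  qed (use K in simp)
qed

lemma conj_int_pow:
  assumes "g \<in> carrier G" "x \<in> carrier G"
  shows "g \<otimes> x [^] (i::int) \<otimes> inv g = (g \<otimes> x \<otimes> inv g) [^] i"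
proof -
  have h: "(\<lambda>s. g \<otimes> s \<otimes> inv g) \<in> hom G G"
    using assms by (auto intro!: homI simp: conj_mult)
  interpret c: group_hom G G "\<lambda>s. g \<otimes> s \<otimes> inv g"
    by (simp add: group_hom_def group_hom_axioms_def h)
  show ?thesis using c.hom_int_pow[OF assms(2), of i] by simp
qed

text \<open>If conjugation by \<open>g\<close> maps a generator \<open>t\<close> of \<open>L/K\<close> to \<open>t\<^sup>a\<close>, it raises every element of \<open>L/K\<close> to the power \<open>a\<close>.\<close>

lemma cyclic_factor_conj_power:
  assumes K: "K \<lhd> G" and L: "L \<lhd> G" and KL: "K \<subseteq> L" and cyc: "cyclic_group (G\<lparr>carrier := L\<rparr> Mod K)"
    and g: "g \<in> carrier G" and x: "x \<in> L"
  shows "\<exists>a::int. g \<otimes> x \<otimes> inv g \<in> K #> x [^] a"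
proof -
  have sK: "subgroup K G" and sL: "subgroup L G" using K L normal_imp_subgroup by auto
  have Lc: "\<And>x. x \<in> L \<Longrightarrow> x \<in> carrier G" using subgroup.mem_carrier[OF sL] by blast
  have Ln: "\<And>x. x \<in> L \<Longrightarrow> g \<otimes> x \<otimes> inv g \<in> L" using L g unfolding normal_iff by auto
  interpret L: finite_group "G\<lparr>carrier := L\<rparr>" by (rule finite_group_subgroup[OF sL])
  interpret KL: normal K "G\<lparr>carrier := L\<rparr>" by (rule normal_in_subgroup[OF K sL KL])
  define Q where "Q = G\<lparr>carrier := L\<rparr> Mod K"
  interpret Q: group Q unfolding Q_def by (rule KL.factorgroup_is_group)
  have pow_Q: "(K #> y) [^]\<^bsub>Q\<^esub> (i::int) = K #> y [^] i" if "y \<in> L" for y i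
    using KL.FactGroup_int_pow[of y i] int_pow_consistent[OF sL that, of i] that unfolding Q_def by simp
  have carrier_Q: "carrier Q = (\<lambda>x. K #> x) ` L" unfolding Q_def by (simp add: carrier_FactGroup)
  obtain c where c: "c \<in> carrier Q" "carrier Q = range (\<lambda>i::int. c [^]\<^bsub>Q\<^esub> i)"
    using cyc Q.cyclic_group unfolding Q_def by auto
  obtain t where t: "t \<in> L" "c = K #> t" using c(1) carrier_Q by auto
  have "K #> x \<in> carrier Q" "K #> (g \<otimes> t \<otimes> inv g) \<in> carrier Q" using carrier_Q x Ln[OF t(1)] by auto
  then obtain i a :: int where i: "K #> x = c [^]\<^bsub>Q\<^esub> i" and a: "K #> (g \<otimes> t \<otimes> inv g) = c [^]\<^bsub>Q\<^esub> a"
    unfolding c(2) by auto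
  have "K #> x = K #> t [^] i" using i pow_Q[OF t(1)] t(2) by simp
  then have "(\<lambda>y. g \<otimes> y \<otimes> inv g) ` (K #> x) = (\<lambda>y. g \<otimes> y \<otimes> inv g) ` (K #> t [^] i)" by simp
  then have "K #> (g \<otimes> x \<otimes> inv g) = K #> (g \<otimes> t [^] i \<otimes> inv g)"
    using conj_rcoset_normal[OF K g] Lc x t(1) by simp
  also have "\<dots> = K #> (g \<otimes> t \<otimes> inv g) [^] i" using conj_int_pow[OF g Lc[OF t(1)]] by simp
  also have "\<dots> = (c [^]\<^bsub>Q\<^esub> a) [^]\<^bsub>Q\<^esub> i" using pow_Q[OF Ln[OF t(1)]] a by simp
  also have "\<dots> = (c [^]\<^bsub>Q\<^esub> i) [^]\<^bsub>Q\<^esub> a" using Q.int_pow_pow[OF c(1)] by (simp add: mult.commute)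
  also have "\<dots> = K #> x [^] a" using i pow_Q[OF x] by simp
  finally show ?thesis using rcos_self[OF Lc[OF Ln[OF x]] sK] by auto
qed

lemma supersoluble_prime_series:
  assumes ss: "supersoluble G"
    and R: "\<And>U L p. U \<lhd> G \<Longrightarrow> L \<lhd> G \<Longrightarrow> U \<subseteq> L \<Longrightarrow> prime p \<Longrightarrow> card L = p * card U \<Longrightarrow> R U L"
  shows "normal_series G R (carrier G)"
proof -
  have "normal_series G R L" if "normal_series G (\<lambda>K L. cyclic_group (G\<lparr>carrier := L\<rparr> Mod K)) L" for L
    using that
  proof induction
    case trivial
    show ?case by (rule normal_series.trivial)
  next
    case (step K L)
    have "K \<lhd> G" by (rule normal_series_normal[OF step.hyps(1)])
    note conj = cyclic_factor_conj_power[OF this step.hyps(2-4)]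
    show ?case
      by (rule refine_to_prime_factors[OF step.IH _ normal_imp_subgroup[OF step.hyps(2)] step.hyps(3)])
        (fact R, fact conj)
  qed
  then show ?thesis using ss unfolding supersoluble_iff_normal_series by blast
qed

lemma chief_factor_if_prime_index:
  assumes "K \<lhd> G" "L \<lhd> G" "K \<subseteq> L" "prime p" "card L = p * card K"
  shows "chief_factor G L K"
proof -
  have s: "subgroup K G" "subgroup L G" using assms normal_imp_subgroup by auto
  have "maximal_subgroup (G\<lparr>carrier := L\<rparr>) K" using maximal_if_prime_index[OF s(2,1) assms(3-5)] .
  then have max: "K \<subset> L" "\<And>N. subgroup N G \<Longrightarrow> K \<subseteq> N \<Longrightarrow> N \<subseteq> L \<Longrightarrow> N = K \<or> N = L"
    unfolding maximal_subgroup_carrier_iff[OF s(2)] by auto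
  then show ?thesis using assms(1,2) normal_imp_subgroup[of _ G] unfolding chief_factor_def by simp
qed

end

section \<open>Equivalence of the four conditions\<close>

context finite_group
begin

text \<open>Chains are composed along a descending sequence of maximal subgroups from \<open>A\<close> to \<open>H\<close>.\<close>

lemma submodular_if_maximal_submodular:
  assumes max: "\<And>A M. subgroup A G \<Longrightarrow> maximal_subgroup (G\<lparr>carrier := A\<rparr>) M \<Longrightarrow>
      submodular k (G\<lparr>carrier := A\<rparr>) M"
    and A: "subgroup A G" and H: "subgroup H G" "H \<subseteq> A"
  shows "submodular k (G\<lparr>carrier := A\<rparr>) H"
  using A H(2)
proof (induction "card A" arbitrary: A rule: less_induct)
  case less
  note A = less.prems(1)
  interpret A: finite_group "G\<lparr>carrier := A\<rparr>" by (rule finite_group_subgroup[OF A])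
  show ?case
  proof (cases "H = A")
    case True
    then show ?thesis unfolding submodular_def
      by (intro exI[of _ "\<lambda>_. A"] exI[of _ 0]) (use A.subgroup_self in simp)
  next
    case False
    obtain M where M: "maximal_subgroup (G\<lparr>carrier := A\<rparr>) M" "H \<subseteq> M"
      by (rule exists_maximal_subgroup_of[OF A H(1) less.prems(2) False])
    have M': "subgroup M G" "M \<subset> A" using M(1) unfolding maximal_subgroup_carrier_iff[OF A] by auto
    have "card M < card A" using psubset_card_mono[OF _ M'(2)] A by simp
    then have "submodular k (G\<lparr>carrier := M\<rparr>) H" using less.hyps M'(1) M(2) by blast
    then show ?thesis using A.submodular_trans[OF max[OF A M(1)]] by simp
  qed
qed

lemma quotient_index_iff:
  assumes C: "C \<lhd> G"
  shows "order (G Mod C) = i \<longleftrightarrow> order G = i * card C"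
  unfolding order_Mod using index_mult[OF normal_imp_subgroup[OF C]] index_eqI[OF normal_imp_subgroup[OF C]]
  by metis

lemma trivial_quotient_iff:
  assumes C: "C \<lhd> G"
  shows "trivial_group (G Mod C) \<longleftrightarrow> C = carrier G"
proof -
  interpret C: normal C G by (rule C)
  interpret Q: group "G Mod C" by (rule C.factorgroup_is_group)
  have "trivial_group (G Mod C) \<longleftrightarrow> order (G Mod C) = 1"
    unfolding trivial_group_def using Q.order_one_triv_iff Q.is_group by simp
  also have "\<dots> \<longleftrightarrow> order G = card C" using quotient_index_iff[OF C] by simp
  also have "\<dots> \<longleftrightarrow> C = carrier G"
    using subgroup_eq_if_card[OF subgroup_self C.subset] by (auto simp: order_def)
  finally show ?thesis .
qed

abbreviation "prime_power_quotient k C \<equiv> trivial_group (G Mod C) \<or>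
  (\<exists>(q :: nat) n. prime q \<and> 1 \<le> n \<and> n \<le> k \<and> cyclic_group (G Mod C) \<and> order (G Mod C) = q ^ n)"

lemma supersoluble_with_prime_power_quotients:
  assumes hyp: "maximal_prime_indices G"
    and index: "\<And>N J p. J \<lhd> G \<Longrightarrow> N \<lhd> G \<Longrightarrow> J \<subseteq> N \<Longrightarrow> prime p \<Longrightarrow> card N = p * card J \<Longrightarrow>
      cent N J \<noteq> carrier G \<Longrightarrow>
      \<exists>(q :: nat) n. prime q \<and> 1 \<le> n \<and> n \<le> k \<and> order G = q ^ n * card (cent N J)"
  shows "supersoluble G" and "chief_factor G N J \<Longrightarrow> prime_power_quotient k (factor_centralizer G N J)"
proof -
  show "supersoluble G"
    by (rule supersoluble_if_chief_factors_prime) (rule chief_factor_prime_order[OF finite_group_axioms hyp])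
  assume chief: "chief_factor G N J"
  then have N: "N \<lhd> G" and J: "J \<lhd> G" and JN: "J \<subseteq> N" unfolding chief_factor_def by auto
  obtain p where p: "prime p" "card N = p * card J"
    using chief_factor_prime_order[OF finite_group_axioms hyp chief] by blast
  have C: "cent N J \<lhd> G" by (rule cent_normal[OF J N])
  show "prime_power_quotient k (factor_centralizer G N J)"
    unfolding factor_centralizer_eq_cent[OF J N] trivial_quotient_iff[OF C] quotient_index_iff[OF C]
    using index[OF J N JN p] cyclic_factor_centralizer[OF J N JN p] by blast
qed

lemma maximal_modularly_embedded_if_supersoluble:
  assumes ss: "supersoluble G"
    and quot: "\<And>N J. chief_factor G N J \<Longrightarrow> prime_power_quotient k (factor_centralizer G N J)"
    and k: "1 \<le> k" and A: "subgroup A G" and M: "maximal_subgroup (G\<lparr>carrier := A\<rparr>) M"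
  shows "\<exists>n. 1 \<le> n \<and> n \<le> k \<and> modularly_embedded n (G\<lparr>carrier := A\<rparr>) M"
proof -
  have good: "good_factor k J N"
    if J: "J \<lhd> G" and N: "N \<lhd> G" and JN: "J \<subseteq> N" and p: "prime p" "card N = p * card J" for J N p
  proof -
    have C: "cent N J \<lhd> G" by (rule cent_normal[OF J N])
    have "prime_power_quotient k (factor_centralizer G N J)"
      by (rule quot[OF chief_factor_if_prime_index[OF J N JN p]])
    then have "cent N J = carrier G \<or> (\<exists>q n. prime q \<and> n \<le> k \<and> order G = q ^ n * card (cent N J))"
      unfolding factor_centralizer_eq_cent[OF J N] trivial_quotient_iff[OF C] quotient_index_iff[OF C] by blast
    then have "\<exists>q n. prime q \<and> n \<le> k \<and> order G = q ^ n * card (cent N J)"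
    proof
      assume "cent N J = carrier G"
      \<comment> \<open>With exponent \<open>0\<close> any prime will do.\<close>
      then have "prime (2::nat) \<and> 0 \<le> k \<and> order G = 2 ^ 0 * card (cent N J)" by (simp add: order_def)
      then show ?thesis by blast
    qed
    then show ?thesis unfolding good_factor_def using p by blast
  qed
  have "normal_series G (good_factor k) (carrier G)"
    by (rule supersoluble_prime_series[OF ss good])
  then have "normal_series (G\<lparr>carrier := A\<rparr>) (finite_group.good_factor (G\<lparr>carrier := A\<rparr>) k) (carrier G \<inter> A)"
    by (rule normal_series_good_Int[OF _ A])
  moreover have "carrier G \<inter> A = carrier (G\<lparr>carrier := A\<rparr>)" using subgroup.subset[OF A] by auto
  ultimately show ?thesis
    using finite_group.maximal_modularly_embedded_if_good_series[OF finite_group_subgroup[OF A] _ k M] by simp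
qed

lemma LM_group_if_modularly_embedded:
  assumes emb: "\<And>A M. subgroup A G \<Longrightarrow> maximal_subgroup (G\<lparr>carrier := A\<rparr>) M \<Longrightarrow>
      \<exists>n. 1 \<le> n \<and> n \<le> k \<and> modularly_embedded n (G\<lparr>carrier := A\<rparr>) M"
  shows "LM_group k G"
  unfolding LM_group_def
proof (intro allI impI)
  fix A B assume A: "subgroup A G" and B: "subgroup B G"
    and max: "maximal_subgroup (G\<lparr>carrier := generate G (A \<union> B)\<rparr>) A"
  let ?U = "generate G (A \<union> B)"
  have "A \<union> B \<subseteq> carrier G" using subgroup.subset[OF A] subgroup.subset[OF B] by auto
  then have U: "subgroup ?U G" by (rule generate_is_subgroup)
  have BU: "B \<subseteq> ?U" by (auto intro: generate.incl)
  interpret U: finite_group "G\<lparr>carrier := ?U\<rparr>" by (rule finite_group_subgroup[OF U])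
  have "A \<subset> ?U" using max unfolding maximal_subgroup_carrier_iff[OF U] by simp
  then have "\<not> B \<subseteq> A" using generate_subgroup_incl[OF _ A, of "A \<union> B"] by auto
  obtain n where n: "1 \<le> n" "n \<le> k" "modularly_embedded n (G\<lparr>carrier := ?U\<rparr>) A" using emb[OF U max] by auto
  have "subgroup B (G\<lparr>carrier := ?U\<rparr>)" using B BU by (simp add: subgroup_carrier_iff[OF U])
  from U.modularly_embedded_imp_n_maximal_Int[OF n(3,1) max this \<open>\<not> B \<subseteq> A\<close>]
  show "\<exists>(q :: nat) n. prime q \<and> 1 \<le> n \<and> n \<le> k \<and> n_maximal (G\<lparr>carrier := B\<rparr>) n (A \<inter> B) \<and>
        card (rcosets\<^bsub>G\<lparr>carrier := B\<rparr>\<^esub> (A \<inter> B)) = q ^ n"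
    using n(2) by (auto intro: le_trans)
qed

end

theorem theorem2:
  fixes G :: "('a, 'b) monoid_scheme" and k :: nat
  assumes "group G" and "finite (carrier G)" and "k \<ge> 1"
  shows "((\<forall>H. subgroup H G \<longrightarrow> submodular k G H) \<longleftrightarrow>
           (\<forall>A M. subgroup A G \<longrightarrow> maximal_subgroup (G\<lparr>carrier := A\<rparr>) M \<longrightarrow>
              submodular k (G\<lparr>carrier := A\<rparr>) M))
       \<and> ((\<forall>H. subgroup H G \<longrightarrow> submodular k G H) \<longleftrightarrow>
           supersoluble G \<and>
           (\<forall>H K. chief_factor G H K \<longrightarrow>
              trivial_group (G Mod factor_centralizer G H K) \<or>
              (\<exists>(q :: nat) n. prime q \<and> 1 \<le> n \<and> n \<le> k \<and>
                 cyclic_group (G Mod factor_centralizer G H K) \<and>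
                 order (G Mod factor_centralizer G H K) = q ^ n)))
       \<and> ((\<forall>H. subgroup H G \<longrightarrow> submodular k G H) \<longleftrightarrow> LM_group k G)"
    (is "(?one \<longleftrightarrow> ?two) \<and> (?one \<longleftrightarrow> ?three) \<and> (?one \<longleftrightarrow> ?four)")
proof -
  interpret finite_group G
    using assms(1,2) by (simp add: finite_group_def finite_group_axioms_def)
  let ?emb = "\<forall>A M. subgroup A G \<longrightarrow> maximal_subgroup (G\<lparr>carrier := A\<rparr>) M \<longrightarrow>
      (\<exists>n. 1 \<le> n \<and> n \<le> k \<and> modularly_embedded n (G\<lparr>carrier := A\<rparr>) M)"
  have two_emb: "?two \<longleftrightarrow> ?emb"
    using finite_group.maximal_submodular_iff[OF finite_group_subgroup] by simp
  have "?emb" if ?one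
    using that submodular_maximal_in_subgroup maximal_subgroup_carrier_iff by simp
  moreover have "?one" if ?two
  proof (intro allI impI)
    fix H assume H: "subgroup H G"
    show "submodular k G H"
      using submodular_if_maximal_submodular[OF _ subgroup_self H subgroup.subset[OF H], of k] that by simp
  qed
  moreover have "?three" if ?emb
  proof -
    have emb: "\<And>A M. subgroup A G \<Longrightarrow> maximal_subgroup (G\<lparr>carrier := A\<rparr>) M \<Longrightarrow>
        \<exists>n. 1 \<le> n \<and> n \<le> k \<and> modularly_embedded n (G\<lparr>carrier := A\<rparr>) M" using that by blast
    have mpi: "maximal_prime_indices G"
      unfolding maximal_prime_indices_def using emb prime_index_if_modularly_embedded by blast
    have index: "\<exists>(q :: nat) n. prime q \<and> 1 \<le> n \<and> n \<le> k \<and> order G = q ^ n * card (cent N J)"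
      if "J \<lhd> G" "N \<lhd> G" "J \<subseteq> N" "prime p" "card N = p * card J" "cent N J \<noteq> carrier G" for N J p
      by (rule cent_index_if_modularly_embedded[OF emb that])
    show ?thesis
      using supersoluble_with_prime_power_quotients[OF mpi index] by simp
  qed
  moreover have "?emb" if ?three
    using maximal_modularly_embedded_if_supersoluble[OF _ _ assms(3)] that by blast
  moreover have "?four" if ?emb using LM_group_if_modularly_embedded that by blast
  moreover have "?three" if ?four
  proof -
    have mpi: "maximal_prime_indices G" by (rule LM_group_imp_maximal_prime_indices[OF that])
    have index: "\<exists>(q :: nat) n. prime q \<and> 1 \<le> n \<and> n \<le> k \<and> order G = q ^ n * card (cent N J)"
      if "J \<lhd> G" "N \<lhd> G" "J \<subseteq> N" "prime p" "card N = p * card J" "cent N J \<noteq> carrier G" for N J p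
      by (rule cent_index_if_LM_group[OF \<open>?four\<close> that])
    show ?thesis
      using supersoluble_with_prime_power_quotients[OF mpi index] by simp
  qed
  ultimately show ?thesis using two_emb by argo
qed

end
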